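(* Let $\mathscr{A}$ be a toric arrangement in $(\mathbb{C}^\times)^{d+1}$, suppose $\mathscr{P}(\mathscr{A}_Y)$ is a corank-one M-ideal of $\mathscr{P}(\mathscr{A})$, and let $\mathscr{B}=\mathscr{A}/Y$. Let $f(\mathbf{x},y)=y\prod_{j=1}^l(y^{m_{j,0}}-\mu_j\mathbf{x}^{\mathbf{m}_j})$ be the associated Weierstrass polynomial, of degree $n$ in $y$. (1) The bundle $\bar p\colon M(\mathscr{A})\to M(\mathscr{B})$ is the pullback of $\pi\colon\mathrm{Conf}^{(n,1)}(\mathbb{C})\to\mathrm{Conf}_n(\mathbb{C})/\Sigma_n$ along the coefficient map $\mathbf{a}\colon M(\mathscr{B})\to\mathrm{Conf}_n(\mathbb{C})/\Sigma_n$ sending $\mathbf{x}$ to (the set of roots of) the polynomial $y\prod_{j=1}^l(y^{m_{j,0}}-\mu_j\mathbf{x}^{\mathbf{m}_j})\in\mathbb{C}[y]$. The monodromy of the bundle $\bar p\colon M(\mathscr{A})\to M(\mathscr{B})$ factors as $\alpha_n\circ\mathbf{a}_\sharp$, where $\alpha_n\colon B_n\to\mathrm{Aut}(F_n)$ is the Artin representation. (2) If $\mathscr{P}(\mathscr{A}_Y)$ is a TM-ideal (so that $m_{j,0}=1$ for all $j$ and $n=l+1$), the bundle $\bar p\colon M(\mathscr{A})\to M(\mathscr{B})$ is the pullback of $\pi\colon\mathrm{Conf}_{n+1}(\mathbb{C})\to\mathrm{Conf}_n(\mathbb{C})$ along the root map $\mathbf{b}\colon M(\mathscr{B})\to\mathrm{Conf}_n(\mathbb{C})$,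 $\mathbf{x}\mapsto(0,\mu_1\mathbf{x}^{\mathbf{m}_1},\dots,\mu_l\mathbf{x}^{\mathbf{m}_l})$. The monodromy of the bundle $\bar p\colon M(\mathscr{A})\to M(\mathscr{B})$ factors as $\hat\alpha_n\circ\mathbf{b}_\sharp$, where $\hat\alpha_n\colon P_n\to\mathrm{Aut}(F_n)$ is the restriction of the Artin representation to the pure braid group.
   Context: Toric arrangements. Let $\Gamma$ be a finitely generated free abelian group and $T=\mathrm{Hom}(\Gamma,\mathbb{C}^\times)$. For $\chi\in\Gamma$ put $H_\chi=\{t\in T\mid t(\chi)=1\}$. A toric arrangement $\mathscr{A}$ in $T$ is the set of all connected components of the $H_\chi$, $\chi\in\mathfrak{X}$, for a finite set $\mathfrak{X}\subseteq\Gamma\smallsetminus\{0\}$; its complement is $M(\mathscr{A})=T\smallsetminus\bigcup_{\chi\in\mathfrak X}H_\chi$; its poset of layers $\mathscr{P}(\mathscr{A})$ consists of the nonempty connected components of intersections $\bigcap_{\chi\in S}H_\chi$, $S\subseteq\mathfrak{X}$, ordered by reverse inclusion. A subgroup $Y\subseteq T$ is admissible if there is a decomposition $\Gamma=\Gamma'\oplus\Gamma''$ with $\Gamma'$ of rank one and $Y=\{t\mid t|_{\Gamma''}\equiv1\}$. Let $p\colon T\to T/Y\cong\mathrm{Hom}(\Gamma'',\mathbb{C}^\times)$ be the projection, $\mathscr{A}_Y=\{H\in\mathscr{A}\mid H\text{ is a union of cosets of }Y\}$, $\mathscr{A}/Y=\{p(H)\mid H\in\mathscr{A}_Y\}$ (a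 toric arrangement in $T/Y$), and $\bar p\colon M(\mathscr{A})\to M(\mathscr{A}/Y)$ the restriction of $p$. $\mathscr{P}(\mathscr{A}_Y)$ is an M-ideal of $\mathscr{P}(\mathscr{A})$ if for any distinct $H_1,H_2\in\mathscr{A}\smallsetminus\mathscr{A}_Y$ and any connected component $X$ of $H_1\cap H_2$ there is $H_3\in\mathscr{A}_Y$ with $H_3\supseteq X$; it is a TM-ideal if in addition $H\cap Y$ is connected for all $H\in\mathscr{A}\smallsetminus\mathscr{A}_Y$. "Corank-one" means $Y$ is admissible and the rank of $\mathscr{P}(\mathscr{A}_Y)$ is one less than that of $\mathscr{P}(\mathscr{A})$. Coordinates. Choose coordinates $(x_1,\dots,x_d,y)=(\mathbf{x},y)$ on $T\cong(\mathbb{C}^\times)^{d+1}$ so that $Y=\{\mathbf{x}=(1,\dots,1)\}$ and $p(\mathbf{x},y)=\mathbf{x}$. Write $\mathscr{A}\smallsetminus\mathscr{A}_Y=\{H_1,\dots,H_l\}$. Each $H_j$ is given by an equation $y^{m_{j,0}}-\mu_j\mathbf{x}^{\mathbf{m}_j}=0$ with $m_{j,0}$ a positive integer, $\mathbf{m}_j=(m_{j,1},\dots,m_{j,d})\in\mathbb{Z}^d$, $\mathbf{x}^{\mathbf{m}_j}=x_1^{m_{j,1}}\cdots x_d^{m_{j,d}}$, $\mu_j$ a root of unity, and the vector $(m_{j,0},m_{j,1},\dots,m_{j,d})$ primitive. For $\mathbf{x}\in M(\mathscr{B})$ the polynomial $f(\mathbf{x},y)\in\mathbb{C}[y]$ has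 $n=1+\sum_j m_{j,0}$ distinct roots. Configuration spaces. $\mathrm{Conf}_k(\mathbb{C})$ is the space of ordered $k$-tuples of distinct points; $\mathrm{Conf}_n(\mathbb{C})/\Sigma_n$ is the unordered configuration space (identified with monic degree $n$ polynomials with distinct roots); $\mathrm{Conf}^{(n,1)}(\mathbb{C})=\mathrm{Conf}_{n+1}(\mathbb{C})/(\Sigma_n\times\Sigma_1)$ consists of pairs $(S,z)$ with $S\subset\mathbb{C}$, $|S|=n$, $z\in\mathbb{C}\smallsetminus S$; the maps $\pi$ forget the last point. Monodromy. For a fiber bundle $E\to B$ with fiber $F$ and a fixed section, the split exact sequence $1\to\pi_1(F)\to\pi_1(E)\to\pi_1(B)\to1$ gives an action of $\pi_1(B)$ on $\pi_1(F)$; the corresponding homomorphism $\pi_1(B)\to\mathrm{Aut}(\pi_1(F))$ is the monodromy, where $\mathrm{Aut}$ is the group of right automorphisms (product $\alpha\cdot\beta=\beta\circ\alpha$). The bundles $\pi$ have the sections $S\mapsto(S,\max_{s\in S}|s|+1)$ (and the analogous formula in the ordered case); $\bar p$ is given the pulled-back section. $f_\sharp$ denotes the map on fundamental groups induced by $f$. Artin representation. $B_n=\pi_1(\mathrm{Conf}_n(\mathbb{C})/\Sigma_n)$ is the braid group with standard generators $\sigma_1,\dots,\sigma_{n-1}$, $P_n=\pi_1(\mathrm{Conf}_n(\mathbb{C}))<B_n$ is the pure braid group, and $F_n=\langle \mathsf{y}_1,\dots,\mathsf{y}_n\rangle$ is the fundamental group of the fiber ($\mathbb{C}$ minus $n$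 points). The Artin representation is $\alpha_n(\sigma_i)(\mathsf{y}_i)=\mathsf{y}_i\mathsf{y}_{i+1}\mathsf{y}_i^{-1}$, $\alpha_n(\sigma_i)(\mathsf{y}_{i+1})=\mathsf{y}_i$, $\alpha_n(\sigma_i)(\mathsf{y}_j)=\mathsf{y}_j$ otherwise. The standard identifications are chosen so that the monodromy of $\pi\colon\mathrm{Conf}^{(n,1)}(\mathbb{C})\to\mathrm{Conf}_n(\mathbb{C})/\Sigma_n$ is $\alpha_n$, and that of $\mathrm{Conf}_{n+1}(\mathbb{C})\to\mathrm{Conf}_n(\mathbb{C})$ is $\hat\alpha_n=\alpha_n|_{P_n}$ (known facts). *)

theory Defs
  imports
    "HOL-Analysis.Analysis"
    "HOL-Algebra.Bij"
    "HOL-Algebra.Elementary_Groups"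
    "HOL-Algebra.FiniteProduct"
    "HOL-Computational_Algebra.Polynomial"
begin

definition path_homotopic :: "'a topology \<Rightarrow> 'a \<Rightarrow> (real \<Rightarrow> 'a) \<Rightarrow> (real \<Rightarrow> 'a) \<Rightarrow> bool" where
  "path_homotopic X x0 p q \<longleftrightarrow>
     homotopic_with (\<lambda>r. r 0 = x0 \<and> r 1 = x0) (top_of_set {0..1}) X p q"

definition loops :: "'a topology \<Rightarrow> 'a \<Rightarrow> (real \<Rightarrow> 'a) set" where
  "loops X x0 = {p. pathin X p \<and> p 0 = x0 \<and> p 1 = x0}"

text \<open>The library's \<^const>\<open>joinpaths\<close> is restricted to types of class \<^class>\<open>topological_space\<close>.\<close>

definition path_concat :: "(real \<Rightarrow> 'a) \<Rightarrow> (real \<Rightarrow> 'a) \<Rightarrow> real \<Rightarrow> 'a" where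
  "path_concat p q = (\<lambda>s. if s \<le> 1/2 then p (2 * s) else q (2 * s - 1))"

definition loop_class :: "'a topology \<Rightarrow> 'a \<Rightarrow> (real \<Rightarrow> 'a) \<Rightarrow> (real \<Rightarrow> 'a) set" where
  "loop_class X x0 p = {q. path_homotopic X x0 p q}"

text \<open>The product traverses its left factor first.\<close>

definition fundamental_group :: "'a topology \<Rightarrow> 'a \<Rightarrow> (real \<Rightarrow> 'a) set monoid" where
  "fundamental_group X x0 =
     \<lparr>carrier = loop_class X x0 ` loops X x0,
      monoid.mult = (\<lambda>P Q. \<Union>p\<in>P. \<Union>q\<in>Q. loop_class X x0 (path_concat p q)),
      one = loop_class X x0 (\<lambda>_. x0)\<rparr>"

definition induced_map ::
  "'b topology \<Rightarrow> 'b \<Rightarrow> ('a \<Rightarrow> 'b) \<Rightarrow> (real \<Rightarrow> 'a) set \<Rightarrow> (real \<Rightarrow> 'b) set" where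
  "induced_map Y y0 f P = (\<Union>p\<in>P. loop_class Y y0 (f \<circ> p))"

definition fiber_bundle ::
  "'e topology \<Rightarrow> 'b topology \<Rightarrow> ('e \<Rightarrow> 'b) \<Rightarrow> 'f topology \<Rightarrow> bool" where
  "fiber_bundle E B p F \<longleftrightarrow> continuous_map E B p \<and>
     (\<forall>b\<in>topspace B. \<exists>U. openin B U \<and> b \<in> U \<and>
        (\<exists>\<phi>. homeomorphic_map (subtopology E {t \<in> topspace E. p t \<in> U})
                (prod_topology (subtopology B U) F) \<phi> \<and>
             (\<forall>t\<in>topspace E. p t \<in> U \<longrightarrow> fst (\<phi> t) = p t)))"

text \<open>\<open>p' : E' \<rightarrow> B'\<close> is the pullback of \<open>p : E \<rightarrow> B\<close> along \<open>f : B' \<rightarrow> B\<close>, the canonical map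
  \<open>E' \<rightarrow> E\<close> being \<open>g\<close>.\<close>

definition is_pullback ::
  "'x topology \<Rightarrow> 'c topology \<Rightarrow> ('x \<Rightarrow> 'c) \<Rightarrow> 'e topology \<Rightarrow> 'b topology \<Rightarrow> ('e \<Rightarrow> 'b)
   \<Rightarrow> ('c \<Rightarrow> 'b) \<Rightarrow> ('x \<Rightarrow> 'e) \<Rightarrow> bool" where
  "is_pullback E' B' p' E B p f g \<longleftrightarrow>
     continuous_map B' B f \<and>
     homeomorphic_map E'
       (subtopology (prod_topology B' E) {(x, t). f x = p t}) (\<lambda>t. (p' t, g t))"

definition pullback_section ::
  "'x topology \<Rightarrow> ('x \<Rightarrow> 'c) \<Rightarrow> ('x \<Rightarrow> 'e) \<Rightarrow> ('c \<Rightarrow> 'b) \<Rightarrow> ('b \<Rightarrow> 'e) \<Rightarrow> 'c \<Rightarrow> 'x" where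
  "pullback_section E' p' g f s =
     (\<lambda>x. the_inv_into (topspace E') (\<lambda>t. (p' t, g t)) (x, s (f x)))"

text \<open>A parametrization \<open>i\<close> of the fiber of \<open>p\<close> over \<open>f x0\<close> yields one of the fiber of \<open>p'\<close> over
  \<open>x0\<close>.\<close>

definition pullback_fiber ::
  "'x topology \<Rightarrow> ('x \<Rightarrow> 'c) \<Rightarrow> ('x \<Rightarrow> 'e) \<Rightarrow> 'c \<Rightarrow> ('f \<Rightarrow> 'e) \<Rightarrow> 'f \<Rightarrow> 'x" where
  "pullback_fiber E' p' g x0 i =
     (\<lambda>z. the_inv_into (topspace E') (\<lambda>t. (p' t, g t)) (x0, i z))"

text \<open>For a bundle \<open>E \<rightarrow> B\<close> with section \<open>s\<close> and fiber \<open>i : F \<rightarrow> E\<close> over the base point \<open>b0\<close>,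
  where \<open>i f0 = s b0\<close>, the sequence \<open>1 \<rightarrow> \<pi>\<^sub>1(F) \<rightarrow> \<pi>\<^sub>1(E) \<rightarrow> \<pi>\<^sub>1(B) \<rightarrow> 1\<close> is split exact and
  \<open>\<pi>\<^sub>1(B)\<close> acts on \<open>\<pi>\<^sub>1(F)\<close> from the right by \<open>\<gamma>\<^sup>\<beta> = s(\<beta>)\<^sup>-\<^sup>1 \<gamma> s(\<beta>)\<close>.\<close>

definition monodromy ::
  "'f topology \<Rightarrow> 'f \<Rightarrow> ('f \<Rightarrow> 'e) \<Rightarrow> 'e topology \<Rightarrow> 'b topology \<Rightarrow> ('b \<Rightarrow> 'e) \<Rightarrow> 'b
   \<Rightarrow> (real \<Rightarrow> 'b) set \<Rightarrow> (real \<Rightarrow> 'f) set \<Rightarrow> (real \<Rightarrow> 'f) set" where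
  "monodromy F f0 i E B s b0 =
     (\<lambda>\<beta>\<in>carrier (fundamental_group B b0). \<lambda>\<gamma>\<in>carrier (fundamental_group F f0).
        THE \<delta>. \<delta> \<in> carrier (fundamental_group F f0) \<and>
          induced_map E (s b0) i \<delta> =
            inv\<^bsub>fundamental_group E (s b0)\<^esub> (induced_map E (s b0) s \<beta>)
              \<otimes>\<^bsub>fundamental_group E (s b0)\<^esub> induced_map E (s b0) i \<gamma>
              \<otimes>\<^bsub>fundamental_group E (s b0)\<^esub> induced_map E (s b0) s \<beta>)"

text \<open>Right automorphisms: the product of \<open>\<phi>\<close> and \<open>\<psi>\<close> is \<open>\<psi> \<circ> \<phi>\<close>, opposite to
  \<^const>\<open>AutoGroup\<close>.\<close>

definition right_aut :: "('a, 'b) monoid_scheme \<Rightarrow> ('a \<Rightarrow> 'a) monoid" where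
  "right_aut G =
     \<lparr>carrier = auto G, monoid.mult = (\<lambda>\<phi> \<psi>. compose (carrier G) \<psi> \<phi>), one = (\<lambda>x\<in>carrier G. x)\<rparr>"

definition quotient_topology :: "'a topology \<Rightarrow> ('a \<Rightarrow> 'b) \<Rightarrow> 'b topology" where
  "quotient_topology X f =
     topology (\<lambda>U. U \<subseteq> f ` topspace X \<and> openin X {x \<in> topspace X. f x \<in> U})"

lemma openin_quotient_topology:
  "openin (quotient_topology X f) U \<longleftrightarrow>
     U \<subseteq> f ` topspace X \<and> openin X {x \<in> topspace X. f x \<in> U}"
proof -
  have "istopology (\<lambda>U. U \<subseteq> f ` topspace X \<and> openin X {x \<in> topspace X. f x \<in> U})"
    unfolding istopology_def
  proof (intro conjI allI impI)
    fix S T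
    assume "S \<subseteq> f ` topspace X \<and> openin X {x \<in> topspace X. f x \<in> S}"
      and "T \<subseteq> f ` topspace X \<and> openin X {x \<in> topspace X. f x \<in> T}"
    moreover have "{x \<in> topspace X. f x \<in> S \<inter> T} =
        {x \<in> topspace X. f x \<in> S} \<inter> {x \<in> topspace X. f x \<in> T}" by auto
    ultimately show "S \<inter> T \<subseteq> f ` topspace X" "openin X {x \<in> topspace X. f x \<in> S \<inter> T}"
      by (auto intro: openin_Int)
  next
    fix K
    assume K: "\<forall>S\<in>K. S \<subseteq> f ` topspace X \<and> openin X {x \<in> topspace X. f x \<in> S}"
    then show "\<Union>K \<subseteq> f ` topspace X" by blast
    have "{x \<in> topspace X. f x \<in> \<Union>K} = (\<Union>S\<in>K. {x \<in> topspace X. f x \<in> S})" by auto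
    with K show "openin X {x \<in> topspace X. f x \<in> \<Union>K}" by (auto intro!: openin_Union)
  qed
  then show ?thesis by (simp add: quotient_topology_def topology_inverse')
qed

lemma quotient_map_quotient_topology: "quotient_map X (quotient_topology X f) f"
proof -
  have "topspace (quotient_topology X f) = f ` topspace X"
  proof
    show "topspace (quotient_topology X f) \<subseteq> f ` topspace X"
      unfolding topspace_def[of "quotient_topology X f"] openin_quotient_topology by blast
    have "{x \<in> topspace X. f x \<in> f ` topspace X} = topspace X" by auto
    then show "f ` topspace X \<subseteq> topspace (quotient_topology X f)"
      by (intro openin_subset) (simp add: openin_quotient_topology)
  qed
  then show ?thesis by (auto simp: quotient_map_def openin_quotient_topology)
qed

definition conf :: "nat \<Rightarrow> (nat \<Rightarrow> complex) topology" where
  "conf k = subtopology (product_topology (\<lambda>_. euclidean) {..<k}) {c. inj_on c {..<k}}"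

text \<open>Two configurations lie in the same orbit of the symmetric group on the coordinates iff they
  have the same underlying set of points, so orbits are represented by these sets.\<close>

definition uconf :: "nat \<Rightarrow> complex set topology" where
  "uconf k = quotient_topology (conf k) (\<lambda>c. c ` {..<k})"

definition conf_pt :: "nat \<Rightarrow> (complex set \<times> complex) topology" where
  "conf_pt n = quotient_topology (conf (n + 1)) (\<lambda>c. (c ` {..<n}, c n))"

definition far_point :: "complex set \<Rightarrow> complex" where
  "far_point S = of_real (Max (cmod ` S) + 1)"

definition uconf_section :: "complex set \<Rightarrow> complex set \<times> complex" where
  "uconf_section S = (S, far_point S)"

definition conf_section :: "nat \<Rightarrow> (nat \<Rightarrow> complex) \<Rightarrow> nat \<Rightarrow> complex" where
  "conf_section n c = c(n := far_point (c ` {..<n}))"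

definition word_value :: "('a, 'b) monoid_scheme \<Rightarrow> (nat \<Rightarrow> 'a) \<Rightarrow> (nat \<times> bool) list \<Rightarrow> 'a" where
  "word_value G y w = foldr (\<lambda>(i, b) g. (if b then y i else inv\<^bsub>G\<^esub> y i) \<otimes>\<^bsub>G\<^esub> g) w \<one>\<^bsub>G\<^esub>"

definition reduced_word :: "(nat \<times> bool) list \<Rightarrow> bool" where
  "reduced_word w \<longleftrightarrow>
     (\<forall>k. Suc k < length w \<longrightarrow> fst (w ! k) = fst (w ! Suc k) \<longrightarrow> snd (w ! k) = snd (w ! Suc k))"

definition free_basis :: "('a, 'b) monoid_scheme \<Rightarrow> (nat \<Rightarrow> 'a) \<Rightarrow> nat set \<Rightarrow> bool" where
  "free_basis G y I \<longleftrightarrow> y ` I \<subseteq> carrier G \<and> generate G (y ` I) = carrier G \<and>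
     (\<forall>w. w \<noteq> [] \<and> fst ` set w \<subseteq> I \<and> reduced_word w \<longrightarrow> word_value G y w \<noteq> \<one>\<^bsub>G\<^esub>)"

definition braid_group :: "nat \<Rightarrow> complex set \<Rightarrow> (real \<Rightarrow> complex set) set monoid" where
  "braid_group n S0 = fundamental_group (uconf n) S0"

definition pure_braid_group ::
  "nat \<Rightarrow> (nat \<Rightarrow> complex) \<Rightarrow> (real \<Rightarrow> nat \<Rightarrow> complex) set monoid" where
  "pure_braid_group n c0 = fundamental_group (conf n) c0"

definition fiber_group :: "complex set \<Rightarrow> (real \<Rightarrow> complex) set monoid" where
  "fiber_group S0 = fundamental_group (top_of_set (- S0)) (far_point S0)"

text \<open>\<open>\<alpha>\<close> is determined by the generators \<open>\<sigma>\<close> and the free basis \<open>y\<close>.\<close>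

definition artin_representation ::
  "nat \<Rightarrow> complex set \<Rightarrow> (nat \<Rightarrow> (real \<Rightarrow> complex set) set) \<Rightarrow> (nat \<Rightarrow> (real \<Rightarrow> complex) set)
   \<Rightarrow> ((real \<Rightarrow> complex set) set \<Rightarrow> (real \<Rightarrow> complex) set \<Rightarrow> (real \<Rightarrow> complex) set) \<Rightarrow> bool" where
  "artin_representation n S0 \<sigma> y \<alpha> \<longleftrightarrow>
     \<sigma> ` {1..n-1} \<subseteq> carrier (braid_group n S0) \<and>
     generate (braid_group n S0) (\<sigma> ` {1..n-1}) = carrier (braid_group n S0) \<and>
     free_basis (fiber_group S0) y {1..n} \<and>
     \<alpha> \<in> hom (braid_group n S0) (right_aut (fiber_group S0)) \<and>
     (\<forall>i\<in>{1..n-1}.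
        \<alpha> (\<sigma> i) (y i) =
          y i \<otimes>\<^bsub>fiber_group S0\<^esub> y (i + 1) \<otimes>\<^bsub>fiber_group S0\<^esub> inv\<^bsub>fiber_group S0\<^esub> y i \<and>
        \<alpha> (\<sigma> i) (y (i + 1)) = y i \<and>
        (\<forall>j\<in>{1..n} - {i, i + 1}. \<alpha> (\<sigma> i) (y j) = y j))"

text \<open>The generators \<open>\<sigma>\<close> and the free basis \<open>y\<close> at the base configuration \<open>S0\<close> are
  standard if they are chosen so that the monodromy of the bundle of configurations with an
  additional point is the Artin representation.\<close>

definition standard_artin_representation ::
  "nat \<Rightarrow> complex set \<Rightarrow> (nat \<Rightarrow> (real \<Rightarrow> complex set) set) \<Rightarrow> (nat \<Rightarrow> (real \<Rightarrow> complex) set)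
   \<Rightarrow> ((real \<Rightarrow> complex set) set \<Rightarrow> (real \<Rightarrow> complex) set \<Rightarrow> (real \<Rightarrow> complex) set) \<Rightarrow> bool" where
  "standard_artin_representation n S0 \<sigma> y \<alpha> \<longleftrightarrow>
     artin_representation n S0 \<sigma> y \<alpha> \<and>
     (\<forall>\<beta>\<in>carrier (braid_group n S0).
        monodromy (top_of_set (- S0)) (far_point S0) (\<lambda>z. (S0, z))
          (conf_pt n) (uconf n) uconf_section S0 \<beta> = \<alpha> \<beta>)"

text \<open>The inclusion of pure braids into braids is induced by the covering map that forgets the
  ordering.\<close>

definition pure_artin_representation ::
  "nat \<Rightarrow> complex set
   \<Rightarrow> ((real \<Rightarrow> complex set) set \<Rightarrow> (real \<Rightarrow> complex) set \<Rightarrow> (real \<Rightarrow> complex) set)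
   \<Rightarrow> (real \<Rightarrow> nat \<Rightarrow> complex) set \<Rightarrow> (real \<Rightarrow> complex) set \<Rightarrow> (real \<Rightarrow> complex) set" where
  "pure_artin_representation n S0 \<alpha> \<beta> = \<alpha> (induced_map (uconf n) S0 (\<lambda>c. c ` {..<n}) \<beta>)"

definition cstar :: "complex monoid" where
  "cstar = \<lparr>carrier = - {0}, monoid.mult = (*), one = 1\<rparr>"

text \<open>The lattice of characters \<open>\<Gamma>\<close> is written multiplicatively.\<close>

definition torus :: "'g monoid \<Rightarrow> ('g \<Rightarrow> complex) set" where
  "torus \<Gamma> = hom \<Gamma> cstar \<inter> extensional (carrier \<Gamma>)"

definition torus_group :: "'g monoid \<Rightarrow> ('g \<Rightarrow> complex) monoid" where
  "torus_group \<Gamma> = \<lparr>carrier = torus \<Gamma>, monoid.mult = (\<lambda>s t. \<lambda>g\<in>carrier \<Gamma>. s g * t g),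
                    one = (\<lambda>g\<in>carrier \<Gamma>. 1)\<rparr>"

definition torus_topology :: "'g monoid \<Rightarrow> ('g \<Rightarrow> complex) topology" where
  "torus_topology \<Gamma> = subtopology (product_topology (\<lambda>_. euclidean) (carrier \<Gamma>)) (torus \<Gamma>)"

definition character_kernel :: "'g monoid \<Rightarrow> 'g \<Rightarrow> ('g \<Rightarrow> complex) set" where
  "character_kernel \<Gamma> \<xi> = {t \<in> torus \<Gamma>. t \<xi> = 1}"

definition components_in :: "'g monoid \<Rightarrow> ('g \<Rightarrow> complex) set \<Rightarrow> ('g \<Rightarrow> complex) set set" where
  "components_in \<Gamma> S = connected_components_of (subtopology (torus_topology \<Gamma>) S)"

definition arrangement_of :: "'g monoid \<Rightarrow> 'g set \<Rightarrow> ('g \<Rightarrow> complex) set set" where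
  "arrangement_of \<Gamma> X = (\<Union>\<xi>\<in>X. components_in \<Gamma> (character_kernel \<Gamma> \<xi>))"

definition toric_arrangement :: "'g monoid \<Rightarrow> ('g \<Rightarrow> complex) set set \<Rightarrow> bool" where
  "toric_arrangement \<Gamma> A \<longleftrightarrow>
     (\<exists>X. finite X \<and> X \<subseteq> carrier \<Gamma> - {\<one>\<^bsub>\<Gamma>\<^esub>} \<and> A = arrangement_of \<Gamma> X)"

definition complement_space ::
  "'g monoid \<Rightarrow> ('g \<Rightarrow> complex) set set \<Rightarrow> ('g \<Rightarrow> complex) topology" where
  "complement_space \<Gamma> A = subtopology (torus_topology \<Gamma>) (torus \<Gamma> - \<Union>A)"

text \<open>Layers are described here through the members of an arrangement instead of its defining
  characters; \<open>layers_arrangement_of\<close> below shows that this makes no difference. The order on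
  layers is reverse inclusion.\<close>

definition layers :: "'g monoid \<Rightarrow> ('g \<Rightarrow> complex) set set \<Rightarrow> ('g \<Rightarrow> complex) set set" where
  "layers \<Gamma> A = (\<Union>S\<in>Pow A. components_in \<Gamma> (torus \<Gamma> \<inter> \<Inter>S))"

definition poset_rank :: "'a set set \<Rightarrow> nat" where
  "poset_rank P = Max {card C - 1 | C. finite C \<and> C \<subseteq> P \<and> chain_subset C}"

definition admissible :: "'g monoid \<Rightarrow> ('g \<Rightarrow> complex) set \<Rightarrow> bool" where
  "admissible \<Gamma> Y \<longleftrightarrow>
     (\<exists>\<Gamma>1 \<Gamma>2. subgroup \<Gamma>1 \<Gamma> \<and> subgroup \<Gamma>2 \<Gamma> \<and>
        \<Gamma>1 \<inter> \<Gamma>2 = {\<one>\<^bsub>\<Gamma>\<^esub>} \<and> \<Gamma>1 <#>\<^bsub>\<Gamma>\<^esub> \<Gamma>2 = carrier \<Gamma> \<and>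
        \<Gamma>\<lparr>carrier := \<Gamma>1\<rparr> \<cong> integer_group \<and>
        Y = {t \<in> torus \<Gamma>. \<forall>g\<in>\<Gamma>2. t g = 1})"

definition sub_arrangement ::
  "'g monoid \<Rightarrow> ('g \<Rightarrow> complex) set set \<Rightarrow> ('g \<Rightarrow> complex) set \<Rightarrow> ('g \<Rightarrow> complex) set set" where
  "sub_arrangement \<Gamma> A Y = {H \<in> A. \<exists>\<C>. \<C> \<subseteq> rcosets\<^bsub>torus_group \<Gamma>\<^esub> Y \<and> H = \<Union>\<C>}"

definition corank_one ::
  "'g monoid \<Rightarrow> ('g \<Rightarrow> complex) set set \<Rightarrow> ('g \<Rightarrow> complex) set \<Rightarrow> bool" where
  "corank_one \<Gamma> A Y \<longleftrightarrow> admissible \<Gamma> Y \<and>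
     poset_rank (layers \<Gamma> (sub_arrangement \<Gamma> A Y)) + 1 = poset_rank (layers \<Gamma> A)"

definition M_ideal ::
  "'g monoid \<Rightarrow> ('g \<Rightarrow> complex) set set \<Rightarrow> ('g \<Rightarrow> complex) set \<Rightarrow> bool" where
  "M_ideal \<Gamma> A Y \<longleftrightarrow>
     (\<forall>H1\<in>A - sub_arrangement \<Gamma> A Y. \<forall>H2\<in>A - sub_arrangement \<Gamma> A Y. H1 \<noteq> H2 \<longrightarrow>
        (\<forall>X\<in>components_in \<Gamma> (H1 \<inter> H2). \<exists>H3\<in>sub_arrangement \<Gamma> A Y. X \<subseteq> H3))"

definition TM_ideal ::
  "'g monoid \<Rightarrow> ('g \<Rightarrow> complex) set set \<Rightarrow> ('g \<Rightarrow> complex) set \<Rightarrow> bool" where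
  "TM_ideal \<Gamma> A Y \<longleftrightarrow> M_ideal \<Gamma> A Y \<and>
     (\<forall>H\<in>A - sub_arrangement \<Gamma> A Y. connectedin (torus_topology \<Gamma>) (H \<inter> Y))"

lemma components_in_iff:
  "C \<in> components_in \<Gamma> S \<longleftrightarrow>
     C \<noteq> {} \<and> C \<subseteq> S \<and> connectedin (torus_topology \<Gamma>) C \<and>
     (\<forall>D. connectedin (torus_topology \<Gamma>) D \<and> D \<subseteq> S \<and> C \<subseteq> D \<longrightarrow> D = C)"
proof
  assume C: "C \<in> components_in \<Gamma> S"
  then have con: "connectedin (subtopology (torus_topology \<Gamma>) S) C"
    and max: "\<And>D. connectedin (subtopology (torus_topology \<Gamma>) S) D \<Longrightarrow> \<not> disjnt C D \<Longrightarrow> D \<subseteq> C"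
    and ne: "C \<noteq> {}"
    unfolding components_in_def
    using connectedin_connected_components_of nonempty_connected_components_of
      connected_components_of_maximal by metis+
  show "C \<noteq> {} \<and> C \<subseteq> S \<and> connectedin (torus_topology \<Gamma>) C \<and>
     (\<forall>D. connectedin (torus_topology \<Gamma>) D \<and> D \<subseteq> S \<and> C \<subseteq> D \<longrightarrow> D = C)"
  proof (intro conjI allI impI)
    fix D
    assume D: "connectedin (torus_topology \<Gamma>) D \<and> D \<subseteq> S \<and> C \<subseteq> D"
    then have "connectedin (subtopology (torus_topology \<Gamma>) S) D"
      by (simp add: connectedin_subtopology)
    moreover have "\<not> disjnt C D" using D ne by (auto simp: disjnt_def)
    ultimately show "D = C" using max D by blast
  qed (use con ne in \<open>auto simp: connectedin_subtopology\<close>)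
next
  assume C: "C \<noteq> {} \<and> C \<subseteq> S \<and> connectedin (torus_topology \<Gamma>) C \<and>
     (\<forall>D. connectedin (torus_topology \<Gamma>) D \<and> D \<subseteq> S \<and> C \<subseteq> D \<longrightarrow> D = C)"
  then obtain x where x: "x \<in> C" by blast
  let ?Z = "subtopology (torus_topology \<Gamma>) S"
  have con: "connectedin ?Z C" using C by (simp add: connectedin_subtopology)
  then have xt: "x \<in> topspace ?Z" using x connectedin_subset_topspace by blast
  have sub: "C \<subseteq> connected_component_of_set ?Z x"
    using con x by (simp add: connected_component_of_maximal)
  have "connectedin ?Z (connected_component_of_set ?Z x)"
    by (rule connectedin_connected_component_of)
  then have "connected_component_of_set ?Z x = C"
    using C sub by (simp add: connectedin_subtopology)
  then show "C \<in> components_in \<Gamma> S"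
    unfolding components_in_def connected_components_of_def using xt by blast
qed

lemma component_exists:
  assumes "connectedin (torus_topology \<Gamma>) D" "D \<noteq> {}" "D \<subseteq> S"
  obtains K where "K \<in> components_in \<Gamma> S" "D \<subseteq> K"
proof -
  let ?Z = "subtopology (torus_topology \<Gamma>) S"
  obtain x where x: "x \<in> D" using assms by blast
  have con: "connectedin ?Z D" using assms by (simp add: connectedin_subtopology)
  then have "x \<in> topspace ?Z" using x connectedin_subset_topspace by blast
  moreover have "D \<subseteq> connected_component_of_set ?Z x"
    using con x by (simp add: connected_component_of_maximal)
  ultimately show ?thesis
    using that unfolding components_in_def connected_components_of_def by blast
qed

lemma components_in_unique:
  assumes "K \<in> components_in \<Gamma> S" "D \<subseteq> S" "connectedin (torus_topology \<Gamma>) D" "D \<inter> K \<noteq> {}"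
  shows "D \<subseteq> K"
proof -
  have "connectedin (torus_topology \<Gamma>) (D \<union> K)"
    using assms unfolding components_in_iff by (intro connectedin_Un) blast+
  moreover have "D \<union> K \<subseteq> S" using assms unfolding components_in_iff by blast
  ultimately have "D \<union> K = K" using assms(1) unfolding components_in_iff by blast
  then show ?thesis by blast
qed

lemma layers_arrangement_of:
  "layers \<Gamma> (arrangement_of \<Gamma> X) =
     (\<Union>S\<in>Pow X. components_in \<Gamma> (torus \<Gamma> \<inter> (\<Inter>\<xi>\<in>S. character_kernel \<Gamma> \<xi>)))"
proof (intro subset_antisym subsetI)
  fix C
  assume "C \<in> layers \<Gamma> (arrangement_of \<Gamma> X)"
  then obtain S where S: "S \<subseteq> arrangement_of \<Gamma> X"
    and C: "C \<in> components_in \<Gamma> (torus \<Gamma> \<inter> \<Inter>S)" by (auto simp: layers_def)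
  have "\<forall>K\<in>S. \<exists>\<xi>\<in>X. K \<in> components_in \<Gamma> (character_kernel \<Gamma> \<xi>)"
    using S by (auto simp: arrangement_of_def)
  then obtain \<xi> where \<xi>: "\<And>K. K \<in> S \<Longrightarrow> \<xi> K \<in> X"
      "\<And>K. K \<in> S \<Longrightarrow> K \<in> components_in \<Gamma> (character_kernel \<Gamma> (\<xi> K))" by metis
  let ?I = "torus \<Gamma> \<inter> (\<Inter>\<psi>\<in>\<xi> ` S. character_kernel \<Gamma> \<psi>)"
  have CK: "C \<noteq> {}" "C \<subseteq> torus \<Gamma>" "\<And>K. K \<in> S \<Longrightarrow> C \<subseteq> K"
    using C unfolding components_in_iff by blast+
  have "C \<in> components_in \<Gamma> ?I"
    unfolding components_in_iff
  proof (intro conjI allI impI)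
    show "C \<noteq> {}" by (fact CK)
    have "K \<subseteq> character_kernel \<Gamma> (\<xi> K)" if "K \<in> S" for K
      using \<xi>(2)[OF that] components_in_iff by blast
    then show "C \<subseteq> ?I" using CK by blast
    show "connectedin (torus_topology \<Gamma>) C" using C by (simp add: components_in_iff)
    fix D
    assume D: "connectedin (torus_topology \<Gamma>) D \<and> D \<subseteq> ?I \<and> C \<subseteq> D"
    have "D \<subseteq> K" if "K \<in> S" for K
    proof (rule components_in_unique[OF \<xi>(2)[OF that]])
      show "D \<subseteq> character_kernel \<Gamma> (\<xi> K)" using D that by blast
      show "D \<inter> K \<noteq> {}" using conjunct2[OF conjunct2[OF D]] CK(1) CK(3)[OF that] by blast
    qed (rule conjunct1[OF D])
    then have "D \<subseteq> torus \<Gamma> \<inter> \<Inter>S" using D by blast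
    then show "D = C" using C D unfolding components_in_iff by blast
  qed
  then show "C \<in> (\<Union>S\<in>Pow X. components_in \<Gamma> (torus \<Gamma> \<inter> (\<Inter>\<xi>\<in>S. character_kernel \<Gamma> \<xi>)))"
    using \<xi>(1) by blast
next
  fix C
  assume "C \<in> (\<Union>S\<in>Pow X. components_in \<Gamma> (torus \<Gamma> \<inter> (\<Inter>\<xi>\<in>S. character_kernel \<Gamma> \<xi>)))"
  then obtain S where S: "S \<subseteq> X"
    and C: "C \<in> components_in \<Gamma> (torus \<Gamma> \<inter> (\<Inter>\<xi>\<in>S. character_kernel \<Gamma> \<xi>))" by auto
  have C': "C \<noteq> {}" "C \<subseteq> torus \<Gamma>" "connectedin (torus_topology \<Gamma>) C"
      "\<And>\<xi>. \<xi> \<in> S \<Longrightarrow> C \<subseteq> character_kernel \<Gamma> \<xi>"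
    using C unfolding components_in_iff by blast+
  have "\<forall>\<xi>\<in>S. \<exists>K. K \<in> components_in \<Gamma> (character_kernel \<Gamma> \<xi>) \<and> C \<subseteq> K"
    using C' by (meson component_exists)
  then obtain K where K: "\<And>\<xi>. \<xi> \<in> S \<Longrightarrow> K \<xi> \<in> components_in \<Gamma> (character_kernel \<Gamma> \<xi>)"
      "\<And>\<xi>. \<xi> \<in> S \<Longrightarrow> C \<subseteq> K \<xi>" by metis
  have KK: "K \<xi> \<subseteq> character_kernel \<Gamma> \<xi>" if "\<xi> \<in> S" for \<xi>
    using K(1)[OF that] by (simp add: components_in_iff)
  have "C \<in> components_in \<Gamma> (torus \<Gamma> \<inter> \<Inter>(K ` S))"
    unfolding components_in_iff
  proof (intro conjI allI impI)
    fix D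
    assume D: "connectedin (torus_topology \<Gamma>) D \<and> D \<subseteq> torus \<Gamma> \<inter> \<Inter>(K ` S) \<and> C \<subseteq> D"
    then have "D \<subseteq> torus \<Gamma> \<inter> (\<Inter>\<xi>\<in>S. character_kernel \<Gamma> \<xi>)" using KK by blast
    then show "D = C" using C D unfolding components_in_iff by blast
  next
    show "C \<subseteq> torus \<Gamma> \<inter> \<Inter>(K ` S)" using C'(2) K(2) by blast
  qed (use C'(1,3) in simp_all)
  moreover have "K ` S \<subseteq> arrangement_of \<Gamma> X"
    using K(1) S by (auto simp: arrangement_of_def)
  ultimately show "C \<in> layers \<Gamma> (arrangement_of \<Gamma> X)" by (auto simp: layers_def)
qed

text \<open>\<open>\<Gamma>\<close> is free abelian with basis \<open>e 0, \<dots>, e (k - 1)\<close>.\<close>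

definition lattice_basis :: "'g monoid \<Rightarrow> (nat \<Rightarrow> 'g) \<Rightarrow> nat \<Rightarrow> bool" where
  "lattice_basis \<Gamma> e k \<longleftrightarrow> comm_group \<Gamma> \<and> e ` {..<k} \<subseteq> carrier \<Gamma> \<and>
     bij_betw (\<lambda>v. \<Otimes>\<^bsub>\<Gamma>\<^esub>i\<in>{..<k}. e i [^]\<^bsub>\<Gamma>\<^esub> v i) ({..<k} \<rightarrow>\<^sub>E (UNIV :: int set)) (carrier \<Gamma>)"

text \<open>A basis \<open>e 0, \<dots>, e d\<close> of \<open>\<Gamma>\<close> gives the coordinates
  \<open>t \<mapsto> (t (e 0), \<dots>, t (e (d - 1)); t (e d)) = (\<^bold>x, y)\<close> on the torus, in which \<open>Y\<close> will be the locus
  \<open>\<^bold>x = (1, \<dots>, 1)\<close>. The map \<open>t \<mapsto> \<^bold>x\<close> is the projection modulo \<open>Y\<close>.\<close>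

definition proj :: "(nat \<Rightarrow> 'g) \<Rightarrow> nat \<Rightarrow> ('g \<Rightarrow> complex) \<Rightarrow> nat \<Rightarrow> complex" where
  "proj e d t = (\<lambda>i\<in>{..<d}. t (e i))"

definition quotient_arrangement ::
  "'g monoid \<Rightarrow> (nat \<Rightarrow> 'g) \<Rightarrow> nat \<Rightarrow> ('g \<Rightarrow> complex) set set \<Rightarrow> ('g \<Rightarrow> complex) set
   \<Rightarrow> (nat \<Rightarrow> complex) set set" where
  "quotient_arrangement \<Gamma> e d A Y = (\<lambda>H. proj e d ` H) ` sub_arrangement \<Gamma> A Y"

definition coord_complement_space ::
  "nat \<Rightarrow> (nat \<Rightarrow> complex) set set \<Rightarrow> (nat \<Rightarrow> complex) topology" where
  "coord_complement_space d B =
     subtopology (product_topology (\<lambda>_. euclidean) {..<d}) (({..<d} \<rightarrow>\<^sub>E - {0}) - \<Union>B)"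

definition monomial :: "nat \<Rightarrow> (nat \<Rightarrow> int) \<Rightarrow> (nat \<Rightarrow> complex) \<Rightarrow> complex" where
  "monomial d v x = (\<Prod>i<d. x i powi v i)"

definition weierstrass_poly ::
  "nat \<Rightarrow> nat \<Rightarrow> (nat \<Rightarrow> nat) \<Rightarrow> (nat \<Rightarrow> nat \<Rightarrow> int) \<Rightarrow> (nat \<Rightarrow> complex) \<Rightarrow> (nat \<Rightarrow> complex)
   \<Rightarrow> complex poly" where
  "weierstrass_poly d l m0 m \<mu> x =
     [:0, 1:] * (\<Prod>j=1..l. monom 1 (m0 j) - [:\<mu> j * monomial d (m j) x:])"

definition coefficient_map ::
  "nat \<Rightarrow> nat \<Rightarrow> (nat \<Rightarrow> nat) \<Rightarrow> (nat \<Rightarrow> nat \<Rightarrow> int) \<Rightarrow> (nat \<Rightarrow> complex) \<Rightarrow> (nat \<Rightarrow> complex)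
   \<Rightarrow> complex set" where
  "coefficient_map d l m0 m \<mu> x = {z. poly (weierstrass_poly d l m0 m \<mu> x) z = 0}"

definition root_map ::
  "nat \<Rightarrow> nat \<Rightarrow> (nat \<Rightarrow> nat \<Rightarrow> int) \<Rightarrow> (nat \<Rightarrow> complex) \<Rightarrow> (nat \<Rightarrow> complex) \<Rightarrow> nat \<Rightarrow> complex" where
  "root_map d l m \<mu> x =
     (\<lambda>j\<in>{..l}. if j = 0 then 0 else \<mu> j * monomial d (m j) x)"

end

theory Submission
  imports Defs
begin

text \<open>
  The last coordinate identifies \<open>M(\<A>)\<close> with the set of pairs \<open>(x, y)\<close> such that \<open>y\<close> is not a
  root of \<open>f(x, -)\<close>. These roots are distinct: a common root of two factors would give a point of
  \<open>H\<^sub>i \<inter> H\<^sub>j\<close>, which by the M-ideal condition lies over the removed hypersurfaces of the base. Locally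
  they are continuous functions of \<open>x\<close>, whence the pullback squares.

  The monodromy is compared by parallel transport. Over a square of moving configurations the
  points can be numbered (the square is simply connected), and finitely many small pushes
  \<open>z \<mapsto> z + \<Sum>\<^sub>i max(0, 1 - |z - k\<^sub>i|/\<epsilon>) (k'\<^sub>i - k\<^sub>i)\<close> compose to an isotopy of the plane that carries
  along the configuration and its far point. Pushing a loop of the fiber along a loop of the base
  gives the conjugate by the section; pushing a homotopy in the total space back into the fiber
  shows that the fiber group injects, so the conjugate determines the monodromy. A single push,
  being a small Lipschitz perturbation of the identity, also gives the local trivializations.
\<close>

section \<open>The fundamental group of an abstract topological space\<close>

text \<open>The value of \<open>monodromy\<close> is a definite description, so it takes a loop that
  satisfies the conjugation equation and a proof that no other class does. Neither the Artin action
  nor any fundamental group is computed: one and the same transported loop solves the equation in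
  the bundle of configurations and in its pullback, which is all that naturality needs. Uniqueness
  is usually drawn from the long exact sequence of a fibration. Here the far point replaces it:
  counted as one more point of the moving configuration, it never meets the others, so transport
  keeps loops based on the section. The radius \<epsilon> of a push bounds the distances of these
  points from below, so that the bump at one point leaves the others alone; a push is invertible
  once the total displacement is below \<epsilon>, and uniform continuity on the square provides
  steps that small. In the TM case nothing is transported again: the ordered and the unordered
  square recover the same point of \<open>MA\<close> from a base point and a last coordinate, so
  their fibers and sections agree.\<close>

lemma path_homotopic_iff:
  "path_homotopic X x0 p q \<longleftrightarrow>
     (\<exists>h. continuous_map (top_of_set ({0..1::real} \<times> {0..1})) X h \<and>
        (\<forall>u\<in>{0..1}. h (0, u) = p u \<and> h (1, u) = q u) \<and>
        (\<forall>s\<in>{0..1}. h (s, 0) = x0 \<and> h (s, 1) = x0))"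
proof -
  have "path_homotopic X x0 p q \<longleftrightarrow>
     (\<exists>h. continuous_map (prod_topology (top_of_set {0..1::real}) (top_of_set {0..1})) X h \<and>
        (\<forall>u\<in>topspace (top_of_set {0..1}). h (0, u) = p u) \<and>
        (\<forall>u\<in>topspace (top_of_set {0..1}). h (1, u) = q u) \<and>
        (\<forall>s\<in>{0..1}. h (s, 0) = x0 \<and> h (s, 1) = x0))"
    unfolding path_homotopic_def
    by (rule homotopic_with) auto
  then show ?thesis
    unfolding prod_topology_subtopology_eu by auto
qed

lemma path_homotopicI:
  assumes "continuous_map (top_of_set ({0..1::real} \<times> {0..1})) X h"
    and "\<And>u. 0 \<le> u \<Longrightarrow> u \<le> 1 \<Longrightarrow> h (0, u) = p u" "\<And>u. 0 \<le> u \<Longrightarrow> u \<le> 1 \<Longrightarrow> h (1, u) = q u"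
    and "\<And>s. 0 \<le> s \<Longrightarrow> s \<le> 1 \<Longrightarrow> h (s, 0) = x0" "\<And>s. 0 \<le> s \<Longrightarrow> s \<le> 1 \<Longrightarrow> h (s, 1) = x0"
  shows "path_homotopic X x0 p q"
  unfolding path_homotopic_iff using assms by (intro exI[of _ h]) auto

lemma path_homotopic_refl: "p \<in> loops X x0 \<Longrightarrow> path_homotopic X x0 p p"
  by (simp add: path_homotopic_def loops_def pathin_def)

lemma path_homotopic_sym: "path_homotopic X x0 p q \<Longrightarrow> path_homotopic X x0 q p"
  unfolding path_homotopic_def by (rule homotopic_with_symD)

lemma path_homotopic_trans [trans]:
  "path_homotopic X x0 p q \<Longrightarrow> path_homotopic X x0 q r \<Longrightarrow> path_homotopic X x0 p r"
  unfolding path_homotopic_def by (rule homotopic_with_trans)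

lemma path_homotopic_loops:
  assumes "path_homotopic X x0 p q" shows "p \<in> loops X x0" "q \<in> loops X x0"
  using homotopic_with_imp_continuous_maps[OF assms[unfolded path_homotopic_def]]
    homotopic_with_imp_property[OF assms[unfolded path_homotopic_def]]
  by (auto simp: loops_def pathin_def)

lemma path_homotopic_compose:
  assumes "path_homotopic X x0 p q" "continuous_map X Y f" "f x0 = y0"
  shows "path_homotopic Y y0 (f \<circ> p) (f \<circ> q)"
  using assms unfolding path_homotopic_def
  by (auto intro: homotopic_with_compose_continuous_map_left)

lemma path_homotopic_cong:
  assumes "path_homotopic X x0 p q" "\<And>u. 0 \<le> u \<Longrightarrow> u \<le> 1 \<Longrightarrow> p u = p' u"
    "\<And>u. 0 \<le> u \<Longrightarrow> u \<le> 1 \<Longrightarrow> q u = q' u"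
  shows "path_homotopic X x0 p' q'"
  using assms unfolding path_homotopic_iff by auto

lemma loops_cong:
  assumes "p \<in> loops X x0" "\<And>u. 0 \<le> u \<Longrightarrow> u \<le> 1 \<Longrightarrow> p u = q u"
  shows "path_homotopic X x0 p q" "q \<in> loops X x0"
proof -
  show "path_homotopic X x0 p q"
    by (rule path_homotopic_cong[OF path_homotopic_refl[OF assms(1)]]) (use assms(2) in auto)
  then show "q \<in> loops X x0" by (rule path_homotopic_loops)
qed

lemma loops_in_topspace:
  assumes "p \<in> loops X x0" "0 \<le> u" "u \<le> 1" shows "p u \<in> topspace X"
proof -
  have "continuous_map (top_of_set {0..1}) X p" using assms(1) by (simp add: loops_def pathin_def)
  moreover have "u \<in> topspace (top_of_set {0..1})" using assms by simp
  ultimately show ?thesis by (metis continuous_map_def PiE)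
qed

lemma loops_base_in_topspace: "p \<in> loops X x0 \<Longrightarrow> x0 \<in> topspace X"
  using loops_in_topspace[of p X x0 0] by (simp add: loops_def)

lemma loops_compose:
  "p \<in> loops X x0 \<Longrightarrow> continuous_map X Y f \<Longrightarrow> f x0 = y0 \<Longrightarrow> f \<circ> p \<in> loops Y y0"
  by (auto simp: loops_def pathin_def intro: continuous_map_compose)

text \<open>The straight-line homotopy lives in the convex parameter domain and is then mapped by
  \<open>g\<close>. The group laws (with an interval as domain) and the two ways around a square are
  all instances.\<close>

lemma path_homotopic_convex:
  fixes u v :: "real \<Rightarrow> 'a::real_normed_vector"
  assumes g: "continuous_map (top_of_set C) X g" and C: "convex C"
    and u: "continuous_on {0..1} u" "u ` {0..1} \<subseteq> C"
    and v: "continuous_on {0..1} v" "v ` {0..1} \<subseteq> C"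
    and ends: "u 0 = v 0" "u 1 = v 1" "g (u 0) = x0" "g (u 1) = x0"
  shows "path_homotopic X x0 (g \<circ> u) (g \<circ> v)"
proof -
  define h where "h = (\<lambda>(s, t). (1 - s) *\<^sub>R u t + s *\<^sub>R v t)"
  have "continuous_on ({0..1} \<times> {0..1}) h"
    unfolding h_def case_prod_beta
    by (intro continuous_intros continuous_on_compose2[OF u(1)] continuous_on_compose2[OF v(1)]) auto
  moreover have "h ` ({0..1} \<times> {0..1}) \<subseteq> C"
  proof clarify
    fix s t :: real assume "s \<in> {0..1}" "t \<in> {0..1}"
    then have "u t \<in> C" "v t \<in> C" "0 \<le> 1 - s" "0 \<le> s" using u(2) v(2) by auto
    then show "h (s, t) \<in> C" unfolding h_def prod.case by (intro convexD[OF C]) auto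
  qed
  ultimately have "continuous_map (top_of_set ({0..1::real} \<times> {0..1})) (top_of_set C) h"
    by auto
  from continuous_map_compose[OF this g] show ?thesis
  proof (rule path_homotopicI)
    fix s :: real
    have *: "(1 - s) *\<^sub>R w + s *\<^sub>R w = w" for w :: 'a
      by (simp flip: scaleR_left_distrib)
    have "g (v 0) = x0" "g (v 1) = x0" using ends by auto
    then show "(g \<circ> h) (s, 0) = x0" "(g \<circ> h) (s, 1) = x0"
      by (simp_all add: h_def ends(1,2) *)
  qed (simp_all add: h_def)
qed

lemma path_homotopic_reparam:
  assumes "pathin X p" "continuous_on {0..1} u" "u ` {0..1} \<subseteq> {0..1::real}"
    "continuous_on {0..1} v" "v ` {0..1} \<subseteq> {0..1}"
    "u 0 = v 0" "u 1 = v 1" "p (u 0) = x0" "p (u 1) = x0"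
  shows "path_homotopic X x0 (p \<circ> u) (p \<circ> v)"
  by (rule path_homotopic_convex[where C = "{0..1}"]) (use assms in \<open>auto simp: pathin_def\<close>)

text \<open>The extra parameter set \<open>S\<close> lets one pasting argument serve twice: a
  one-point \<open>S\<close> concatenates paths, an interval \<open>S\<close> concatenates
  homotopies.\<close>

lemma continuous_map_path_concat:
  fixes S :: "'a::topological_space set"
  assumes f: "continuous_map (top_of_set (S \<times> {0..1::real})) X f"
    and g: "continuous_map (top_of_set (S \<times> {0..1::real})) X g"
    and eq: "\<And>s. s \<in> S \<Longrightarrow> f (s, 1) = g (s, 0)"
  shows "continuous_map (top_of_set (S \<times> {0..1})) X
           (\<lambda>x. path_concat (\<lambda>t. f (fst x, t)) (\<lambda>t. g (fst x, t)) (snd x))"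
  unfolding path_concat_def
proof (rule continuous_map_cases_le)
  let ?Q = "top_of_set (S \<times> {0..1::real})"
  show "continuous_map ?Q euclideanreal snd" "continuous_map ?Q euclideanreal (\<lambda>x. 1/2)"
    by (auto intro!: continuous_intros)
  have "continuous_map (subtopology ?Q {x \<in> topspace ?Q. snd x \<le> 1/2}) ?Q (\<lambda>x. (fst x, 2 * snd x))"
    by (auto simp: subtopology_subtopology intro!: continuous_intros)
  from continuous_map_compose[OF this f]
  show "continuous_map (subtopology ?Q {x \<in> topspace ?Q. snd x \<le> 1/2}) X (\<lambda>x. f (fst x, 2 * snd x))"
    by (simp add: o_def)
  have "continuous_map (subtopology ?Q {x \<in> topspace ?Q. 1/2 \<le> snd x}) ?Q (\<lambda>x. (fst x, 2 * snd x - 1))"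
    by (auto simp: subtopology_subtopology intro!: continuous_intros)
  from continuous_map_compose[OF this g]
  show "continuous_map (subtopology ?Q {x \<in> topspace ?Q. 1/2 \<le> snd x}) X (\<lambda>x. g (fst x, 2 * snd x - 1))"
    by (simp add: o_def)
  show "f (fst x, 2 * snd x) = g (fst x, 2 * snd x - 1)"
    if "x \<in> topspace ?Q" "snd x = 1/2" for x
    using that(1) eq[of "fst x"] unfolding that(2) by auto
qed

lemma pathin_path_concat:
  assumes "pathin X p" "pathin X q" "p 1 = q 0"
  shows "pathin X (path_concat p q)"
proof -
  have "continuous_map (top_of_set ({0::real} \<times> {0..1::real})) X (r \<circ> snd)" if "pathin X r" for r
    using that unfolding pathin_def
    by (rule continuous_map_compose[rotated]) (auto intro!: continuous_intros)
  from continuous_map_path_concat[OF this[OF assms(1)] this[OF assms(2)]]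
  have "continuous_map (top_of_set ({0::real} \<times> {0..1::real})) X (\<lambda>x. path_concat p q (snd x))"
    using assms(3) by simp
  moreover have "continuous_map (top_of_set {0..1}) (top_of_set ({0::real} \<times> {0..1::real})) (\<lambda>t. (0, t))"
    by (auto intro!: continuous_intros)
  ultimately have "continuous_map (top_of_set {0..1}) X
      ((\<lambda>x. path_concat p q (snd x)) \<circ> (\<lambda>t. (0::real, t)))"
    by (intro continuous_map_compose)
  then show ?thesis by (simp add: pathin_def o_def)
qed

lemma path_concat_loops: "p \<in> loops X x0 \<Longrightarrow> q \<in> loops X x0 \<Longrightarrow> path_concat p q \<in> loops X x0"
  using pathin_path_concat[of X p q] by (simp add: loops_def) (simp add: path_concat_def)

lemma const_loops: "x0 \<in> topspace X \<Longrightarrow> (\<lambda>_. x0) \<in> loops X x0"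
  by (auto simp: loops_def pathin_def)

lemma path_homotopic_concat:
  assumes "path_homotopic X x0 p p'" "path_homotopic X x0 q q'"
  shows "path_homotopic X x0 (path_concat p q) (path_concat p' q')"
proof -
  obtain h k where h: "continuous_map (top_of_set ({0..1::real} \<times> {0..1})) X h"
      "\<forall>u\<in>{0..1}. h (0, u) = p u \<and> h (1, u) = p' u" "\<forall>s\<in>{0..1}. h (s, 0) = x0 \<and> h (s, 1) = x0"
    and k: "continuous_map (top_of_set ({0..1::real} \<times> {0..1})) X k"
      "\<forall>u\<in>{0..1}. k (0, u) = q u \<and> k (1, u) = q' u" "\<forall>s\<in>{0..1}. k (s, 0) = x0 \<and> k (s, 1) = x0"
    using assms unfolding path_homotopic_iff by blast
  have "h (s, 1) = k (s, 0)" if "s \<in> {0..1}" for s using h(3) k(3) that by simp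
  from continuous_map_path_concat[OF h(1) k(1) this] show ?thesis
    by (rule path_homotopicI) (use h(2,3) k(2,3) in \<open>simp_all add: path_concat_def\<close>)
qed

section \<open>The group of loop classes and induced homomorphisms\<close>

lemma loop_class_self: "p \<in> loops X x0 \<Longrightarrow> p \<in> loop_class X x0 p"
  by (simp add: loop_class_def path_homotopic_refl)

lemma loop_class_eq_iff:
  assumes "p \<in> loops X x0"
  shows "loop_class X x0 p = loop_class X x0 q \<longleftrightarrow> path_homotopic X x0 p q"
proof
  assume "loop_class X x0 p = loop_class X x0 q"
  moreover note loop_class_self[OF assms]
  ultimately show "path_homotopic X x0 p q"
    using path_homotopic_sym[of X x0 q p] by (auto simp: loop_class_def)
next
  assume pq: "path_homotopic X x0 p q"
  have "path_homotopic X x0 p r \<longleftrightarrow> path_homotopic X x0 q r" for r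
    using path_homotopic_trans[OF pq] path_homotopic_trans[OF path_homotopic_sym[OF pq]] by blast
  then show "loop_class X x0 p = loop_class X x0 q"
    by (simp add: loop_class_def)
qed

lemma carrier_fundamental_group:
  "carrier (fundamental_group X x0) = loop_class X x0 ` loops X x0"
  by (simp add: fundamental_group_def)

lemma loop_class_carrier [intro]:
  "p \<in> loops X x0 \<Longrightarrow> loop_class X x0 p \<in> carrier (fundamental_group X x0)"
  by (simp add: carrier_fundamental_group)

text \<open>The product is a union over all pairs of representatives. Concatenation respects
  homotopy, so every member of the union is the same class, and the index sets are nonempty.\<close>

lemma mult_fundamental_group:
  assumes "p \<in> loops X x0" "q \<in> loops X x0"
  shows "loop_class X x0 p \<otimes>\<^bsub>fundamental_group X x0\<^esub> loop_class X x0 q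
    = loop_class X x0 (path_concat p q)"
proof -
  have "loop_class X x0 (path_concat p' q') = loop_class X x0 (path_concat p q)"
    if "p' \<in> loop_class X x0 p" "q' \<in> loop_class X x0 q" for p' q'
  proof -
    have "path_homotopic X x0 (path_concat p q) (path_concat p' q')"
      using that by (intro path_homotopic_concat) (auto simp: loop_class_def)
    then show ?thesis
      using loop_class_eq_iff[OF path_concat_loops[OF assms]] by metis
  qed
  moreover have "loop_class X x0 p \<noteq> {}" "loop_class X x0 q \<noteq> {}"
    using loop_class_self[OF assms(1)] loop_class_self[OF assms(2)] by auto
  moreover have "(\<Union>p'\<in>loop_class X x0 p. \<Union>q'\<in>loop_class X x0 q. loop_class X x0 (path_concat p' q'))
      = (\<Union>p'\<in>loop_class X x0 p. \<Union>q'\<in>loop_class X x0 q. loop_class X x0 (path_concat p q))"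
    by (intro SUP_cong refl calculation(1))
  ultimately show ?thesis by (simp add: fundamental_group_def)
qed

lemma path_concat_assoc:
  assumes "p \<in> loops X x0" "q \<in> loops X x0" "r \<in> loops X x0"
  shows "path_homotopic X x0 (path_concat (path_concat p q) r) (path_concat p (path_concat q r))"
proof -
  let ?g = "path_concat (path_concat p q) r"
  \<comment> \<open>Reparametrization with slopes 1/2, 1, 2 that sends the breakpoints 1/2, 3/4 of
    the right-hand bracketing to 1/4, 1/2. Being convex and piecewise linear it is a maximum of its
    pieces, which makes continuity automatic.\<close>
  let ?u = "\<lambda>t::real. max (t / 2) (max (t - 1 / 4) (2 * t - 1))"
  have g: "?g \<in> loops X x0" using assms by (intro path_concat_loops)
  have "path_homotopic X x0 (?g \<circ> id) (?g \<circ> ?u)"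
    using g by (intro path_homotopic_reparam continuous_intros) (auto simp: loops_def max_def)
  then show ?thesis
  proof (rule path_homotopic_cong)
    fix t :: real assume "0 \<le> t" "t \<le> 1"
    consider "t \<le> 1/2" | "1/2 < t" "t \<le> 3/4" | "3/4 < t" by linarith
    then show "(?g \<circ> ?u) t = path_concat p (path_concat q r) t"
    proof cases
      case 1 then have "?u t = t / 2" by (auto simp: max_def)
      then show ?thesis using 1 by (simp add: path_concat_def)
    next
      case 2 then have "?u t = t - 1/4" by (auto simp: max_def)
      then show ?thesis using 2 by (simp add: path_concat_def algebra_simps)
    next
      case 3 then have "?u t = 2 * t - 1" by (auto simp: max_def)
      then show ?thesis using 3 by (simp add: path_concat_def algebra_simps)
    qed
  qed simp
qed

lemma path_concat_const_left:
  assumes "p \<in> loops X x0"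
  shows "path_homotopic X x0 (path_concat (\<lambda>_. x0) p) p"
proof -
  have "path_homotopic X x0 (p \<circ> (\<lambda>t. max 0 (2 * t - 1))) (p \<circ> id)"
    using assms by (intro path_homotopic_reparam continuous_intros) (auto simp: loops_def max_def)
  then show ?thesis
  proof (rule path_homotopic_cong)
    fix u :: real
    have "max 0 (2 * u - 1) = (if u \<le> 1/2 then 0 else 2 * u - 1)" by auto
    then show "(p \<circ> (\<lambda>t. max 0 (2 * t - 1))) u = path_concat (\<lambda>_. x0) p u"
      using assms by (simp add: path_concat_def loops_def)
  qed simp
qed

lemma path_concat_reverse_left:
  assumes "p \<in> loops X x0"
  shows "(\<lambda>t. p (1 - t)) \<in> loops X x0"
    and "path_homotopic X x0 (path_concat (\<lambda>t. p (1 - t)) p) (\<lambda>_. x0)"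
proof -
  have "path_homotopic X x0 (p \<circ> (\<lambda>t. 1 - t)) (p \<circ> (\<lambda>t. 1 - t))"
    using assms by (intro path_homotopic_reparam continuous_intros) (auto simp: loops_def)
  then show "(\<lambda>t. p (1 - t)) \<in> loops X x0"
    using path_homotopic_loops(1) by (fastforce simp: o_def)
  \<comment> \<open>The parameter runs from 1 down to 0 and back, which is \<open>p\<close> reversed
    followed by \<open>p\<close>; inside the parameter interval it contracts to the constant
    1.\<close>
  have "path_homotopic X x0 (p \<circ> (\<lambda>t. \<bar>1 - 2 * t\<bar>)) (p \<circ> (\<lambda>t. 1))"
    using assms by (intro path_homotopic_reparam continuous_intros) (auto simp: loops_def)
  then show "path_homotopic X x0 (path_concat (\<lambda>t. p (1 - t)) p) (\<lambda>_. x0)"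
  proof (rule path_homotopic_cong)
    fix u :: real
    have "\<bar>1 - 2 * u\<bar> = (if u \<le> 1/2 then 1 - 2 * u else 2 * u - 1)" by auto
    then show "(p \<circ> (\<lambda>t. \<bar>1 - 2 * t\<bar>)) u = path_concat (\<lambda>t. p (1 - t)) p u"
      by (simp add: path_concat_def)
  qed (use assms in \<open>simp add: loops_def\<close>)
qed

lemma group_fundamental_group:
  assumes x0: "x0 \<in> topspace X"
  shows "group (fundamental_group X x0)"
proof (rule groupI)
  let ?G = "fundamental_group X x0"
  have one: "\<one>\<^bsub>?G\<^esub> = loop_class X x0 (\<lambda>_. x0)" by (simp add: fundamental_group_def)
  show "\<one>\<^bsub>?G\<^esub> \<in> carrier ?G" unfolding one using x0 by (auto intro: const_loops)
  fix P assume "P \<in> carrier ?G"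
  then obtain p where p: "p \<in> loops X x0" "P = loop_class X x0 p"
    by (auto simp: carrier_fundamental_group)
  show "\<one>\<^bsub>?G\<^esub> \<otimes>\<^bsub>?G\<^esub> P = P"
    unfolding one p(2) using p(1) const_loops[OF x0]
    by (simp add: mult_fundamental_group loop_class_eq_iff path_concat_loops path_concat_const_left)
  show "\<exists>Q\<in>carrier ?G. Q \<otimes>\<^bsub>?G\<^esub> P = \<one>\<^bsub>?G\<^esub>"
    using path_concat_reverse_left[OF p(1)] p(1) unfolding one p(2)
    by (intro bexI[of _ "loop_class X x0 (\<lambda>t. p (1 - t))"])
      (auto simp: mult_fundamental_group loop_class_eq_iff path_concat_loops)
  fix Q assume "Q \<in> carrier ?G"
  then obtain q where q: "q \<in> loops X x0" "Q = loop_class X x0 q"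
    by (auto simp: carrier_fundamental_group)
  show "P \<otimes>\<^bsub>?G\<^esub> Q \<in> carrier ?G"
    using p q by (auto simp: mult_fundamental_group path_concat_loops)
  fix R assume "R \<in> carrier ?G"
  then obtain r where r: "r \<in> loops X x0" "R = loop_class X x0 r"
    by (auto simp: carrier_fundamental_group)
  show "P \<otimes>\<^bsub>?G\<^esub> Q \<otimes>\<^bsub>?G\<^esub> R = P \<otimes>\<^bsub>?G\<^esub> (Q \<otimes>\<^bsub>?G\<^esub> R)"
    using p q r
    by (simp add: mult_fundamental_group path_concat_loops loop_class_eq_iff path_concat_assoc)
qed

lemma induced_map_loop_class:
  assumes "p \<in> loops X x0" "continuous_map X Y f" "f x0 = y0"
  shows "induced_map Y y0 f (loop_class X x0 p) = loop_class Y y0 (f \<circ> p)"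
proof -
  have "loop_class Y y0 (f \<circ> q) = loop_class Y y0 (f \<circ> p)" if "q \<in> loop_class X x0 p" for q
  proof -
    have "path_homotopic Y y0 (f \<circ> p) (f \<circ> q)"
      using that by (intro path_homotopic_compose[OF _ assms(2,3)]) (simp add: loop_class_def)
    then show ?thesis
      using loop_class_eq_iff[OF loops_compose[OF assms]] by metis
  qed
  moreover have "loop_class X x0 p \<noteq> {}"
    using loop_class_self[OF assms(1)] by auto
  moreover have "(\<Union>q\<in>loop_class X x0 p. loop_class Y y0 (f \<circ> q))
      = (\<Union>q\<in>loop_class X x0 p. loop_class Y y0 (f \<circ> p))"
    by (intro SUP_cong refl calculation(1))
  ultimately show ?thesis by (simp add: induced_map_def)
qed

lemma induced_map_cong:
  assumes "P \<in> carrier (fundamental_group X x0)" "continuous_map X Y f" "f x0 = y0"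
    and eq: "\<And>x. x \<in> topspace X \<Longrightarrow> f x = f' x"
  shows "induced_map Y y0 f P = induced_map Y y0 f' P"
proof -
  obtain p where p: "p \<in> loops X x0" "P = loop_class X x0 p"
    using assms(1) by (auto simp: carrier_fundamental_group)
  have "continuous_map X Y f'" using assms(2) eq by (rule continuous_map_eq)
  moreover have "f' x0 = y0"
    using eq[OF loops_base_in_topspace[OF p(1)]] assms(3) by simp
  ultimately have *: "induced_map Y y0 f' P = loop_class Y y0 (f' \<circ> p)"
    using p by (simp add: induced_map_loop_class)
  have "path_homotopic Y y0 (f \<circ> p) (f' \<circ> p)"
    by (intro loops_cong(1) loops_compose[OF p(1) assms(2,3)])
      (simp add: eq[OF loops_in_topspace[OF p(1)]])
  then show ?thesis
    using * p assms(2,3) loops_compose[OF p(1) assms(2,3)]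
    by (simp add: induced_map_loop_class loop_class_eq_iff)
qed

text \<open>Both routes from (0, 0) to (1, 1) are paths in a convex square with the same ends. This
  turns a family of loops whose base point moves into a relation between based loops, the form in
  which conjugation by the section appears later.\<close>

lemma square_boundary_homotopic:
  assumes h: "continuous_map (top_of_set ({0..1::real} \<times> {0..1})) X h"
    and ends: "h (0, 0) = x0" "h (1, 1) = x0"
  shows "path_homotopic X x0 (path_concat (\<lambda>t. h (t, 0)) (\<lambda>u. h (1, u)))
           (path_concat (\<lambda>u. h (0, u)) (\<lambda>t. h (t, 1)))"
proof -
  let ?a = "\<lambda>t::real. min 1 (2 * t)" and ?b = "\<lambda>t::real. max 0 (2 * t - 1)"
  have "path_homotopic X x0 (h \<circ> (\<lambda>t. (?a t, ?b t))) (h \<circ> (\<lambda>t. (?b t, ?a t)))"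
    using ends
    by (intro path_homotopic_convex[OF h] continuous_intros convex_Times convex_real_interval) auto
  then show ?thesis
  proof (rule path_homotopic_cong)
    fix u :: real
    have "?a u = (if u \<le> 1/2 then 2 * u else 1)" "?b u = (if u \<le> 1/2 then 0 else 2 * u - 1)"
      by auto
    then show "(h \<circ> (\<lambda>t. (?a t, ?b t))) u = path_concat (\<lambda>t. h (t, 0)) (\<lambda>u. h (1, u)) u"
      "(h \<circ> (\<lambda>t. (?b t, ?a t))) u = path_concat (\<lambda>u. h (0, u)) (\<lambda>t. h (t, 1)) u"
      by (simp_all add: path_concat_def)
  qed
qed

text \<open>Multiplying by the class of \<open>p\<close> on the left removes the inverse, so that no
  reversed path has to be handled.\<close>

lemma conjugate_eq_iff_homotopic:
  assumes x0: "x0 \<in> topspace X" and l: "p \<in> loops X x0" "q \<in> loops X x0" "r \<in> loops X x0"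
  shows "loop_class X x0 r = inv\<^bsub>fundamental_group X x0\<^esub> loop_class X x0 p
      \<otimes>\<^bsub>fundamental_group X x0\<^esub> loop_class X x0 q \<otimes>\<^bsub>fundamental_group X x0\<^esub> loop_class X x0 p
    \<longleftrightarrow> path_homotopic X x0 (path_concat p r) (path_concat q p)"
proof -
  interpret group "fundamental_group X x0" by (rule group_fundamental_group[OF x0])
  have "loop_class X x0 r = inv\<^bsub>fundamental_group X x0\<^esub> loop_class X x0 p
      \<otimes>\<^bsub>fundamental_group X x0\<^esub> (loop_class X x0 q \<otimes>\<^bsub>fundamental_group X x0\<^esub> loop_class X x0 p)
    \<longleftrightarrow> loop_class X x0 p \<otimes>\<^bsub>fundamental_group X x0\<^esub> loop_class X x0 r
      = loop_class X x0 q \<otimes>\<^bsub>fundamental_group X x0\<^esub> loop_class X x0 p"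
    using l by (metis inv_solve_left loop_class_carrier m_closed)
  then show ?thesis
    using l by (simp add: mult_fundamental_group loop_class_eq_iff path_concat_loops m_assoc loop_class_carrier)
qed

section \<open>Configuration spaces\<close>

lemma topspace_conf: "topspace (conf k) = {c \<in> extensional {..<k}. inj_on c {..<k}}"
  by (auto simp: conf_def PiE_def)

lemma continuous_map_conf:
  "continuous_map X (conf k) f \<longleftrightarrow>
     (\<forall>x\<in>topspace X. f x \<in> extensional {..<k} \<and> inj_on (f x) {..<k}) \<and>
     (\<forall>i<k. continuous_map X euclidean (\<lambda>x. f x i))"
  unfolding conf_def continuous_map_in_subtopology continuous_map_componentwise by auto

lemma continuous_map_conf_proj: "i < k \<Longrightarrow> continuous_map (conf k) euclidean (\<lambda>c. c i)"
  using continuous_map_conf[of "conf k" k "\<lambda>c. c"] by simp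

lemma quotient_uconf: "quotient_map (conf k) (uconf k) (\<lambda>c. c ` {..<k})"
  unfolding uconf_def by (rule quotient_map_quotient_topology)

lemma quotient_conf_pt: "quotient_map (conf (n + 1)) (conf_pt n) (\<lambda>c. (c ` {..<n}, c n))"
  unfolding conf_pt_def by (rule quotient_map_quotient_topology)

lemma enumerate_configuration:
  assumes "finite S" "card S = k"
  obtains c where "c \<in> topspace (conf k)" "c ` {..<k} = S"
proof -
  obtain f where f: "bij_betw f {..<k} S"
    using assms by (metis bij_betw_from_nat_into_finite card_lessThan finite_lessThan
        finite_same_card_bij)
  then have "restrict f {..<k} \<in> topspace (conf k)" "restrict f {..<k} ` {..<k} = S"
    by (auto simp: topspace_conf bij_betw_def inj_on_def)
  then show ?thesis by (rule that)
qed

lemma topspace_uconf: "topspace (uconf k) = {S. finite S \<and> card S = k}"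
proof -
  have "topspace (uconf k) = (\<lambda>c. c ` {..<k}) ` topspace (conf k)"
    using quotient_imp_surjective_map[OF quotient_uconf] by simp
  also have "\<dots> = {S. finite S \<and> card S = k}"
  proof (intro subset_antisym subsetI)
    fix S :: "complex set" assume "S \<in> {S. finite S \<and> card S = k}"
    then obtain c where "c \<in> topspace (conf k)" "c ` {..<k} = S"
      using enumerate_configuration by blast
    then show "S \<in> (\<lambda>c. c ` {..<k}) ` topspace (conf k)" by blast
  qed (auto simp: topspace_conf card_image)
  finally show ?thesis .
qed

lemma topspace_conf_pt:
  "topspace (conf_pt n) = {(S, z). finite S \<and> card S = n \<and> z \<notin> S}"
proof -
  have "topspace (conf_pt n) = (\<lambda>c. (c ` {..<n}, c n)) ` topspace (conf (n + 1))"
    using quotient_imp_surjective_map[OF quotient_conf_pt] by simp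
  also have "\<dots> = {(S, z). finite S \<and> card S = n \<and> z \<notin> S}"
  proof (intro subset_antisym subsetI)
    fix Q :: "complex set \<times> complex" assume "Q \<in> {(S, z). finite S \<and> card S = n \<and> z \<notin> S}"
    then obtain S z where Q: "Q = (S, z)" "finite S" "card S = n" "z \<notin> S" by auto
    then obtain c where c: "c \<in> topspace (conf n)" "c ` {..<n} = S"
      using enumerate_configuration by blast
    have "c(n := z) \<in> topspace (conf (n + 1))" "(c(n := z)) ` {..<n} = S"
      using c Q by (auto simp: topspace_conf extensional_def inj_on_def lessThan_Suc)
    then show "Q \<in> (\<lambda>c. (c ` {..<n}, c n)) ` topspace (conf (n + 1))"
      using Q by (intro image_eqI[of _ _ "c(n := z)"]) auto
  next
    fix Q assume "Q \<in> (\<lambda>c. (c ` {..<n}, c n)) ` topspace (conf (n + 1))"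
    then obtain c where Q: "Q = (c ` {..<n}, c n)" and c: "inj_on c {..<Suc n}"
      by (auto simp: topspace_conf)
    then have "inj_on c {..<n}" "c n \<notin> c ` {..<n}"
      by (auto simp: lessThan_Suc inj_on_def)
    then show "Q \<in> {(S, z). finite S \<and> card S = n \<and> z \<notin> S}"
      using Q by (simp add: card_image)
  qed
  finally show ?thesis .
qed

text \<open>A sum over the points is symmetric in the numbering, hence descends to the quotient.
  Such sums are the source of continuous functions on unordered configurations; with bump functions
  as \<open>h\<close> they isolate single points.\<close>

lemma continuous_map_sum_uconf:
  fixes h :: "complex \<Rightarrow> 'a::real_normed_vector"
  assumes "continuous_on UNIV h"
  shows "continuous_map (uconf k) euclidean (\<lambda>S. \<Sum>z\<in>S. h z)"
proof (rule continuous_compose_quotient_map[OF quotient_uconf])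
  have h: "continuous_map euclidean euclidean h" using assms by simp
  have "continuous_map (conf k) euclidean (\<lambda>c. \<Sum>i<k. h (c i))"
    using continuous_map_compose[OF continuous_map_conf_proj h]
    by (intro continuous_intros) (auto simp: o_def)
  then show "continuous_map (conf k) euclidean ((\<lambda>S. \<Sum>z\<in>S. h z) \<circ> (\<lambda>c. c ` {..<k}))"
    by (rule continuous_map_eq) (auto simp: topspace_conf sum.reindex)
qed

lemma continuous_map_Max:
  assumes "\<And>i. i \<le> (n::nat) \<Longrightarrow> continuous_map X euclideanreal (f i)"
  shows "continuous_map X euclideanreal (\<lambda>x. Max ((\<lambda>i. f i x) ` {..n}))"
  using assms
proof (induction n)
  case (Suc n)
  have "Max ((\<lambda>i. f i x) ` {..Suc n}) = max (f (Suc n) x) (Max ((\<lambda>i. f i x) ` {..n}))" for x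
    by (simp add: atMost_Suc Max_insert)
  with Suc show ?case by (simp add: continuous_map_real_max)
qed simp

lemma continuous_map_far_point:
  assumes "n > 0" shows "continuous_map (uconf n) euclidean far_point"
proof (rule continuous_compose_quotient_map[OF quotient_uconf])
  obtain m where m: "{..<n} = {..m}" "n = Suc m"
    using assms by (metis gr0_conv_Suc lessThan_Suc_atMost)
  have "continuous_map (conf n) euclideanreal (\<lambda>c. Max ((\<lambda>i. cmod (c i)) ` {..m}) + 1)"
    by (intro continuous_intros continuous_map_Max continuous_map_conf_proj) (use m in auto)
  moreover have "continuous_map euclideanreal euclidean complex_of_real"
    by (simp add: continuous_on_of_real_id)
  ultimately have "continuous_map (conf n) euclidean
      (complex_of_real \<circ> (\<lambda>c. Max ((\<lambda>i. cmod (c i)) ` {..m}) + 1))"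
    by (rule continuous_map_compose)
  then show "continuous_map (conf n) euclidean (far_point \<circ> (\<lambda>c. c ` {..<n}))"
    by (rule continuous_map_eq) (simp add: far_point_def m image_image lessThan_Suc_atMost)
qed

lemma far_point_notin: assumes "finite S" shows "far_point S \<notin> S"
proof
  assume S: "far_point S \<in> S"
  then have "cmod (far_point S) \<le> Max (cmod ` S)" using assms by (intro Max_ge) auto
  \<comment> \<open>The assumption to be refuted makes \<open>S\<close> nonempty, so
    \<open>Max\<close> is a genuine maximum of norms and the norm of the far point is
    \<open>Max + 1\<close> rather than its absolute value with unknown sign.\<close>
  moreover have "0 \<le> Max (cmod ` S)"
    using S assms by (subst Max_ge_iff) (auto intro!: bexI[of _ "far_point S"])
  ultimately show False by (simp add: far_point_def)
qed

section \<open>Continuous numberings of moving configurations\<close>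

lemma finite_separation:
  fixes c :: "nat \<Rightarrow> complex"
  assumes "inj_on c {..<k}"
  obtains e where "e > 0" "\<And>i j. i < k \<Longrightarrow> j < k \<Longrightarrow> i \<noteq> j \<Longrightarrow> e \<le> dist (c i) (c j)"
proof
  let ?D = "insert 1 ((\<lambda>(i, j). dist (c i) (c j)) ` {(i, j). i < k \<and> j < k \<and> i \<noteq> j})"
  have "{(i, j). i < k \<and> j < k \<and> i \<noteq> j} \<subseteq> {..<k} \<times> {..<k}" by auto
  then have fin: "finite ?D" by (meson finite_SigmaI finite_imageI finite_insert finite_lessThan finite_subset)
  show "Min ?D > 0" using fin assms by (auto simp: inj_on_def Min_gr_iff)
  show "Min ?D \<le> dist (c i) (c j)" if "i < k" "j < k" "i \<noteq> j" for i j
    using that by (intro Min_le[OF fin]) auto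
qed

text \<open>Near \<open>x\<close> exactly one point of the configuration stays close to each
  \<open>c i\<close>, and a weighted sum over the whole configuration singles it out, so continuity
  comes from \<open>continuous_map_sum_uconf\<close>. The branches are continuous on all of
  \<open>X\<close>, but number the configuration only over \<open>U\<close>.\<close>

lemma uconf_branches:
  assumes a: "continuous_map X (uconf k) a" and x: "x \<in> topspace X"
  obtains U r where "openin X U" "x \<in> U"
    "\<And>i. i < k \<Longrightarrow> continuous_map X euclidean (r i)"
    "\<And>x'. x' \<in> U \<Longrightarrow> inj_on (\<lambda>i. r i x') {..<k} \<and> a x' = (\<lambda>i. r i x') ` {..<k}"
proof -
  have fin: "finite (a y) \<and> card (a y) = k" if "y \<in> topspace X" for y
    using continuous_map_image_subset_topspace[OF a] that by (auto simp: topspace_uconf)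
  obtain c where c: "inj_on c {..<k}" "c ` {..<k} = a x"
    using enumerate_configuration fin[OF x] by (metis (lifting) mem_Collect_eq topspace_conf)
  obtain e0 where "e0 > 0" and "\<And>i j. i < k \<Longrightarrow> j < k \<Longrightarrow> i \<noteq> j \<Longrightarrow> e0 \<le> dist (c i) (c j)"
    using finite_separation[OF c(1)] by blast
  then obtain e where e: "e > 0" and sep: "\<And>i j. i < k \<Longrightarrow> j < k \<Longrightarrow> i \<noteq> j \<Longrightarrow> 3 * e \<le> dist (c i) (c j)"
    by (metis mult.commute pos_divide_le_eq times_divide_eq_right divide_pos_pos
        nonzero_mult_div_cancel_left order_refl zero_less_numeral zero_neq_numeral)
  \<comment> \<open>The centers are 3e apart. \<open>\<sigma> i y\<close> is positive exactly when
    some point of \<open>a y\<close> is within e of \<open>c i\<close>, an open condition on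
    \<open>y\<close>. The weight \<open>\<phi> i\<close> is 1 within e of \<open>c i\<close> and 0
    from distance 2e on, where all points close to other centers lie.\<close>
  define \<sigma> where "\<sigma> = (\<lambda>i y. \<Sum>z\<in>a y. max 0 (1 - dist z (c i) / e))"
  define \<phi> where "\<phi> = (\<lambda>i z. min 1 (max 0 (2 - dist z (c i) / e)))"
  define r where "r = (\<lambda>i y. c i + (\<Sum>z\<in>a y. \<phi> i z *\<^sub>R (z - c i)))"
  define U where "U = (\<Inter>i\<in>{..<k}. {y \<in> topspace X. \<sigma> i y \<in> {0<..}}) \<inter> topspace X"
  have \<sigma>: "continuous_map X euclideanreal (\<sigma> i)" for i
  proof -
    have "continuous_on UNIV (\<lambda>z. max 0 (1 - dist z (c i) / e))"
      by (intro continuous_intros) (use e in auto)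
    from continuous_map_compose[OF a continuous_map_sum_uconf[OF this]] show ?thesis
      by (simp add: \<sigma>_def o_def)
  qed
  show ?thesis
  proof
    show "openin X U"
      unfolding U_def
      by (intro openin_INT openin_continuous_map_preimage[OF \<sigma>]) (auto simp flip: open_openin)
    show "x \<in> U"
    proof -
      have "\<sigma> i x > 0" if "i < k" for i
        unfolding \<sigma>_def
        using fin[OF x] c(2) that by (intro sum_pos2[of _ "c i"]) auto
      then show ?thesis using x by (auto simp: U_def)
    qed
    show "continuous_map X euclidean (r i)" for i
    proof -
      have "continuous_on UNIV (\<lambda>z. \<phi> i z *\<^sub>R (z - c i))"
        unfolding \<phi>_def by (intro continuous_intros) (use e in auto)
      from continuous_map_compose[OF a continuous_map_sum_uconf[OF this]] show ?thesis
        unfolding r_def by (intro continuous_intros) (auto simp: o_def)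
    qed
    fix y assume y: "y \<in> U"
    then have yX: "y \<in> topspace X" by (simp add: U_def)
    have "\<exists>z\<in>a y. dist z (c i) < e" if "i < k" for i
    proof (rule ccontr)
      assume "\<not> ?thesis"
      then have "\<sigma> i y = 0" unfolding \<sigma>_def using e by (intro sum.neutral) (auto simp: max_def)
      moreover have "\<sigma> i y > 0" using y that by (auto simp: U_def)
      ultimately show False by simp
    qed
    then obtain z where z: "\<And>i. i < k \<Longrightarrow> z i \<in> a y" "\<And>i. i < k \<Longrightarrow> dist (z i) (c i) < e"
      by metis
    have far: "2 * e \<le> dist (z j) (c i)" if "i < k" "j < k" "i \<noteq> j" for i j
      using sep[OF that] z(2)[OF that(2)] dist_triangle[of "c i" "c j" "z j"]
      by (simp add: dist_commute)
    have inj: "inj_on z {..<k}"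
    proof (rule inj_onI, rule ccontr)
      fix i j assume "i \<in> {..<k}" "j \<in> {..<k}" "z i = z j" "i \<noteq> j"
      then show False using far[of i j] z(2)[of i] e by auto
    qed
    \<comment> \<open>The \<open>z i\<close> are \<open>k\<close> distinct points of a set with
      \<open>k\<close> elements, so there is no further point in \<open>a y\<close>.\<close>
    have im: "z ` {..<k} = a y"
      using z(1) fin[OF yX] inj by (intro card_subset_eq) (auto simp: card_image)
    have rz: "r i y = z i" if i: "i < k" for i
    proof -
      have "(\<Sum>w\<in>a y. \<phi> i w *\<^sub>R (w - c i)) = (\<Sum>j<k. \<phi> i (z j) *\<^sub>R (z j - c i))"
        unfolding im[symmetric] using inj by (simp add: sum.reindex)
      also have "\<dots> = (\<Sum>j<k. if j = i then z i - c i else 0)"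
      proof (rule sum.cong[OF refl])
        fix j assume "j \<in> {..<k}"
        then show "\<phi> i (z j) *\<^sub>R (z j - c i) = (if j = i then z i - c i else 0)"
          using far[of i j] z(2)[of i] e i by (auto simp: \<phi>_def max_def min_def field_simps)
      qed
      finally show ?thesis using i by (simp add: r_def)
    qed
    show "inj_on (\<lambda>i. r i y) {..<k} \<and> a y = (\<lambda>i. r i y) ` {..<k}"
      using inj im by (auto simp: rz inj_on_def)
  qed
qed

lemma continuous_map_local:
  assumes "\<And>x. x \<in> topspace X \<Longrightarrow> \<exists>U. openin X U \<and> x \<in> U \<and> continuous_map (subtopology X U) Y f"
  shows "continuous_map X Y f"
proof (rule pasting_lemma[where I = "{U. openin X U \<and> continuous_map (subtopology X U) Y f}"
      and T = "\<lambda>U. U" and f = "\<lambda>_. f"])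
  show "\<exists>j. j \<in> {U. openin X U \<and> continuous_map (subtopology X U) Y f} \<and> x \<in> j \<and> f x = f x"
    if "x \<in> topspace X" for x
    using assms[OF that] by blast
qed auto

text \<open>A local continuous numbering lifts the map to the ordered space, and the quotient map
  brings it back; this is the counterpart of \<open>uconf_branches\<close>.\<close>

lemma continuous_map_uconf_branches:
  assumes "\<And>x. x \<in> topspace X \<Longrightarrow> \<exists>U r. openin X U \<and> x \<in> U \<and>
      (\<forall>i<k. continuous_map (subtopology X U) euclidean (r i)) \<and>
      (\<forall>x'\<in>U. inj_on (\<lambda>i. r i x') {..<k} \<and> a x' = (\<lambda>i. r i x') ` {..<k})"
  shows "continuous_map X (uconf k) a"
proof (rule continuous_map_local)
  fix x assume "x \<in> topspace X"
  with assms obtain U r where U: "openin X U" "x \<in> U"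
      "\<And>i. i < k \<Longrightarrow> continuous_map (subtopology X U) euclidean (r i)"
      "\<And>x'. x' \<in> U \<Longrightarrow> inj_on (\<lambda>i. r i x') {..<k} \<and> a x' = (\<lambda>i. r i x') ` {..<k}"
    by metis
  let ?c = "\<lambda>x. \<lambda>i\<in>{..<k}. r i x"
  have "continuous_map (subtopology X U) (conf k) ?c"
    unfolding continuous_map_conf
  proof (intro conjI ballI allI impI)
    show "inj_on (?c y) {..<k}" if "y \<in> topspace (subtopology X U)" for y
      using U(4)[of y] that by (subst inj_on_cong[of _ _ "\<lambda>i. r i y"]) auto
  qed (use U(3) in auto)
  from continuous_map_compose[OF this quotient_imp_continuous_map[OF quotient_uconf]]
  have "continuous_map (subtopology X U) (uconf k) a"
    by (rule continuous_map_eq) (use U(4) in auto)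
  with U show "\<exists>U. openin X U \<and> x \<in> U \<and> continuous_map (subtopology X U) (uconf k) a" by blast
qed

lemma continuous_map_conf_pt_fst: "continuous_map (conf_pt n) (uconf n) fst"
proof (rule continuous_compose_quotient_map[OF quotient_conf_pt])
  have "continuous_map (conf (n + 1)) (conf n) (\<lambda>c. restrict c {..<n})"
    unfolding continuous_map_conf
    by (auto simp: topspace_conf inj_on_def intro: continuous_map_conf_proj)
  from continuous_map_compose[OF this quotient_imp_continuous_map[OF quotient_uconf]]
  show "continuous_map (conf (n + 1)) (uconf n) (fst \<circ> (\<lambda>c. (c ` {..<n}, c n)))"
    by (rule continuous_map_eq) auto
qed

lemma continuous_map_conf_pt_snd: "continuous_map (conf_pt n) euclidean snd"
  by (rule continuous_compose_quotient_map[OF quotient_conf_pt])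
    (simp add: o_def continuous_map_conf_proj)

text \<open>The space of configurations with an extra point is a quotient of an ordered space, not a
  subspace of a product, so joint continuity is not automatic: a local numbering of \<open>a\<close>
  is extended by \<open>w\<close> as its last entry and projected.\<close>

lemma continuous_map_conf_ptI:
  assumes a: "continuous_map X (uconf n) a" and w: "continuous_map X euclidean w"
    and notin: "\<And>x. x \<in> topspace X \<Longrightarrow> w x \<notin> a x"
  shows "continuous_map X (conf_pt n) (\<lambda>x. (a x, w x))"
proof (rule continuous_map_local)
  fix x assume x: "x \<in> topspace X"
  obtain U r where U: "openin X U" "x \<in> U"
      "\<And>i. i < n \<Longrightarrow> continuous_map X euclidean (r i)"
      "\<And>x'. x' \<in> U \<Longrightarrow> inj_on (\<lambda>i. r i x') {..<n} \<and> a x' = (\<lambda>i. r i x') ` {..<n}"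
    using uconf_branches[OF a x] by metis
  let ?c = "\<lambda>x. (\<lambda>i\<in>{..<n}. r i x)(n := w x)"
  have "continuous_map (subtopology X U) (conf (n + 1)) ?c"
    unfolding continuous_map_conf
  proof (intro conjI ballI allI impI)
    fix y assume "y \<in> topspace (subtopology X U)"
    then have y: "y \<in> U" "w y \<notin> a y" using notin by auto
    have "inj_on (?c y) {..<n}"
      using U(4)[OF y(1)] by (subst inj_on_cong[of _ _ "\<lambda>i. r i y"]) auto
    moreover have "?c y ` {..<n} = a y" using U(4)[OF y(1)] by auto
    ultimately show "inj_on (?c y) {..<n + 1}"
      using y(2) by (simp add: lessThan_Suc)
  next
    fix i assume "i < n + 1"
    then show "continuous_map (subtopology X U) euclidean (\<lambda>x. ?c x i)"
      using U(3)[of i] w by (cases "i = n") (auto intro: continuous_map_from_subtopology)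
  qed (auto simp: extensional_def)
  from continuous_map_compose[OF this quotient_imp_continuous_map[OF quotient_conf_pt]]
  have "continuous_map (subtopology X U) (conf_pt n) (\<lambda>x. (a x, w x))"
    by (rule continuous_map_eq) (use U(4) in auto)
  with U show "\<exists>U. openin X U \<and> x \<in> U \<and> continuous_map (subtopology X U) (conf_pt n) (\<lambda>x. (a x, w x))"
    by blast
qed

lemma continuous_map_conf_pt:
  "continuous_map X (conf_pt n) f \<longleftrightarrow>
     continuous_map X (uconf n) (fst \<circ> f) \<and> continuous_map X euclidean (snd \<circ> f) \<and>
     (\<forall>x\<in>topspace X. snd (f x) \<notin> fst (f x))"
proof (intro iffI conjI ballI)
  assume f: "continuous_map X (conf_pt n) f"
  show "continuous_map X (uconf n) (fst \<circ> f)" "continuous_map X euclidean (snd \<circ> f)"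
    using continuous_map_compose[OF f] continuous_map_conf_pt_fst continuous_map_conf_pt_snd by auto
  show "snd (f x) \<notin> fst (f x)" if "x \<in> topspace X" for x
    using continuous_map_image_subset_topspace[OF f] that by (fastforce simp: topspace_conf_pt)
next
  assume "continuous_map X (uconf n) (fst \<circ> f) \<and> continuous_map X euclidean (snd \<circ> f) \<and>
     (\<forall>x\<in>topspace X. snd (f x) \<notin> fst (f x))"
  then show "continuous_map X (conf_pt n) f"
    using continuous_map_conf_ptI[of X n "fst \<circ> f" "snd \<circ> f"] by simp
qed

text \<open>The tautological covering whose fiber over \<open>x\<close> is the configuration itself;
  its sheets over a small open set are the graphs of the local branches.\<close>

lemma covering_space_configuration:
  fixes G :: "'a::real_normed_vector \<Rightarrow> complex set"
  assumes G: "continuous_map (top_of_set Q) (uconf n) G" and n: "n > 0"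
  shows "covering_space {(x, z). x \<in> Q \<and> z \<in> G x} fst Q"
  unfolding covering_space_def
proof (intro conjI ballI)
  let ?C = "{(x, z). x \<in> Q \<and> z \<in> G x}"
  have fin: "finite (G y) \<and> card (G y) = n" if "y \<in> Q" for y
    using continuous_map_image_subset_topspace[OF G] that by (auto simp: topspace_uconf)
  show "continuous_on ?C fst" by (intro continuous_intros)
  have "G y \<noteq> {}" if "y \<in> Q" for y using fin[OF that] n by auto
  then show "fst ` ?C = Q" by force
  fix x assume "x \<in> Q"
  then have "x \<in> topspace (top_of_set Q)" by simp
  from uconf_branches[OF G this] obtain U r
    where U: "openin (top_of_set Q) U" "x \<in> U"
      and r: "\<And>i. i < n \<Longrightarrow> continuous_on Q (r i)"
      and Ur: "\<And>x'. x' \<in> U \<Longrightarrow> inj_on (\<lambda>i. r i x') {..<n} \<and> G x' = (\<lambda>i. r i x') ` {..<n}"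
    by (metis continuous_map_iff_continuous)
  have UQ: "U \<subseteq> Q" using U(1) by (rule openin_imp_subset)
  define u where "u = (\<lambda>i. (\<lambda>y. (y, r i y)) ` U)"
  show "\<exists>T. x \<in> T \<and> openin (top_of_set Q) T \<and>
          (\<exists>v. \<Union> v = ?C \<inter> fst -` T \<and> (\<forall>u\<in>v. openin (top_of_set ?C) u) \<and>
             pairwise disjnt v \<and> (\<forall>u\<in>v. \<exists>q. homeomorphism u T fst q))"
  proof (intro exI[of _ U] conjI exI[of _ "u ` {..<n}"] ballI)
    show "\<Union> (u ` {..<n}) = ?C \<inter> fst -` U"
      using UQ Ur by (fastforce simp: u_def)
    show "pairwise disjnt (u ` {..<n})"
      using Ur by (auto simp: pairwise_def disjnt_def u_def inj_on_def)
  next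
    fix w assume "w \<in> u ` {..<n}"
    then obtain i where i: "i < n" "w = u i" by auto
    have "openin (top_of_set ?C) (?C \<inter> fst -` U)"
      using U(1) by (intro continuous_openin_preimage[of _ _ Q] continuous_intros) auto
    \<comment> \<open>The graph of branch \<open>i\<close> is given by a closed equation; it is open
      because among the \<open>n\<close> possible values it is also where the product of the
      distances to the other branches is positive.\<close>
    moreover have "openin (top_of_set ?C) (?C \<inter> (\<lambda>p. \<Prod>j\<in>{..<n} - {i}. cmod (snd p - r j (fst p))) -` {0<..})"
      by (intro continuous_openin_preimage[of _ _ UNIV] continuous_intros continuous_on_compose2[OF r]) auto
    ultimately have "openin (top_of_set ?C) ((?C \<inter> fst -` U) \<inter>
        (?C \<inter> (\<lambda>p. \<Prod>j\<in>{..<n} - {i}. cmod (snd p - r j (fst p))) -` {0<..}))"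
      by (rule openin_Int)
    moreover have "(?C \<inter> fst -` U) \<inter>
        (?C \<inter> (\<lambda>p. \<Prod>j\<in>{..<n} - {i}. cmod (snd p - r j (fst p))) -` {0<..}) = w"
    proof (intro subset_antisym subsetI)
      fix p assume p: "p \<in> (?C \<inter> fst -` U) \<inter>
        (?C \<inter> (\<lambda>p. \<Prod>j\<in>{..<n} - {i}. cmod (snd p - r j (fst p))) -` {0<..})"
      then obtain j where j: "j < n" "snd p = r j (fst p)" using Ur[of "fst p"] by auto
      have "(\<Prod>j\<in>{..<n} - {i}. cmod (snd p - r j (fst p))) > 0" using p by simp
      moreover have "(\<Prod>j\<in>{..<n} - {i}. cmod (snd p - r j (fst p))) = 0" if "j \<noteq> i"
        using that j by (intro prod_zero) (auto intro!: bexI[of _ j])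
      ultimately have "j = i" by (metis less_irrefl)
      then show "p \<in> w" using p j unfolding i(2) u_def by (intro image_eqI[of _ _ "fst p"]) auto
    next
      fix p assume "p \<in> w"
      then obtain y where y: "y \<in> U" "p = (y, r i y)" by (auto simp: i u_def)
      have "0 < (\<Prod>j\<in>{..<n} - {i}. cmod (r i y - r j y))"
        using Ur[OF y(1)] i(1) by (intro prod_pos) (auto simp: inj_on_def)
      then show "p \<in> (?C \<inter> fst -` U) \<inter>
        (?C \<inter> (\<lambda>p. \<Prod>j\<in>{..<n} - {i}. cmod (snd p - r j (fst p))) -` {0<..})"
        using y UQ i(1) Ur[OF y(1)] by auto
    qed
    ultimately show "openin (top_of_set ?C) w" by simp
    have "continuous_on U (\<lambda>y. (y, r i y))"
      using continuous_on_subset[OF r[OF i(1)] UQ] by (intro continuous_intros)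
    then have "homeomorphism w U fst (\<lambda>y. (y, r i y))"
      unfolding homeomorphism_def i(2) u_def by (auto intro!: continuous_intros simp: image_image)
    then show "\<exists>q. homeomorphism w U fst q" by blast
  qed (use U in auto)
qed

text \<open>A convex set is simply connected and locally path-connected, so the covering has a
  section through each of the \<open>n\<close> points over a chosen base point, and these sections
  are the global numbering.\<close>

lemma configuration_lift_convex:
  fixes G :: "'a::real_normed_vector \<Rightarrow> complex set"
  assumes G: "continuous_map (top_of_set Q) (uconf n) G" and Q: "convex Q"
  obtains k where "\<And>i. i < n \<Longrightarrow> continuous_on Q (k i)"
    "\<And>x. x \<in> Q \<Longrightarrow> inj_on (\<lambda>i. k i x) {..<n}"
    "\<And>x. x \<in> Q \<Longrightarrow> G x = (\<lambda>i. k i x) ` {..<n}"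
proof (cases "Q = {} \<or> n = 0")
  case True
  have "finite (G y) \<and> card (G y) = n" if "y \<in> Q" for y
    using continuous_map_image_subset_topspace[OF G] that by (auto simp: topspace_uconf)
  then have "n = 0 \<Longrightarrow> y \<in> Q \<Longrightarrow> G y = {}" for y by force
  then show ?thesis using True by (intro that[of "\<lambda>_ _. 0"]) auto
next
  case False
  then obtain x0 where x0: "x0 \<in> Q" and n: "n > 0" by auto
  let ?C = "{(x, z). x \<in> Q \<and> z \<in> G x}"
  have fin: "finite (G y) \<and> card (G y) = n" if "y \<in> Q" for y
    using continuous_map_image_subset_topspace[OF G] that by (auto simp: topspace_uconf)
  note cov = covering_space_configuration[OF G n]
  obtain c where c: "inj_on c {..<n}" "c ` {..<n} = G x0"
    using enumerate_configuration fin[OF x0] by (metis (lifting) mem_Collect_eq topspace_conf)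
  define L where "L i g \<longleftrightarrow> continuous_on Q g \<and> g \<in> Q \<rightarrow> ?C \<and> g x0 = (x0, c i) \<and> (\<forall>y\<in>Q. fst (g y) = y)"
    for i g
  have "\<exists>g. L i g" if "i < n" for i
  proof -
    have "(x0, c i) \<in> ?C" using x0 c that by auto
    then obtain g where "continuous_on Q g" "g \<in> Q \<rightarrow> ?C" "g x0 = (x0, c i)"
        "\<And>y. y \<in> Q \<Longrightarrow> fst (g y) = y"
      by (rule covering_space_lift_strong[OF cov _ x0 convex_imp_simply_connected[OF Q]
            convex_imp_locally_path_connected[OF Q] continuous_on_id]) auto
    then show ?thesis by (intro exI[of _ g]) (simp add: L_def)
  qed
  then obtain g where "\<And>i. i < n \<Longrightarrow> L i (g i)" by metis
  then have g: "\<And>i. i < n \<Longrightarrow> continuous_on Q (g i)" "\<And>i. i < n \<Longrightarrow> g i \<in> Q \<rightarrow> ?C"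
      "\<And>i. i < n \<Longrightarrow> g i x0 = (x0, c i)" "\<And>i y. i < n \<Longrightarrow> y \<in> Q \<Longrightarrow> fst (g i y) = y"
    by (simp_all add: L_def)
  have inj: "inj_on (\<lambda>i. snd (g i x)) {..<n}" if x: "x \<in> Q" for x
  proof (rule inj_onI)
    fix i j assume ij: "i \<in> {..<n}" "j \<in> {..<n}" and "snd (g i x) = snd (g j x)"
    then have "g i x = g j x" using g(4) x by (simp add: prod_eq_iff)
    \<comment> \<open>Two lifts that meet once agree on the whole connected set, so a collision at
      \<open>x\<close> would force one at the base point.\<close>
    then have "g i x0 = g j x0"
      by (rule covering_space_lift_unique[OF cov _ continuous_on_id, where T = Q])
        (use ij g(1,2,4) x x0 convex_connected[OF Q] in simp_all)
    then show "i = j" using g(3) ij c(1) by (auto simp: inj_on_def)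
  qed
  show ?thesis
  proof (rule that[of "\<lambda>i x. snd (g i x)"])
    show "continuous_on Q (\<lambda>x. snd (g i x))" if "i < n" for i
      using g(1)[OF that] by (rule continuous_on_snd)
    fix x assume x: "x \<in> Q"
    show "inj_on (\<lambda>i. snd (g i x)) {..<n}" using inj x .
    have "snd (g i x) \<in> G x" if "i < n" for i
      using funcset_mem[OF g(2)[OF that] x] g(4)[OF that x] by (cases "g i x") auto
    then have "(\<lambda>i. snd (g i x)) ` {..<n} = G x"
      using fin[OF x] inj[OF x] by (intro card_subset_eq) (auto simp: card_image)
    then show "G x = (\<lambda>i. snd (g i x)) ` {..<n}" by simp
  qed
qed

section \<open>Pushing points of the plane\<close>

text \<open>Tent functions have the explicit Lipschitz constant \<open>1/\<epsilon>\<close>, so the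
  displacement has Lipschitz constant at most the total shift of the \<open>m\<close> points divided
  by \<epsilon>. This is the origin of the smallness condition in the lemmas that follow.\<close>

definition push :: "nat \<Rightarrow> real \<Rightarrow> (nat \<Rightarrow> complex) \<Rightarrow> (nat \<Rightarrow> complex) \<Rightarrow> complex \<Rightarrow> complex" where
  "push m \<epsilon> k k' z = z + (\<Sum>i<m. max 0 (1 - dist z (k i) / \<epsilon>) *\<^sub>R (k' i - k i))"

lemma push_lipschitz:
  assumes "\<epsilon> > 0"
  shows "norm ((push m \<epsilon> k k' z - z) - (push m \<epsilon> k k' w - w))
    \<le> (\<Sum>i<m. norm (k' i - k i)) / \<epsilon> * norm (z - w)"
proof -
  have "\<bar>max 0 (1 - dist z (k i) / \<epsilon>) - max 0 (1 - dist w (k i) / \<epsilon>)\<bar> \<le> norm (z - w) / \<epsilon>" for i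
  proof -
    have "\<bar>max 0 (1 - dist z (k i) / \<epsilon>) - max 0 (1 - dist w (k i) / \<epsilon>)\<bar>
        \<le> \<bar>dist w (k i) / \<epsilon> - dist z (k i) / \<epsilon>\<bar>" by linarith
    also have "\<dots> = \<bar>dist w (k i) - dist z (k i)\<bar> / \<epsilon>"
      using assms by (simp add: diff_divide_distrib[symmetric])
    also have "\<dots> \<le> norm (z - w) / \<epsilon>"
      using assms abs_dist_diff_le[of w "k i" z]
      by (intro divide_right_mono) (simp_all add: dist_norm norm_minus_commute dist_commute)
    finally show ?thesis .
  qed
  then have *: "norm ((max 0 (1 - dist z (k i) / \<epsilon>) - max 0 (1 - dist w (k i) / \<epsilon>)) *\<^sub>R (k' i - k i))
      \<le> norm (z - w) / \<epsilon> * norm (k' i - k i)" for i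
    unfolding norm_scaleR by (intro mult_right_mono) auto
  have "norm ((push m \<epsilon> k k' z - z) - (push m \<epsilon> k k' w - w)) =
      norm (\<Sum>i<m. (max 0 (1 - dist z (k i) / \<epsilon>) - max 0 (1 - dist w (k i) / \<epsilon>)) *\<^sub>R (k' i - k i))"
    by (simp add: push_def sum_subtractf scaleR_left_diff_distrib)
  also have "\<dots> \<le> (\<Sum>i<m. norm (z - w) / \<epsilon> * norm (k' i - k i))"
    using * by (rule sum_norm_le)
  also have "\<dots> = (\<Sum>i<m. norm (k' i - k i)) / \<epsilon> * norm (z - w)"
    by (simp add: sum_distrib_left sum_divide_distrib mult.commute)
  finally show ?thesis .
qed

text \<open>The reverse triangle inequality against the Lipschitz displacement. Besides injectivity,
  the quantitative form later controls how preimages vary with parameters.\<close>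

lemma push_expansive:
  assumes "\<epsilon> > 0"
  shows "(1 - (\<Sum>i<m. norm (k' i - k i)) / \<epsilon>) * norm (z - w) \<le> norm (push m \<epsilon> k k' z - push m \<epsilon> k k' w)"
proof -
  have "norm (z - w) = norm ((push m \<epsilon> k k' z - push m \<epsilon> k k' w)
      - ((push m \<epsilon> k k' z - z) - (push m \<epsilon> k k' w - w)))"
    by (simp add: algebra_simps)
  also have "\<dots> \<le> norm (push m \<epsilon> k k' z - push m \<epsilon> k k' w)
      + norm ((push m \<epsilon> k k' z - z) - (push m \<epsilon> k k' w - w))"
    by (rule norm_triangle_ineq4)
  finally show ?thesis using push_lipschitz[OF assms, of m k k' z w] by (simp add: algebra_simps)
qed

lemma inj_push:
  assumes "\<epsilon> > 0" "(\<Sum>i<m. norm (k' i - k i)) < \<epsilon>"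
  shows "inj (push m \<epsilon> k k')"
proof (rule injI)
  fix z w assume "push m \<epsilon> k k' z = push m \<epsilon> k k' w"
  then have "(1 - (\<Sum>i<m. norm (k' i - k i)) / \<epsilon>) * norm (z - w) \<le> 0"
    using push_expansive[OF assms(1), of k' k m z w] by simp
  moreover have "1 - (\<Sum>i<m. norm (k' i - k i)) / \<epsilon> > 0" using assms by simp
  ultimately show "z = w" by (simp add: mult_le_0_iff)
qed

text \<open>A preimage of \<open>w\<close> is a fixed point of
  \<open>z \<mapsto> w - (push z - z)\<close>, a contraction for small total displacement.\<close>

lemma surj_push:
  assumes "\<epsilon> > 0" "(\<Sum>i<m. norm (k' i - k i)) < \<epsilon>"
  shows "surj (push m \<epsilon> k k')"
proof -
  have "\<exists>z. push m \<epsilon> k k' z = w" for w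
  proof -
    let ?q = "(\<Sum>i<m. norm (k' i - k i)) / \<epsilon>"
    have "dist (w - (push m \<epsilon> k k' x - x)) (w - (push m \<epsilon> k k' y - y)) \<le> ?q * dist x y" for x y
      using push_lipschitz[OF assms(1), of m k k' x y]
      by (simp add: dist_norm norm_minus_commute algebra_simps)
    moreover have "0 \<le> ?q" "?q < 1" using assms by (simp_all add: sum_nonneg)
    ultimately have "\<exists>!z. w - (push m \<epsilon> k k' z - z) = z"
      by (intro banach_fix_type) auto
    then show ?thesis by (auto simp: algebra_simps)
  qed
  then show ?thesis by (metis surjI)
qed

text \<open>The other bumps have radius \<epsilon> and vanish at \<open>k i\<close>, while its own
  bump has height 1 there.\<close>

lemma push_point:
  assumes "\<epsilon> > 0" "i < m" "\<And>j. j < m \<Longrightarrow> j \<noteq> i \<Longrightarrow> \<epsilon> \<le> dist (k i) (k j)"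
  shows "push m \<epsilon> k k' (k i) = k' i"
proof -
  have "max 0 (1 - dist (k i) (k j) / \<epsilon>) *\<^sub>R (k' j - k j) = (if j = i then k' i - k i else 0)"
    if "j < m" for j
    using assms(1) assms(3)[OF that] by (auto simp: max_def field_simps)
  then have "(\<Sum>j<m. max 0 (1 - dist (k i) (k j) / \<epsilon>) *\<^sub>R (k' j - k j))
      = (\<Sum>j<m. if j = i then k' i - k i else 0)"
    by (intro sum.cong) auto
  then show ?thesis using assms(2) by (simp add: push_def)
qed

lemma push_id: "(\<And>i. i < m \<Longrightarrow> k' i = k i) \<Longrightarrow> push m \<epsilon> k k' z = z"
  by (simp add: push_def)

lemma continuous_on_push:
  assumes "\<And>i. i < m \<Longrightarrow> continuous_on S (\<lambda>x. k x i)" "\<And>i. i < m \<Longrightarrow> continuous_on S (\<lambda>x. k' x i)"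
    "continuous_on S z" "\<epsilon> > 0"
  shows "continuous_on S (\<lambda>x. push m \<epsilon> (k x) (k' x) (z x))"
  unfolding push_def by (intro continuous_intros assms) (use assms in auto)

text \<open>A single push is known to be invertible only for small displacements; a long motion is
  therefore cut into legs, with \<open>c j\<close> the configuration after \<open>j\<close> of
  them.\<close>

primrec push_chain ::
  "nat \<Rightarrow> real \<Rightarrow> (nat \<Rightarrow> nat \<Rightarrow> complex) \<Rightarrow> nat \<Rightarrow> complex \<Rightarrow> complex" where
  "push_chain m \<epsilon> c 0 z = z"
| "push_chain m \<epsilon> c (Suc j) z = push m \<epsilon> (c j) (c (Suc j)) (push_chain m \<epsilon> c j z)"

lemma inj_push_chain:
  assumes "\<epsilon> > 0" "\<And>j. j < N \<Longrightarrow> (\<Sum>i<m. norm (c (Suc j) i - c j i)) < \<epsilon>"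
  shows "inj (push_chain m \<epsilon> c N)"
  using assms(2)
proof (induction N)
  case (Suc N)
  then have "inj (push m \<epsilon> (c N) (c (Suc N)) \<circ> push_chain m \<epsilon> c N)"
    using assms(1) by (intro inj_compose inj_push) auto
  then show ?case by (simp add: o_def inj_def)
qed (simp add: inj_def)

lemma push_chain_point:
  assumes "\<epsilon> > 0" "i < m"
    "\<And>j i'. j < N \<Longrightarrow> i' < m \<Longrightarrow> i' \<noteq> i \<Longrightarrow> \<epsilon> \<le> dist (c j i) (c j i')"
  shows "push_chain m \<epsilon> c N (c 0 i) = c N i"
  using assms(3) by (induction N) (simp_all add: push_point assms(1,2))

lemma push_chain_id:
  assumes "\<And>j i. j \<le> N \<Longrightarrow> i < m \<Longrightarrow> c j i = c 0 i"
  shows "push_chain m \<epsilon> c N z = z"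
  using assms
proof (induction N)
  case (Suc N)
  have "c (Suc N) i = c N i" if "i < m" for i
    using trans[OF Suc.prems[of "Suc N" i] sym[OF Suc.prems[of N i]]] that by simp
  moreover have "push_chain m \<epsilon> c N z = z" by (intro Suc.IH Suc.prems) simp_all
  ultimately show ?case unfolding push_chain.simps by (metis push_id)
qed simp

lemma continuous_on_push_chain:
  assumes "\<epsilon> > 0" "\<And>i j. i < m \<Longrightarrow> j \<le> N \<Longrightarrow> continuous_on S (\<lambda>x. c x j i)" "continuous_on S z"
  shows "continuous_on S (\<lambda>x. push_chain m \<epsilon> (c x) N (z x))"
  using assms(2)
proof (induction N)
  case (Suc N)
  then show ?case
    using assms(1) by (auto intro!: continuous_on_push)
qed (use assms(3) in simp)

lemma compact_configuration_separation:
  fixes k :: "nat \<Rightarrow> 'a::topological_space \<Rightarrow> complex"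
  assumes "compact Q" and k: "\<And>i. i < m \<Longrightarrow> continuous_on Q (k i)"
    and inj: "\<And>x. x \<in> Q \<Longrightarrow> inj_on (\<lambda>i. k i x) {..<m}"
  obtains \<epsilon> where "\<epsilon> > 0"
    "\<And>x i j. x \<in> Q \<Longrightarrow> i < m \<Longrightarrow> j < m \<Longrightarrow> i \<noteq> j \<Longrightarrow> \<epsilon> \<le> dist (k i x) (k j x)"
proof -
  \<comment> \<open>Each pair attains a positive minimal distance on a nonempty compact
    \<open>Q\<close>. Phrasing the bound as a property of all sufficiently small positive numbers
    lets finitely many pairs be combined at once and includes an empty \<open>Q\<close>.\<close>
  define P where "P = (\<lambda>p (\<epsilon>::real). \<forall>x\<in>Q. fst p \<noteq> snd p \<longrightarrow> \<epsilon> \<le> dist (k (fst p) x) (k (snd p) x))"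
  have "eventually (P p) (at_right 0)" if p: "p \<in> {..<m} \<times> {..<m}" for p
  proof (cases "fst p = snd p \<or> Q = {}")
    case False
    have "continuous_on Q (\<lambda>x. dist (k (fst p) x) (k (snd p) x))"
      using p by (intro continuous_intros k) auto
    then obtain x where x: "x \<in> Q"
        "\<forall>y\<in>Q. dist (k (fst p) x) (k (snd p) x) \<le> dist (k (fst p) y) (k (snd p) y)"
      using continuous_attains_inf[OF assms(1)] False by blast
    have "0 < dist (k (fst p) x) (k (snd p) x)"
      using inj[OF x(1)] p False by (auto simp: inj_on_def)
    then show ?thesis
      unfolding eventually_at_right_field
      by (intro exI[of _ "dist (k (fst p) x) (k (snd p) x)"]) (use x(2) in \<open>force simp: P_def\<close>)
  qed (auto simp: P_def)
  then have "eventually (\<lambda>\<epsilon>. \<forall>p\<in>{..<m} \<times> {..<m}. P p \<epsilon>) (at_right 0)"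
    by (intro eventually_ball_finite) auto
  then obtain b where b: "b > 0" "\<And>\<epsilon>. 0 < \<epsilon> \<Longrightarrow> \<epsilon> < b \<Longrightarrow> \<forall>p\<in>{..<m} \<times> {..<m}. P p \<epsilon>"
    unfolding eventually_at_right_field by blast
  show ?thesis
  proof (rule that[of "b / 2"])
    fix x i j assume "x \<in> Q" "i < m" "j < m" "i \<noteq> j"
    then show "b / 2 \<le> dist (k i x) (k j x)"
      using b(2)[of "b / 2"] b(1) by (auto simp: P_def)
  qed (use b in simp)
qed

text \<open>A moving configuration \<open>k\<close> on the unit square is followed in the first coordinate: \<open>\<Phi>\<close>
  pushes it forward from time 0 and \<open>\<Psi>\<close> pushes it back to time 0.\<close>

lemma configuration_isotopy:
  fixes k :: "nat \<Rightarrow> real \<times> real \<Rightarrow> complex"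
  assumes k: "\<And>i. i < m \<Longrightarrow> continuous_on ({0..1} \<times> {0..1}) (k i)"
    and inj: "\<And>x. x \<in> {0..1} \<times> {0..1} \<Longrightarrow> inj_on (\<lambda>i. k i x) {..<m}"
  obtains \<Phi> \<Psi> :: "real \<times> real \<Rightarrow> complex \<Rightarrow> complex" where
    "continuous_on (({0..1} \<times> {0..1}) \<times> UNIV) (\<lambda>p. \<Phi> (fst p) (snd p))"
    "continuous_on (({0..1} \<times> {0..1}) \<times> UNIV) (\<lambda>p. \<Psi> (fst p) (snd p))"
    "\<And>x. x \<in> {0..1} \<times> {0..1} \<Longrightarrow> inj (\<Phi> x)" "\<And>x. x \<in> {0..1} \<times> {0..1} \<Longrightarrow> inj (\<Psi> x)"
    "\<And>s u i. s \<in> {0..1} \<Longrightarrow> u \<in> {0..1} \<Longrightarrow> i < m \<Longrightarrow> \<Phi> (s, u) (k i (0, u)) = k i (s, u)"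
    "\<And>s u i. s \<in> {0..1} \<Longrightarrow> u \<in> {0..1} \<Longrightarrow> i < m \<Longrightarrow> \<Psi> (s, u) (k i (s, u)) = k i (0, u)"
    "\<And>u z. u \<in> {0..1} \<Longrightarrow> \<Phi> (0, u) z = z"
    "\<And>s u z. s \<in> {0..1} \<Longrightarrow> u \<in> {0..1} \<Longrightarrow> (\<And>i t. i < m \<Longrightarrow> t \<in> {0..s} \<Longrightarrow> k i (t, u) = k i (0, u))
       \<Longrightarrow> \<Psi> (s, u) z = z"
proof -
  let ?Q = "{0..1::real} \<times> {0..1::real}"
  have Q: "compact ?Q" by (intro compact_Times compact_Icc)
  obtain \<epsilon> where \<epsilon>: "\<epsilon> > 0"
    and sep: "\<And>x i j. x \<in> ?Q \<Longrightarrow> i < m \<Longrightarrow> j < m \<Longrightarrow> i \<noteq> j \<Longrightarrow> \<epsilon> \<le> dist (k i x) (k j x)"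
    using compact_configuration_separation[of ?Q m k] Q k inj by blast
  \<comment> \<open>The total displacement between two moments. Its uniform continuity on the
    compact product, compared with the diagonal where it vanishes, gives a time step whose
    displacement is below the separation \<epsilon>.\<close>
  define F where "F = (\<lambda>p. \<Sum>i<m. norm (k i (fst p) - k i (snd p)))"
  have "continuous_on (?Q \<times> ?Q) F"
    unfolding F_def
    by (intro continuous_intros continuous_on_compose2[OF k]) auto
  then have "uniformly_continuous_on (?Q \<times> ?Q) F"
    by (intro compact_uniformly_continuous compact_Times[OF Q Q])
  then obtain \<delta> where \<delta>: "\<delta> > 0"
    "\<And>p q. p \<in> ?Q \<times> ?Q \<Longrightarrow> q \<in> ?Q \<times> ?Q \<Longrightarrow> dist p q < \<delta> \<Longrightarrow> dist (F p) (F q) < \<epsilon>"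
    unfolding uniformly_continuous_on_def using \<epsilon> by metis
  have close: "(\<Sum>i<m. norm (k i x - k i y)) < \<epsilon>" if "x \<in> ?Q" "y \<in> ?Q" "dist x y < \<delta>" for x y
  proof -
    have "dist (F (x, y)) (F (y, y)) < \<epsilon>"
      using that by (intro \<delta>(2)) (auto simp: dist_Pair_Pair)
    moreover have "F (y, y) = 0" by (simp add: F_def)
    ultimately show ?thesis by (simp add: F_def dist_norm)
  qed
  obtain N :: nat where N: "N > 0" "1 / real N < \<delta>"
    using \<delta>(1) by (metis nat_approx_posE of_nat_0_less_iff zero_less_Suc of_nat_Suc)
  \<comment> \<open>The motion is stopped at time \<open>fst x\<close>: the number \<open>N\<close>
    of pushes is the same for every end time, those after it being trivial, and this makes the
    composite continuous in the end time as well.\<close>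
  define c where "c = (\<lambda>(x::real \<times> real) j i. k i (min (fst x) (real j / real N), snd x))"
  define d where "d = (\<lambda>(x::real \<times> real) j i. k i (min (fst x) (real (N - j) / real N), snd x))"
  define \<Phi> where "\<Phi> = (\<lambda>x. push_chain m \<epsilon> (c x) N)"
  \<comment> \<open>A chain along the reversed motion instead of the inverse of
    \<open>\<Phi> x\<close>: joint continuity is then immediate, and the two agree with mutual
    inverses on the tracked points, which is all that is required of them.\<close>
  define \<Psi> where "\<Psi> = (\<lambda>x. push_chain m \<epsilon> (d x) N)"
  have in_Q: "(min (fst x) (real j / real N), snd x) \<in> ?Q" if "x \<in> ?Q" for x j
    using that by (auto simp: min_def)
  have step: "(\<Sum>i<m. norm (k i (min (fst x) (real j / real N), snd x)
      - k i (min (fst x) (real j' / real N), snd x))) < \<epsilon>"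
    if "x \<in> ?Q" "j = Suc j' \<or> j' = Suc j" for x j j'
  proof (rule close[OF in_Q in_Q], fact, fact)
    have "\<bar>real j / real N - real j' / real N\<bar> = 1 / real N"
      using that(2) by (auto simp: diff_divide_distrib[symmetric])
    moreover have "\<bar>min (fst x) a - min (fst x) b\<bar> \<le> \<bar>a - b\<bar>" for a b by linarith
    ultimately have "\<bar>min (fst x) (real j / real N) - min (fst x) (real j' / real N)\<bar> \<le> 1 / real N"
      by metis
    then show "dist (min (fst x) (real j / real N), snd x) (min (fst x) (real j' / real N), snd x) < \<delta>"
      using N(2) by (simp add: dist_Pair_Pair dist_real_def)
  qed
  have cont: "continuous_on (?Q \<times> UNIV) (\<lambda>p. k i (min (fst (fst p)) (real j / real N), snd (fst p)))"
    if "i < m" for i j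
    by (intro continuous_on_compose2[OF k[OF that]] continuous_intros) (auto simp: min_def)
  show ?thesis
  proof (rule that)
    show "continuous_on (?Q \<times> UNIV) (\<lambda>p. \<Phi> (fst p) (snd p))"
      "continuous_on (?Q \<times> UNIV) (\<lambda>p. \<Psi> (fst p) (snd p))"
      unfolding \<Phi>_def \<Psi>_def c_def d_def
      by (intro continuous_on_push_chain cont continuous_intros \<epsilon>; assumption)+
    show "inj (\<Phi> x)" if "x \<in> ?Q" for x
      unfolding \<Phi>_def
    proof (rule inj_push_chain[OF \<epsilon>])
      fix j assume "j < N"
      show "(\<Sum>i<m. norm (c x (Suc j) i - c x j i)) < \<epsilon>"
        unfolding c_def case_prod_beta by (intro step that) auto
    qed
    show "inj (\<Psi> x)" if "x \<in> ?Q" for x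
      unfolding \<Psi>_def
    proof (rule inj_push_chain[OF \<epsilon>])
      fix j assume "j < N"
      then show "(\<Sum>i<m. norm (d x (Suc j) i - d x j i)) < \<epsilon>"
        unfolding d_def case_prod_beta by (intro step that) auto
    qed
    fix s u :: real assume u: "u \<in> {0..1}"
    {
      fix z
      show "\<Phi> (0, u) z = z"
        unfolding \<Phi>_def by (rule push_chain_id) (auto simp: c_def)
    }
    assume s: "s \<in> {0..1}"
    then have su: "(s, u) \<in> ?Q" using u by auto
    have c0: "c (s, u) 0 i = k i (0, u)" "c (s, u) N i = k i (s, u)"
      "d (s, u) 0 i = k i (s, u)" "d (s, u) N i = k i (0, u)" for i
      using s N(1) by (auto simp: c_def d_def min_def)
    {
      fix i assume i: "i < m"
      have "push_chain m \<epsilon> (c (s, u)) N (c (s, u) 0 i) = c (s, u) N i"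
        by (rule push_chain_point[OF \<epsilon> i])
          (use in_Q[OF su] i in \<open>auto simp: c_def simp del: of_nat_diff mem_Sigma_iff intro!: sep\<close>)
      then show "\<Phi> (s, u) (k i (0, u)) = k i (s, u)" by (simp add: \<Phi>_def c0)
      have "push_chain m \<epsilon> (d (s, u)) N (d (s, u) 0 i) = d (s, u) N i"
        by (rule push_chain_point[OF \<epsilon> i])
          (use in_Q[OF su] i in \<open>auto simp: d_def simp del: of_nat_diff mem_Sigma_iff intro!: sep\<close>)
      then show "\<Psi> (s, u) (k i (s, u)) = k i (0, u)" by (simp add: \<Psi>_def c0)
    }
    fix z assume const: "\<And>i t. i < m \<Longrightarrow> t \<in> {0..s} \<Longrightarrow> k i (t, u) = k i (0, u)"
    have "k i (min s (real j / real N), u) = k i (0, u)" if "i < m" for i j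
      using s by (intro const that) auto
    then show "\<Psi> (s, u) z = z"
      unfolding \<Psi>_def by (intro push_chain_id) (simp only: d_def prod.case fst_conv snd_conv)
  qed
qed

section \<open>Pullbacks and monodromy\<close>

text \<open>The universal property of the square, with \<open>J\<close> recovering a point from its
  two images. The facts are later addressed by position: 1 to 4 concern the given maps, 5 to 7 say
  that \<open>J\<close> is a right inverse with values in the total space, 8 that it is a left
  inverse, and 9 that it yields continuous maps into the total space.\<close>

lemma is_pullback_lift:
  assumes pb: "is_pullback E' B' p' E B p f g"
  defines "J \<equiv> the_inv_into (topspace E') (\<lambda>t. (p' t, g t))"
  shows is_pullback_proj: "continuous_map E' B' p'" "continuous_map E' E g"
    and is_pullback_base: "continuous_map B' B f"
    and is_pullback_comm: "t \<in> topspace E' \<Longrightarrow> f (p' t) = p (g t)"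
    and is_pullback_lift_in: "x \<in> topspace B' \<Longrightarrow> y \<in> topspace E \<Longrightarrow> f x = p y \<Longrightarrow> J (x, y) \<in> topspace E'"
    and is_pullback_lift_proj: "x \<in> topspace B' \<Longrightarrow> y \<in> topspace E \<Longrightarrow> f x = p y \<Longrightarrow> p' (J (x, y)) = x"
      "x \<in> topspace B' \<Longrightarrow> y \<in> topspace E \<Longrightarrow> f x = p y \<Longrightarrow> g (J (x, y)) = y"
    and is_pullback_lift_eq: "t \<in> topspace E' \<Longrightarrow> J (p' t, g t) = t"
    and is_pullback_lift_continuous: "continuous_map Z B' u \<Longrightarrow> continuous_map Z E v \<Longrightarrow>
      (\<And>z. z \<in> topspace Z \<Longrightarrow> f (u z) = p (v z)) \<Longrightarrow> continuous_map Z E' (\<lambda>z. J (u z, v z))"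
proof -
  let ?R = "subtopology (prod_topology B' E) {(x, t). f x = p t}" and ?h = "\<lambda>t. (p' t, g t)"
  have f: "continuous_map B' B f" and hom: "homeomorphic_map E' ?R ?h"
    using pb by (auto simp: is_pullback_def)
  show "continuous_map B' B f" by (rule f)
  have inj: "inj_on ?h (topspace E')" and im: "?h ` topspace E' = topspace ?R"
    and cont: "continuous_map E' ?R ?h"
    using hom by (auto simp: homeomorphic_eq_everything_map)
  have "continuous_map E' (prod_topology B' E) ?h"
    using cont by (simp add: continuous_map_in_subtopology)
  then show "continuous_map E' B' p'" "continuous_map E' E g"
    by (simp_all add: continuous_map_pairwise o_def)
  have R: "topspace ?R = {(x, y). x \<in> topspace B' \<and> y \<in> topspace E \<and> f x = p y}" by auto
  show "f (p' t) = p (g t)" if "t \<in> topspace E'"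
    using imageI[OF that, of ?h] unfolding im R by simp
  have hJ: "?h (J q) = q" if "q \<in> topspace ?R" for q
    unfolding J_def using f_the_inv_into_f[OF inj] that im by simp
  show Jh: "J (p' t, g t) = t" if "t \<in> topspace E'" for t
    unfolding J_def using the_inv_into_f_f[OF inj that] .
  have JE: "J q \<in> topspace E'" if "q \<in> topspace ?R" for q
    unfolding J_def using the_inv_into_into[OF inj] that im by simp
  show "x \<in> topspace B' \<Longrightarrow> y \<in> topspace E \<Longrightarrow> f x = p y \<Longrightarrow> J (x, y) \<in> topspace E'"
    using JE unfolding R by simp
  show "x \<in> topspace B' \<Longrightarrow> y \<in> topspace E \<Longrightarrow> f x = p y \<Longrightarrow> p' (J (x, y)) = x"
    "x \<in> topspace B' \<Longrightarrow> y \<in> topspace E \<Longrightarrow> f x = p y \<Longrightarrow> g (J (x, y)) = y"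
    using hJ[of "(x, y)"] unfolding R by simp_all
  obtain J' where J': "homeomorphic_maps E' ?R ?h J'"
    using hom homeomorphic_map_maps by blast
  have "J' q = J q" if q: "q \<in> topspace ?R" for q
  proof -
    obtain t where t: "t \<in> topspace E'" "q = ?h t" using q[folded im] by blast
    then have "J' q = t" using J' by (auto simp: homeomorphic_maps_def)
    then show ?thesis using Jh[OF t(1)] t(2) by simp
  qed
  moreover have "continuous_map ?R E' J'" using J' by (simp add: homeomorphic_maps_def)
  ultimately have J: "continuous_map ?R E' J" by (rule continuous_map_eq[rotated])
  show "continuous_map Z E' (\<lambda>z. J (u z, v z))"
    if "continuous_map Z B' u" "continuous_map Z E v" "\<And>z. z \<in> topspace Z \<Longrightarrow> f (u z) = p (v z)"
  proof -
    have "continuous_map Z ?R (\<lambda>z. (u z, v z))"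
      unfolding continuous_map_in_subtopology
      using that by (auto simp: continuous_map_pairwise o_def)
    from continuous_map_compose[OF this J] show ?thesis by (simp add: o_def)
  qed
qed

text \<open>\<open>conj\<close> shows that the class of \<open>d\<close> meets the defining
  equation; \<open>inj\<close> shows that any other solution, having the same image in the total
  space, is the same class.\<close>

lemma monodromy_eqI:
  assumes i: "continuous_map F E i" and s: "continuous_map B E s" and f0: "i f0 = s b0"
    and b: "b \<in> loops B b0" and c: "c \<in> loops F f0" and d: "d \<in> loops F f0"
    and conj: "path_homotopic E (s b0) (path_concat (s \<circ> b) (i \<circ> d)) (path_concat (i \<circ> c) (s \<circ> b))"
    and inj: "\<And>d'. d' \<in> loops F f0 \<Longrightarrow> path_homotopic E (s b0) (i \<circ> d) (i \<circ> d') \<Longrightarrow> path_homotopic F f0 d d'"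
  shows "monodromy F f0 i E B s b0 (loop_class B b0 b) (loop_class F f0 c) = loop_class F f0 d"
proof -
  let ?G = "fundamental_group E (s b0)"
  have l: "s \<circ> b \<in> loops E (s b0)" "i \<circ> c \<in> loops E (s b0)"
    "\<And>d. d \<in> loops F f0 \<Longrightarrow> i \<circ> d \<in> loops E (s b0)"
    using loops_compose b c s i f0 by metis+
  have e0: "s b0 \<in> topspace E" using loops_base_in_topspace[OF l(1)] .
  let ?c = "inv\<^bsub>?G\<^esub> (induced_map E (s b0) s (loop_class B b0 b))
      \<otimes>\<^bsub>?G\<^esub> induced_map E (s b0) i (loop_class F f0 c)
      \<otimes>\<^bsub>?G\<^esub> induced_map E (s b0) s (loop_class B b0 b)"
  have c_eq: "?c = loop_class E (s b0) (i \<circ> d)"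
    using conjugate_eq_iff_homotopic[OF e0 l(1,2) l(3)[OF d]] conj
    by (simp add: induced_map_loop_class[OF b s refl] induced_map_loop_class[OF c i f0])
  have "(THE \<delta>. \<delta> \<in> carrier (fundamental_group F f0) \<and> induced_map E (s b0) i \<delta> = ?c) = loop_class F f0 d"
  proof (rule the_equality)
    show "loop_class F f0 d \<in> carrier (fundamental_group F f0) \<and>
        induced_map E (s b0) i (loop_class F f0 d) = ?c"
      unfolding c_eq using d by (auto simp: induced_map_loop_class[OF d i f0])
    fix \<delta> assume \<delta>: "\<delta> \<in> carrier (fundamental_group F f0) \<and> induced_map E (s b0) i \<delta> = ?c"
    then obtain d' where d': "d' \<in> loops F f0" "\<delta> = loop_class F f0 d'"
      by (auto simp: carrier_fundamental_group)
    then have "loop_class E (s b0) (i \<circ> d) = loop_class E (s b0) (i \<circ> d')"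
      using \<delta> unfolding c_eq by (simp add: induced_map_loop_class[OF d'(1) i f0])
    then have "path_homotopic E (s b0) (i \<circ> d) (i \<circ> d')"
      by (simp add: loop_class_eq_iff[OF l(3)[OF d]])
    then have "path_homotopic F f0 d d'" by (rule inj[OF d'(1)])
    then show "\<delta> = loop_class F f0 d" using d'(2) loop_class_eq_iff[OF d] by metis
  qed
  then show ?thesis
    unfolding monodromy_def using loop_class_carrier[OF b] loop_class_carrier[OF c] by simp
qed

section \<open>Transport of the complement of a moving configuration\<close>

lemma uconf_isotopy:
  fixes G :: "real \<times> real \<Rightarrow> complex set"
  assumes G: "continuous_map (top_of_set ({0..1} \<times> {0..1})) (uconf n) G" and n: "n > 0"
  obtains \<Phi> \<Psi> :: "real \<times> real \<Rightarrow> complex \<Rightarrow> complex" where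
    "continuous_on (({0..1} \<times> {0..1}) \<times> UNIV) (\<lambda>p. \<Phi> (fst p) (snd p))"
    "continuous_on (({0..1} \<times> {0..1}) \<times> UNIV) (\<lambda>p. \<Psi> (fst p) (snd p))"
    "\<And>s u z. s \<in> {0..1} \<Longrightarrow> u \<in> {0..1} \<Longrightarrow> z \<notin> G (0, u) \<Longrightarrow> \<Phi> (s, u) z \<notin> G (s, u)"
    "\<And>s u z. s \<in> {0..1} \<Longrightarrow> u \<in> {0..1} \<Longrightarrow> z \<notin> G (s, u) \<Longrightarrow> \<Psi> (s, u) z \<notin> G (0, u)"
    "\<And>s u. s \<in> {0..1} \<Longrightarrow> u \<in> {0..1} \<Longrightarrow> \<Phi> (s, u) (far_point (G (0, u))) = far_point (G (s, u))"
    "\<And>s u. s \<in> {0..1} \<Longrightarrow> u \<in> {0..1} \<Longrightarrow> \<Psi> (s, u) (far_point (G (s, u))) = far_point (G (0, u))"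
    "\<And>u z. u \<in> {0..1} \<Longrightarrow> \<Phi> (0, u) z = z"
    "\<And>u z. u \<in> {0..1} \<Longrightarrow> \<Psi> (0, u) z = z"
    "\<And>s u z. s \<in> {0..1} \<Longrightarrow> u \<in> {0..1} \<Longrightarrow> (\<And>t. t \<in> {0..1} \<Longrightarrow> G (t, u) = G (0, u)) \<Longrightarrow> \<Psi> (s, u) z = z"
proof -
  let ?Q = "{0..1::real} \<times> {0..1::real}"
  have fin: "finite (G x) \<and> card (G x) = n" if "x \<in> ?Q" for x
    using continuous_map_image_subset_topspace[OF G] that by (auto simp: topspace_uconf)
  have "convex ?Q" by (intro convex_Times convex_real_interval)
  from configuration_lift_convex[OF G this] obtain k where
    k: "\<And>i. i < n \<Longrightarrow> continuous_on ?Q (k i)" "\<And>x. x \<in> ?Q \<Longrightarrow> inj_on (\<lambda>i. k i x) {..<n}"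
      "\<And>x. x \<in> ?Q \<Longrightarrow> G x = (\<lambda>i. k i x) ` {..<n}" by blast
  \<comment> \<open>Index \<open>n\<close> carries the far point, which is never in the
    configuration, so \<open>K\<close> is a motion of \<open>n + 1\<close> distinct points. The
    chain maps are injective and carry numbered points to numbered points, hence keep every other
    point off the configuration.\<close>
  define K where "K = (\<lambda>i x. if i < n then k i x else far_point (G x))"
  have Kk: "(\<lambda>i. K i x) ` {..<n} = G x" if "x \<in> ?Q" for x
    using k(3)[OF that] by (auto simp: K_def)
  have far: "continuous_on ?Q (\<lambda>x. far_point (G x))"
    using continuous_map_compose[OF G continuous_map_far_point[OF n]] by (simp add: o_def)
  have K1: "continuous_on ?Q (K i)" if "i < Suc n" for i
    using k(1)[of i] far by (cases "i < n") (simp_all add: K_def)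
  have K2: "inj_on (\<lambda>i. K i x) {..<Suc n}" if "x \<in> ?Q" for x
  proof -
    have "inj_on (\<lambda>i. K i x) {..<n}"
      using k(2)[OF that] by (subst inj_on_cong[of _ _ "\<lambda>i. k i x"]) (auto simp: K_def)
    moreover have "K n x \<notin> G x" using far_point_notin fin[OF that] by (simp add: K_def)
    ultimately show ?thesis using Kk[OF that] by (simp add: lessThan_Suc)
  qed
  obtain \<Phi> \<Psi> :: "real \<times> real \<Rightarrow> complex \<Rightarrow> complex" where
    cont: "continuous_on (?Q \<times> UNIV) (\<lambda>p. \<Phi> (fst p) (snd p))"
      "continuous_on (?Q \<times> UNIV) (\<lambda>p. \<Psi> (fst p) (snd p))"
    and inj: "\<And>x. x \<in> ?Q \<Longrightarrow> inj (\<Phi> x)" "\<And>x. x \<in> ?Q \<Longrightarrow> inj (\<Psi> x)"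
    and pt: "\<And>s u i. s \<in> {0..1} \<Longrightarrow> u \<in> {0..1} \<Longrightarrow> i < Suc n \<Longrightarrow> \<Phi> (s, u) (K i (0, u)) = K i (s, u)"
      "\<And>s u i. s \<in> {0..1} \<Longrightarrow> u \<in> {0..1} \<Longrightarrow> i < Suc n \<Longrightarrow> \<Psi> (s, u) (K i (s, u)) = K i (0, u)"
    and id: "\<And>u z. u \<in> {0..1} \<Longrightarrow> \<Phi> (0, u) z = z"
      "\<And>s u z. s \<in> {0..1} \<Longrightarrow> u \<in> {0..1} \<Longrightarrow>
        (\<And>i t. i < Suc n \<Longrightarrow> t \<in> {0..s} \<Longrightarrow> K i (t, u) = K i (0, u)) \<Longrightarrow> \<Psi> (s, u) z = z"
    using configuration_isotopy[of "Suc n" K] K1 K2 by blast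
  show ?thesis
  proof (rule that[OF cont])
    fix s u :: real and z assume u: "u \<in> {0..1}"
    show "\<Phi> (0, u) z = z" using id(1)[OF u] .
    show "\<Psi> (0, u) z = z" by (rule id(2)) (use u in auto)
    assume s: "s \<in> {0..1}"
    have Q: "(s, u) \<in> ?Q" "(0, u) \<in> ?Q" using s u by auto
    show "\<Phi> (s, u) z \<notin> G (s, u)" if "z \<notin> G (0, u)"
    proof
      assume "\<Phi> (s, u) z \<in> G (s, u)"
      then obtain i where i: "i < n" "\<Phi> (s, u) z = K i (s, u)"
        using Kk[OF Q(1)] by auto
      then have "\<Phi> (s, u) z = \<Phi> (s, u) (K i (0, u))" using pt(1)[OF s u] by simp
      then have "z = K i (0, u)" using inj(1)[OF Q(1)] by (simp add: inj_def)
      then show False using that Kk[OF Q(2)] i(1) by auto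
    qed
    show "\<Psi> (s, u) z \<notin> G (0, u)" if "z \<notin> G (s, u)"
    proof
      assume "\<Psi> (s, u) z \<in> G (0, u)"
      then obtain i where i: "i < n" "\<Psi> (s, u) z = K i (0, u)"
        using Kk[OF Q(2)] by auto
      then have "\<Psi> (s, u) z = \<Psi> (s, u) (K i (s, u))" using pt(2)[OF s u] by simp
      then have "z = K i (s, u)" using inj(2)[OF Q(1)] by (simp add: inj_def)
      then show False using that Kk[OF Q(1)] i(1) by auto
    qed
    show "\<Phi> (s, u) (far_point (G (0, u))) = far_point (G (s, u))"
      "\<Psi> (s, u) (far_point (G (s, u))) = far_point (G (0, u))"
      using pt(1)[OF s u, of n] pt(2)[OF s u, of n] by (simp_all add: K_def)
    assume G0: "\<And>t. t \<in> {0..1} \<Longrightarrow> G (t, u) = G (0, u)"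
    \<comment> \<open>Only the unordered set is assumed constant; the numbering could still permute
      it. A continuous function of \<open>t\<close> with values in a finite set is constant, so it
      does not.\<close>
    have "K i (t, u) = K i (0, u)" if i: "i < Suc n" and t: "t \<in> {0..s}" for i t
    proof -
      let ?S = "insert (far_point (G (0, u))) (G (0, u))"
      have KS: "K i (t, u) \<in> ?S" if "t \<in> {0..1}" for t
        using Kk[of "(t, u)"] that u i G0[OF that] by (cases "i < n") (auto simp: K_def)
      have "continuous_on {0..1} (\<lambda>t. K i (t, u))"
        by (intro continuous_on_compose2[OF K1[OF i]] continuous_intros) (use u in auto)
      moreover have "finite ((\<lambda>t. K i (t, u)) ` {0..1})"
      proof (rule finite_subset)
        show "(\<lambda>t. K i (t, u)) ` {0..1} \<subseteq> ?S" using KS by blast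
      qed (use fin[OF Q(2)] in simp)
      ultimately have "(\<lambda>t. K i (t, u)) constant_on {0..1}"
        by (intro continuous_finite_range_constant) auto
      then show ?thesis using t s by (auto simp: constant_on_def)
    qed
    then show "\<Psi> (s, u) z = z" by (rule id(2)[OF s u])
  qed
qed

text \<open>The section makes the inclusion of the fiber injective on fundamental groups: a homotopy in the
  total space is pushed back into the fiber over the base point, along with the section.\<close>

lemma conf_pt_fiber_injective:
  assumes n: "n > 0"
    and d: "d \<in> loops (top_of_set (- S)) (far_point S)" and d': "d' \<in> loops (top_of_set (- S)) (far_point S)"
    and hom: "path_homotopic (conf_pt n) (S, far_point S) (\<lambda>u. (S, d u)) (\<lambda>u. (S, d' u))"
  shows "path_homotopic (top_of_set (- S)) (far_point S) d d'"
proof -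
  let ?I = "{0..1::real}"
  obtain h where h: "continuous_map (top_of_set (?I \<times> ?I)) (conf_pt n) h"
      "\<And>u. u \<in> ?I \<Longrightarrow> h (0, u) = (S, d u)" "\<And>u. u \<in> ?I \<Longrightarrow> h (1, u) = (S, d' u)"
      "\<And>s. s \<in> ?I \<Longrightarrow> h (s, 0) = (S, far_point S)" "\<And>s. s \<in> ?I \<Longrightarrow> h (s, 1) = (S, far_point S)"
    using hom unfolding path_homotopic_iff by auto
  define G where "G = fst \<circ> h"
  define w where "w = snd \<circ> h"
  have G: "continuous_map (top_of_set (?I \<times> ?I)) (uconf n) G" and w: "continuous_on (?I \<times> ?I) w"
    and wG: "\<And>x. x \<in> ?I \<times> ?I \<Longrightarrow> w x \<notin> G x"
    using h(1) unfolding continuous_map_conf_pt G_def w_def by (auto simp del: o_apply simp: o_def)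
  have G0: "G (0, u) = S" "G (1, u) = S" "G (u, 0) = S" "G (u, 1) = S" if "u \<in> ?I" for u
    using h(2-)[OF that] by (simp_all add: G_def)
  have w0: "w (0, u) = d u" "w (1, u) = d' u" "w (u, 0) = far_point S" "w (u, 1) = far_point S"
    if "u \<in> ?I" for u
    using h(2-)[OF that] by (simp_all add: w_def)
  obtain \<Phi> \<Psi> :: "real \<times> real \<Rightarrow> complex \<Rightarrow> complex" where
    "continuous_on ((?I \<times> ?I) \<times> UNIV) (\<lambda>p. \<Phi> (fst p) (snd p))"
    and cont: "continuous_on ((?I \<times> ?I) \<times> UNIV) (\<lambda>p. \<Psi> (fst p) (snd p))"
    and "\<And>s u z. s \<in> ?I \<Longrightarrow> u \<in> ?I \<Longrightarrow> z \<notin> G (0, u) \<Longrightarrow> \<Phi> (s, u) z \<notin> G (s, u)"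
    and notin: "\<And>s u z. s \<in> ?I \<Longrightarrow> u \<in> ?I \<Longrightarrow> z \<notin> G (s, u) \<Longrightarrow> \<Psi> (s, u) z \<notin> G (0, u)"
    and "\<And>s u. s \<in> ?I \<Longrightarrow> u \<in> ?I \<Longrightarrow> \<Phi> (s, u) (far_point (G (0, u))) = far_point (G (s, u))"
    and far: "\<And>s u. s \<in> ?I \<Longrightarrow> u \<in> ?I \<Longrightarrow> \<Psi> (s, u) (far_point (G (s, u))) = far_point (G (0, u))"
    and "\<And>u z. u \<in> ?I \<Longrightarrow> \<Phi> (0, u) z = z"
    and id0: "\<And>u z. u \<in> ?I \<Longrightarrow> \<Psi> (0, u) z = z"
    and id: "\<And>s u z. s \<in> ?I \<Longrightarrow> u \<in> ?I \<Longrightarrow> (\<And>t. t \<in> ?I \<Longrightarrow> G (t, u) = G (0, u)) \<Longrightarrow> \<Psi> (s, u) z = z"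
    using uconf_isotopy[OF G n] by blast
  have "path_homotopic (top_of_set (- S)) (far_point S) d (\<lambda>u. \<Psi> (1, u) (d' u))"
  proof (rule path_homotopicI[where h = "\<lambda>x. \<Psi> x (w x)"])
    have "continuous_on (?I \<times> ?I) (\<lambda>x. \<Psi> x (w x))"
      by (rule continuous_on_compose2[OF cont, where f = "\<lambda>x. (x, w x)", simplified])
        (auto intro!: continuous_intros w)
    moreover have "\<Psi> (s, u) (w (s, u)) \<notin> S" if "s \<in> ?I" "u \<in> ?I" for s u
      using notin[OF that wG] that G0(1)[OF that(2)] by auto
    ultimately show "continuous_map (top_of_set (?I \<times> ?I)) (top_of_set (- S)) (\<lambda>x. \<Psi> x (w x))"
      by auto
  next
    fix u :: real assume "0 \<le> u" "u \<le> 1"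
    then have u: "u \<in> ?I" by auto
    show "\<Psi> (0, u) (w (0, u)) = d u" "\<Psi> (1, u) (w (1, u)) = \<Psi> (1, u) (d' u)"
      using u by (simp_all add: id0 w0)
    show "\<Psi> (u, 0) (w (u, 0)) = far_point S" "\<Psi> (u, 1) (w (u, 1)) = far_point S"
      using far[OF u, of 0] far[OF u, of 1] u by (simp_all add: G0 w0)
  qed
  \<comment> \<open>On the edge \<open>s = 1\<close> the push back need not be the identity:
    \<open>G\<close> starts and ends at \<open>S\<close> in each column but may move in between.
    Sliding the column to \<open>u = 0\<close>, where \<open>G\<close> is constantly
    \<open>S\<close>, deforms \<open>\<Psi> (1, u)\<close> to the identity without touching
    \<open>S\<close>.\<close>
  moreover have "path_homotopic (top_of_set (- S)) (far_point S) (\<lambda>u. \<Psi> (1, u) (d' u)) d'"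
  proof (rule path_homotopicI[where h = "\<lambda>x. \<Psi> (1, (1 - fst x) * snd x) (d' (snd x))"])
    have d'c: "continuous_on ?I d'" and d'S: "\<And>u. u \<in> ?I \<Longrightarrow> d' u \<notin> S"
      using d' by (auto simp: loops_def pathin_def)
    have in_I: "(1 - s) * u \<in> ?I" if "s \<in> ?I" "u \<in> ?I" for s u
      using that by (auto intro: mult_le_one)
    have "continuous_on (?I \<times> ?I) (\<lambda>x. \<Psi> (1, (1 - fst x) * snd x) (d' (snd x)))"
      by (rule continuous_on_compose2[OF cont, where f = "\<lambda>x. ((1, (1 - fst x) * snd x), d' (snd x))", simplified])
        (auto intro!: continuous_intros continuous_on_compose2[OF d'c] mult_le_one)
    moreover have "\<Psi> (1, (1 - s) * u) (d' u) \<notin> S" if "s \<in> ?I" "u \<in> ?I" for s u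
      using notin[of 1 "(1 - s) * u" "d' u"] in_I[OF that] d'S[OF that(2)] by (simp add: G0)
    ultimately show "continuous_map (top_of_set (?I \<times> ?I)) (top_of_set (- S))
        (\<lambda>x. \<Psi> (1, (1 - fst x) * snd x) (d' (snd x)))"
      by auto
    have ends: "d' 0 = far_point S" "d' 1 = far_point S" using d' by (auto simp: loops_def)
    fix u :: real assume "0 \<le> u" "u \<le> 1"
    then have u: "u \<in> ?I" "1 - u \<in> ?I" by auto
    show "\<Psi> (1, (1 - fst (0, u)) * snd (0, u)) (d' (snd (0::real, u))) = \<Psi> (1, u) (d' u)" by simp
    show "\<Psi> (1, (1 - fst (1, u)) * snd (1, u)) (d' (snd (1::real, u))) = d' u"
      using id[of 1 0 "d' u"] by (simp add: G0)
    show "\<Psi> (1, (1 - fst (u, 0)) * snd (u, 0)) (d' (snd (u, 0))) = far_point S"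
      using far[of 1 0] by (simp add: G0 ends)
    show "\<Psi> (1, (1 - fst (u, 1)) * snd (u, 1)) (d' (snd (u, 1))) = far_point S"
      using far[of 1 "1 - u"] u by (simp add: G0 ends)
  qed
  ultimately show ?thesis by (rule path_homotopic_trans)
qed

text \<open>Transporting \<open>c\<close> along \<open>a \<circ> b\<close> gives one loop
  \<open>d\<close> for both sides. The conjugation square is built in the pullback and its image
  under \<open>g\<close> is the one for configurations; conversely, injectivity on the fiber is
  inherited by the pullback, since \<open>g\<close> composed with its fiber inclusion is the
  original fiber inclusion.\<close>

theorem monodromy_pullback:
  assumes n: "n > 0" and pb: "is_pullback E' X p' (conf_pt n) (uconf n) fst a g"
    and x0: "x0 \<in> topspace X" and \<beta>: "\<beta> \<in> carrier (fundamental_group X x0)"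
  shows "monodromy (top_of_set (- a x0)) (far_point (a x0))
      (pullback_fiber E' p' g x0 (\<lambda>z. (a x0, z))) E' X (pullback_section E' p' g a uconf_section) x0 \<beta>
    = monodromy (top_of_set (- a x0)) (far_point (a x0)) (\<lambda>z. (a x0, z))
      (conf_pt n) (uconf n) uconf_section (a x0) (induced_map (uconf n) (a x0) a \<beta>)"
proof -
  let ?I = "{0..1::real}"
  let ?F = "top_of_set (- a x0)" and ?f0 = "far_point (a x0)"
  define J where "J = the_inv_into (topspace E') (\<lambda>t. (p' t, g t))"
  define i' where "i' = pullback_fiber E' p' g x0 (\<lambda>z. (a x0, z))"
  define s' where "s' = pullback_section E' p' g a uconf_section"
  have i'_eq: "i' z = J (x0, (a x0, z))" and s'_eq: "s' x = J (x, uconf_section (a x))" for z x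
    by (simp_all add: i'_def s'_def pullback_fiber_def pullback_section_def J_def)
  note lift = is_pullback_lift[OF pb, folded J_def]
  have a: "continuous_map X (uconf n) a" by (rule is_pullback_base[OF pb])
  have fin: "finite (a x) \<and> card (a x) = n" if "x \<in> topspace X" for x
    using continuous_map_image_subset_topspace[OF a] that by (auto simp: topspace_uconf)
  have s: "continuous_map (uconf n) (conf_pt n) uconf_section"
    unfolding uconf_section_def
    by (rule continuous_map_conf_ptI)
      (use n in \<open>auto simp: topspace_uconf far_point_notin continuous_map_far_point[unfolded id_def]\<close>)
  have i: "continuous_map ?F (conf_pt n) (\<lambda>z. (a x0, z))"
    by (rule continuous_map_conf_ptI) (use fin[OF x0] in \<open>auto simp: topspace_uconf\<close>)
  have i': "continuous_map ?F E' i'"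
    unfolding i'_eq by (rule lift(9)) (use x0 i in simp_all)
  have s': "continuous_map X E' s'"
    unfolding s'_eq
    by (rule lift(9)) (use continuous_map_compose[OF a s] in \<open>simp_all add: o_def uconf_section_def\<close>)
  have g: "continuous_map E' (conf_pt n) g" by (rule lift(2))
  have gi': "g (i' z) = (a x0, z)" if "z \<notin> a x0" for z
    unfolding i'_eq by (rule lift(7)) (use x0 fin[OF x0] that in \<open>auto simp: topspace_conf_pt\<close>)
  have gs': "g (s' x) = uconf_section (a x)" if "x \<in> topspace X" for x
    unfolding s'_eq
    by (rule lift(7)) (use that fin[OF that] far_point_notin in \<open>auto simp: topspace_conf_pt uconf_section_def\<close>)
  have f0: "i' ?f0 = s' x0" by (simp add: i'_eq s'_eq uconf_section_def)
  have ge0: "g (s' x0) = uconf_section (a x0)" using gs'[OF x0] .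
  obtain b where b: "b \<in> loops X x0" "\<beta> = loop_class X x0 b"
    using \<beta> by (auto simp: carrier_fundamental_group)
  have ab: "a \<circ> b \<in> loops (uconf n) (a x0)" using loops_compose[OF b(1) a] by simp
  have a\<beta>: "induced_map (uconf n) (a x0) a \<beta> = loop_class (uconf n) (a x0) (a \<circ> b)"
    using b induced_map_loop_class[OF b(1) a] by simp
  have main: "monodromy ?F ?f0 i' E' X s' x0 \<beta> \<gamma> = monodromy ?F ?f0 (\<lambda>z. (a x0, z))
      (conf_pt n) (uconf n) uconf_section (a x0) (induced_map (uconf n) (a x0) a \<beta>) \<gamma>"
    if \<gamma>: "\<gamma> \<in> carrier (fundamental_group ?F ?f0)" for \<gamma>
  proof -
    obtain c where c: "c \<in> loops ?F ?f0" "\<gamma> = loop_class ?F ?f0 c"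
      using \<gamma> by (auto simp: carrier_fundamental_group)
    \<comment> \<open>The configuration depends only on the time along the base loop; the second
      coordinate is reserved for the parameter of the fiber loop.\<close>
    define G where "G = (\<lambda>x::real \<times> real. a (b (fst x)))"
    have bI: "continuous_map (top_of_set (?I \<times> ?I)) X (\<lambda>x. b (fst x))"
    proof -
      have "continuous_map (top_of_set ?I) X b" using b(1) by (simp add: loops_def pathin_def)
      moreover have "continuous_map (top_of_set (?I \<times> ?I)) (top_of_set ?I) fst"
        by (auto intro!: continuous_intros)
      ultimately have "continuous_map (top_of_set (?I \<times> ?I)) X (b \<circ> fst)"
        by (intro continuous_map_compose)
      then show ?thesis by (simp add: o_def)
    qed
    have G: "continuous_map (top_of_set (?I \<times> ?I)) (uconf n) G"
      using continuous_map_compose[OF bI a] by (simp add: G_def o_def)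
    have b01: "b 0 = x0" "b 1 = x0" using b(1) by (auto simp: loops_def)
    obtain \<Phi> \<Psi> :: "real \<times> real \<Rightarrow> complex \<Rightarrow> complex" where
      cont: "continuous_on ((?I \<times> ?I) \<times> UNIV) (\<lambda>p. \<Phi> (fst p) (snd p))"
      and "continuous_on ((?I \<times> ?I) \<times> UNIV) (\<lambda>p. \<Psi> (fst p) (snd p))"
      and notin: "\<And>s u z. s \<in> ?I \<Longrightarrow> u \<in> ?I \<Longrightarrow> z \<notin> G (0, u) \<Longrightarrow> \<Phi> (s, u) z \<notin> G (s, u)"
      and "\<And>s u z. s \<in> ?I \<Longrightarrow> u \<in> ?I \<Longrightarrow> z \<notin> G (s, u) \<Longrightarrow> \<Psi> (s, u) z \<notin> G (0, u)"
      and far: "\<And>s u. s \<in> ?I \<Longrightarrow> u \<in> ?I \<Longrightarrow> \<Phi> (s, u) (far_point (G (0, u))) = far_point (G (s, u))"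
      and "\<And>s u. s \<in> ?I \<Longrightarrow> u \<in> ?I \<Longrightarrow> \<Psi> (s, u) (far_point (G (s, u))) = far_point (G (0, u))"
      and id0: "\<And>u z. u \<in> ?I \<Longrightarrow> \<Phi> (0, u) z = z"
      and "\<And>u z. u \<in> ?I \<Longrightarrow> \<Psi> (0, u) z = z"
      and "\<And>s u z. s \<in> ?I \<Longrightarrow> u \<in> ?I \<Longrightarrow> (\<And>t. t \<in> ?I \<Longrightarrow> G (t, u) = G (0, u)) \<Longrightarrow> \<Psi> (s, u) z = z"
      using uconf_isotopy[OF G n] by blast
    have cc: "continuous_on ?I c" and cS: "\<And>u. u \<in> ?I \<Longrightarrow> c u \<notin> a x0"
      and c01: "c 0 = ?f0" "c 1 = ?f0"
      using c(1) by (auto simp: loops_def pathin_def)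
    define h where "h = (\<lambda>x. \<Phi> x (c (snd x)))"
    have h: "continuous_on (?I \<times> ?I) h"
      unfolding h_def
      by (rule continuous_on_compose2[OF cont, where f = "\<lambda>x. (x, c (snd x))", simplified])
        (auto intro!: continuous_intros continuous_on_compose2[OF cc])
    have hG: "h x \<notin> G x" if "x \<in> ?I \<times> ?I" for x
      using that notin[of "fst x" "snd x" "c (snd x)"] cS[of "snd x"] by (auto simp: h_def G_def b01)
    have h0: "h (0, u) = c u" if "u \<in> ?I" for u using id0[OF that] by (simp add: h_def)
    have hfar: "h (s, 0) = far_point (a (b s))" "h (s, 1) = far_point (a (b s))" if "s \<in> ?I" for s
      using far[OF that, of 0] far[OF that, of 1] by (simp_all add: h_def G_def b01 c01)
    define d where "d = (\<lambda>u. h (1, u))"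
    have "continuous_on ?I d"
      unfolding d_def by (intro continuous_on_compose2[OF h] continuous_intros) auto
    moreover have dS: "d u \<notin> a x0" if "u \<in> ?I" for u
      using hG[of "(1, u)"] that by (simp add: d_def G_def b01)
    ultimately have d: "d \<in> loops ?F ?f0"
      using hfar[of 1] by (auto simp: loops_def pathin_def d_def b01)
    \<comment> \<open>The transported square inside the pullback: its edges \<open>u = 0\<close> and
      \<open>u = 1\<close> are the section along \<open>b\<close>, its edge at time 0 is the fiber
      loop \<open>c\<close>, and its edge at time 1 is \<open>d\<close>.\<close>
    define H where "H = (\<lambda>x. J (b (fst x), (G x, h x)))"
    have "continuous_map (top_of_set (?I \<times> ?I)) (conf_pt n) (\<lambda>x. (G x, h x))"
      by (rule continuous_map_conf_ptI[OF G]) (use h hG in auto)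
    then have H: "continuous_map (top_of_set (?I \<times> ?I)) E' H"
      unfolding H_def by (intro lift(9) bI) (simp_all add: G_def)
    have H00: "H (0, 0) = s' x0" "H (1, 1) = s' x0"
      using h0[of 0] hfar[of 1] by (simp_all add: H_def G_def b01 s'_eq uconf_section_def c01)
    have conj': "path_homotopic E' (s' x0) (path_concat (s' \<circ> b) (i' \<circ> d)) (path_concat (i' \<circ> c) (s' \<circ> b))"
      by (rule path_homotopic_cong[OF square_boundary_homotopic[OF H H00]])
        (auto simp: path_concat_def H_def G_def h0 hfar s'_eq i'_eq uconf_section_def b01 d_def)
    have conj: "path_homotopic (conf_pt n) (uconf_section (a x0))
        (path_concat (uconf_section \<circ> (a \<circ> b)) ((\<lambda>z. (a x0, z)) \<circ> d))
        (path_concat ((\<lambda>z. (a x0, z)) \<circ> c) (uconf_section \<circ> (a \<circ> b)))"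
    proof (rule path_homotopic_cong[OF path_homotopic_compose[OF conj' g ge0]])
      fix u :: real assume u: "0 \<le> u" "u \<le> 1"
      have "u \<le> 1/2 \<Longrightarrow> b (2 * u) \<in> topspace X" "\<not> u \<le> 1/2 \<Longrightarrow> b (2 * u - 1) \<in> topspace X"
        "u \<le> 1/2 \<Longrightarrow> c (2 * u) \<notin> a x0" "\<not> u \<le> 1/2 \<Longrightarrow> d (2 * u - 1) \<notin> a x0"
        using u by (auto intro!: loops_in_topspace[OF b(1)] simp: cS dS)
      then show "(g \<circ> path_concat (s' \<circ> b) (i' \<circ> d)) u
          = path_concat (uconf_section \<circ> (a \<circ> b)) ((\<lambda>z. (a x0, z)) \<circ> d) u"
        "(g \<circ> path_concat (i' \<circ> c) (s' \<circ> b)) u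
          = path_concat ((\<lambda>z. (a x0, z)) \<circ> c) (uconf_section \<circ> (a \<circ> b)) u"
        by (simp_all add: path_concat_def gs' gi')
    qed
    have inj: "path_homotopic ?F ?f0 d d'"
      if "d' \<in> loops ?F ?f0"
        "path_homotopic (conf_pt n) (uconf_section (a x0)) ((\<lambda>z. (a x0, z)) \<circ> d) ((\<lambda>z. (a x0, z)) \<circ> d')" for d'
      using conf_pt_fiber_injective[OF n d that(1)] that(2) by (simp add: uconf_section_def o_def)
    have inj': "path_homotopic ?F ?f0 d d'"
      if d': "d' \<in> loops ?F ?f0" "path_homotopic E' (s' x0) (i' \<circ> d) (i' \<circ> d')" for d'
    proof (rule inj[OF d'(1)], rule path_homotopic_cong[OF path_homotopic_compose[OF d'(2) g ge0]])
      fix u :: real assume "0 \<le> u" "u \<le> 1"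
      then have "d u \<notin> a x0" "d' u \<notin> a x0" using dS d'(1) by (auto simp: loops_def pathin_def)
      then show "(g \<circ> (i' \<circ> d)) u = ((\<lambda>z. (a x0, z)) \<circ> d) u" "(g \<circ> (i' \<circ> d')) u = ((\<lambda>z. (a x0, z)) \<circ> d') u"
        by (simp_all add: gi')
    qed
    have "monodromy ?F ?f0 i' E' X s' x0 \<beta> \<gamma> = loop_class ?F ?f0 d"
      unfolding b(2) c(2) by (rule monodromy_eqI[OF i' s' f0 b(1) c(1) d conj' inj'])
    moreover have "monodromy ?F ?f0 (\<lambda>z. (a x0, z)) (conf_pt n) (uconf n) uconf_section (a x0)
        (induced_map (uconf n) (a x0) a \<beta>) \<gamma> = loop_class ?F ?f0 d"
      unfolding a\<beta> c(2) by (rule monodromy_eqI[OF i s _ ab c(1) d conj inj]) (simp add: uconf_section_def)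
    ultimately show ?thesis by simp
  qed
  have "induced_map (uconf n) (a x0) a \<beta> \<in> carrier (fundamental_group (uconf n) (a x0))"
    unfolding a\<beta> using ab by blast
  \<comment> \<open>Off the carrier of the fiber group both restricted functions take the default
    value, so agreement on the carrier suffices.\<close>
  then have "monodromy ?F ?f0 i' E' X s' x0 \<beta> = monodromy ?F ?f0 (\<lambda>z. (a x0, z))
      (conf_pt n) (uconf n) uconf_section (a x0) (induced_map (uconf n) (a x0) a \<beta>)"
    using main \<beta> unfolding monodromy_def by (auto simp: fun_eq_iff restrict_def)
  then show ?thesis by (simp add: i'_def s'_def)
qed

section \<open>Local triviality\<close>

lemma continuous_map_scaleR:
  fixes f :: "'a \<Rightarrow> 'b::real_normed_vector"
  assumes "continuous_map X euclideanreal c" "continuous_map X euclidean f"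
  shows "continuous_map X euclidean (\<lambda>x. c x *\<^sub>R f x)"
  using assms by (simp add: continuous_map_atin tendsto_scaleR)

lemma continuous_map_push:
  assumes "\<epsilon> > 0" "\<And>i. i < m \<Longrightarrow> continuous_map Z euclidean (\<lambda>z. k' z i)" "continuous_map Z euclidean w"
  shows "continuous_map Z euclidean (\<lambda>z. push m \<epsilon> k (k' z) (w z))"
  unfolding push_def dist_norm divide_inverse
  by (intro continuous_intros continuous_map_scaleR assms(3)) (auto intro!: continuous_intros assms(2,3))

text \<open>Preimages depend continuously on all data: by \<open>push_expansive\<close> the distance
  from \<open>y z\<close> to \<open>y z0\<close> is at most a constant multiple, locally, of the
  amount by which the push at \<open>z\<close> fails to send \<open>y z0\<close> to
  \<open>w z\<close>, and this tends to 0.\<close>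

lemma continuous_map_push_inverse:
  assumes \<epsilon>: "\<epsilon> > 0" and k': "\<And>i. i < m \<Longrightarrow> continuous_map Z euclidean (\<lambda>z. k' z i)"
    and w: "continuous_map Z euclidean w"
    and small: "\<And>z. z \<in> topspace Z \<Longrightarrow> (\<Sum>i<m. norm (k' z i - k i)) < \<epsilon>"
    and y: "\<And>z. z \<in> topspace Z \<Longrightarrow> push m \<epsilon> k (k' z) (y z) = w z"
  shows "continuous_map Z euclidean y"
  unfolding continuous_map_atin limitin_canonical_iff
proof
  fix z0 assume z0: "z0 \<in> topspace Z"
  define q where "q = (\<lambda>z. (\<Sum>i<m. norm (k' z i - k i)) / \<epsilon>)"
  define D where "D = (\<lambda>z. norm (w z - push m \<epsilon> k (k' z) (y z0)) / (1 - q z))"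
  have q: "q z < 1" if "z \<in> topspace Z" for z using small[OF that] \<epsilon> by (simp add: q_def)
  have "continuous_map Z euclidean (\<lambda>z. push m \<epsilon> k (k' z) (y z0))"
    by (rule continuous_map_push[OF \<epsilon> k']) auto
  then have 1: "((\<lambda>z. push m \<epsilon> k (k' z) (y z0)) \<longlongrightarrow> push m \<epsilon> k (k' z0) (y z0)) (atin Z z0)"
    using z0 by (simp add: continuous_map_atin)
  have "continuous_map Z euclideanreal q"
    unfolding q_def divide_inverse by (intro continuous_intros) (auto intro!: continuous_intros k')
  then have 2: "(q \<longlongrightarrow> q z0) (atin Z z0)" using z0 by (simp add: continuous_map_atin)
  have 3: "(w \<longlongrightarrow> w z0) (atin Z z0)" using w z0 by (simp add: continuous_map_atin)
  have "(D \<longlongrightarrow> norm (w z0 - push m \<epsilon> k (k' z0) (y z0)) / (1 - q z0)) (atin Z z0)"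
    unfolding D_def by (intro tendsto_intros 1 2 3) (use q[OF z0] in auto)
  then have D: "(D \<longlongrightarrow> 0) (atin Z z0)" using y[OF z0] by simp
  have "norm (y z - y z0) \<le> D z" if "z \<in> topspace Z" for z
  proof -
    have "(1 - q z) * norm (y z - y z0) \<le> norm (w z - push m \<epsilon> k (k' z) (y z0))"
      using push_expansive[OF \<epsilon>, of "k' z" k m "y z" "y z0"] y[OF that] by (simp add: q_def)
    then show ?thesis using q[OF that] by (simp add: D_def pos_le_divide_eq mult.commute)
  qed
  then have "eventually (\<lambda>z. norm (y z - y z0) \<le> D z) (atin Z z0)"
    unfolding eventually_atin using z0 by (intro disjI2 exI[of _ "topspace Z"]) auto
  then have "((\<lambda>z. y z - y z0) \<longlongrightarrow> 0) (atin Z z0)" using D by (rule Lim_null_comparison)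
  then show "(y \<longlongrightarrow> y z0) (atin Z z0)" by (simp add: LIM_zero_iff)
qed

lemma push_image_iff:
  assumes \<epsilon>: "\<epsilon> > 0" and small: "(\<Sum>i<m. norm (k' i - k i)) < \<epsilon>"
    and sep: "\<And>i j. i < m \<Longrightarrow> j < m \<Longrightarrow> i \<noteq> j \<Longrightarrow> \<epsilon> \<le> dist (k i) (k j)"
  shows "push m \<epsilon> k k' z \<in> k' ` {..<m} \<longleftrightarrow> z \<in> k ` {..<m}"
proof -
  have "push m \<epsilon> k k' (k i) = k' i" if "i < m" for i
    using push_point[OF \<epsilon> that, of k k'] sep that by metis
  then have "k' ` {..<m} = push m \<epsilon> k k' ` k ` {..<m}" by (auto simp: image_image)
  then show ?thesis using inj_push[OF \<epsilon> small] by (simp add: inj_image_mem_iff)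
qed

text \<open>Fibers over two base points are compared directly in the plane, so that one model fiber
  serves all charts and the base need not be connected.\<close>

lemma homeomorphism_configurations:
  assumes "inj_on k {..<n}" "inj_on c {..<n::nat}"
  obtains f g :: "complex \<Rightarrow> complex" where "homeomorphism UNIV UNIV f g" "\<And>i. i < n \<Longrightarrow> f (k i) = c i"
proof -
  have "pairwise (\<lambda>i j. k i \<noteq> k j \<and> c i \<noteq> c j) {..<n}"
    using assms by (auto simp: pairwise_def inj_on_def)
  then obtain f g where "homeomorphism (UNIV :: complex set) UNIV f g" "\<And>i. i \<in> {..<n} \<Longrightarrow> f (k i) = c i"
    by (rule homeomorphism_moving_points_exists[of UNIV UNIV "{..<n}" k c, rotated 6]) auto
  then show ?thesis using that by auto
qed

text \<open>In the chart at \<open>b\<close> the point over \<open>x\<close> is moved back by the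
  inverse push from the configuration over \<open>x\<close> to that over \<open>b\<close>, and then
  by a fixed homeomorphism of the plane to the model fiber over \<open>x0\<close>.\<close>

theorem fiber_bundle_pullback:
  assumes pb: "is_pullback E' X p' (conf_pt n) (uconf n) fst a g" and x0: "x0 \<in> topspace X"
  shows "fiber_bundle E' X p' (top_of_set (- a x0))"
  unfolding fiber_bundle_def
proof (intro conjI ballI)
  define J where "J = the_inv_into (topspace E') (\<lambda>t. (p' t, g t))"
  note lift = is_pullback_lift[OF pb, folded J_def]
  show p': "continuous_map E' X p'" by (rule lift(1))
  have a: "continuous_map X (uconf n) a" by (rule is_pullback_base[OF pb])
  have fin: "finite (a x) \<and> card (a x) = n" if "x \<in> topspace X" for x
    using continuous_map_image_subset_topspace[OF a] that by (auto simp: topspace_uconf)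
  have g: "continuous_map E' euclidean (\<lambda>t. snd (g t))"
    using lift(2) by (simp add: continuous_map_conf_pt o_def)
  have gin: "snd (g t) \<notin> a (p' t)" if "t \<in> topspace E'" for t
    using lift(2) lift(4)[OF that] that by (simp add: continuous_map_conf_pt)
  fix b assume b: "b \<in> topspace X"
  obtain U0 r where U0: "openin X U0" "b \<in> U0"
    and r: "\<And>i. i < n \<Longrightarrow> continuous_map X euclidean (r i)"
    and U0r: "\<And>x. x \<in> U0 \<Longrightarrow> inj_on (\<lambda>i. r i x) {..<n} \<and> a x = (\<lambda>i. r i x) ` {..<n}"
    using uconf_branches[OF a b] by metis
  have kb: "inj_on (\<lambda>i. r i b) {..<n}" and ab: "a b = (\<lambda>i. r i b) ` {..<n}" using U0r[OF U0(2)] by auto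
  obtain \<epsilon> where \<epsilon>: "\<epsilon> > 0"
    and sep: "\<And>i j. i < n \<Longrightarrow> j < n \<Longrightarrow> i \<noteq> j \<Longrightarrow> \<epsilon> \<le> dist (r i b) (r j b)"
    using finite_separation[OF kb] by blast
  obtain c where c: "inj_on c {..<n}" "c ` {..<n} = a x0"
    using enumerate_configuration fin[OF x0] by (metis (lifting) mem_Collect_eq topspace_conf)
  obtain \<theta> \<theta>' where \<theta>: "homeomorphism UNIV UNIV \<theta> \<theta>'" "\<And>i. i < n \<Longrightarrow> \<theta> (r i b) = c i"
    using homeomorphism_configurations[OF kb c(1)] by blast
  have \<theta>c: "continuous_on UNIV \<theta>" "continuous_on UNIV \<theta>'" "\<And>z. \<theta> (\<theta>' z) = z" "\<And>z. \<theta>' (\<theta> z) = z"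
    using \<theta>(1) by (auto simp: homeomorphism_def)
  have "a x0 = \<theta> ` a b" using \<theta>(2) by (auto simp: ab c(2)[symmetric] image_image)
  then have \<theta>a: "\<theta> z \<in> a x0 \<longleftrightarrow> z \<in> a b" for z
    using \<theta>c(4) by (metis image_iff)
  \<comment> \<open>Within \<open>U\<close> the total displacement from \<open>b\<close> stays below
    the separation of the points over \<open>b\<close>, so \<open>h x\<close> is a bijection of the
    plane that takes \<open>a b\<close> to \<open>a x\<close>.\<close>
  define U where "U = {x \<in> U0. (\<Sum>i<n. norm (r i x - r i b)) < \<epsilon>}"
  define h where "h = (\<lambda>x. push n \<epsilon> (\<lambda>i. r i b) (\<lambda>i. r i x))"
  have "continuous_map X euclideanreal (\<lambda>x. \<Sum>i<n. norm (r i x - r i b))"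
    by (intro continuous_intros) (auto intro!: continuous_intros r)
  then have "openin X {x \<in> topspace X. (\<Sum>i<n. norm (r i x - r i b)) \<in> {..<\<epsilon>}}"
    by (rule openin_continuous_map_preimage) (simp flip: open_openin)
  then have "openin X (U0 \<inter> {x \<in> topspace X. (\<Sum>i<n. norm (r i x - r i b)) \<in> {..<\<epsilon>}})"
    using U0(1) by (rule openin_Int[rotated])
  moreover have "U0 \<inter> {x \<in> topspace X. (\<Sum>i<n. norm (r i x - r i b)) \<in> {..<\<epsilon>}} = U"
    using openin_subset[OF U0(1)] by (auto simp: U_def)
  ultimately have U: "openin X U" by simp
  have UX: "U \<subseteq> topspace X" using openin_subset[OF U] .
  have bU: "b \<in> U" using U0(2) \<epsilon> by (simp add: U_def)
  have bij: "inj (h x)" "surj (h x)" and ha: "\<And>z. h x z \<in> a x \<longleftrightarrow> z \<in> a b" if "x \<in> U" for x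
    using that inj_push[OF \<epsilon>, of "\<lambda>i. r i x" "\<lambda>i. r i b" n] surj_push[OF \<epsilon>, of "\<lambda>i. r i x" "\<lambda>i. r i b" n]
      push_image_iff[OF \<epsilon>, of "\<lambda>i. r i x" "\<lambda>i. r i b" n] sep U0r[of x] ab
    by (auto simp: U_def h_def)
  define y where "y = (\<lambda>t. inv_into UNIV (h (p' t)) (snd (g t)))"
  let ?E = "subtopology E' {t \<in> topspace E'. p' t \<in> U}"
  let ?P = "prod_topology (subtopology X U) (top_of_set (- a x0))"
  have hy: "h (p' t) (y t) = snd (g t)" if "p' t \<in> U" for t
    using bij(2)[OF that] by (simp add: y_def surj_f_inv_f)
  have ya: "y t \<notin> a b" if "t \<in> topspace E'" "p' t \<in> U" for t
    using ha[OF that(2), of "y t"] hy[OF that(2)] gin[OF that(1)] by simp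
  have y: "continuous_map ?E euclidean y"
  proof (rule continuous_map_push_inverse[OF \<epsilon>])
    show "continuous_map ?E euclidean (\<lambda>t. r i (p' t))" if "i < n" for i
      using continuous_map_compose[OF p' r[OF that]] by (simp add: o_def continuous_map_from_subtopology)
    show "continuous_map ?E euclidean (\<lambda>t. snd (g t))"
      using g by (rule continuous_map_from_subtopology)
    show "(\<Sum>i<n. norm (r i (p' t) - r i b)) < \<epsilon>" if "t \<in> topspace ?E" for t
      using that by (simp add: U_def)
    show "push n \<epsilon> (\<lambda>i. r i b) (\<lambda>i. r i (p' t)) (y t) = snd (g t)" if "t \<in> topspace ?E" for t
      using that hy by (simp add: h_def)
  qed
  define \<phi> where "\<phi> = (\<lambda>t. (p' t, \<theta> (y t)))"
  define \<psi> where "\<psi> = (\<lambda>q. J (fst q, (a (fst q), h (fst q) (\<theta>' (snd q)))))"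
  have h\<theta>: "h x (\<theta>' w) \<notin> a x" if "x \<in> U" "w \<notin> a x0" for x w
    using ha[OF that(1)] \<theta>a[of "\<theta>' w"] \<theta>c(3) that(2) by simp
  have ptin: "(a x, h x (\<theta>' w)) \<in> topspace (conf_pt n)" if "x \<in> U" "w \<notin> a x0" for x w
    using h\<theta>[OF that] fin[of x] that UX by (auto simp: topspace_conf_pt)
  have "homeomorphic_maps ?E ?P \<phi> \<psi>"
    unfolding homeomorphic_maps_def
  proof (intro conjI ballI)
    have "continuous_map ?E euclidean (\<lambda>t. \<theta> (y t))"
      using continuous_map_compose[OF y, of euclidean \<theta>] \<theta>c(1) by (simp add: o_def)
    then show "continuous_map ?E ?P \<phi>"
      unfolding \<phi>_def continuous_map_pairwise o_def continuous_map_in_subtopology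
      using p' ya by (auto simp: continuous_map_from_subtopology \<theta>a)
    have fstP: "continuous_map ?P X fst" and sndP: "continuous_map ?P euclidean snd"
      using continuous_map_fst[of "subtopology X U" "top_of_set (- a x0)"]
        continuous_map_snd[of "subtopology X U" "top_of_set (- a x0)"]
      by (auto simp: continuous_map_in_subtopology)
    have "continuous_map ?P euclidean (\<lambda>q. \<theta>' (snd q))"
      using continuous_map_compose[OF sndP, of euclidean \<theta>'] \<theta>c(2) by (simp add: o_def)
    then have hP: "continuous_map ?P euclidean (\<lambda>q. h (fst q) (\<theta>' (snd q)))"
      unfolding h_def
      by (intro continuous_map_push[OF \<epsilon>])
        (use continuous_map_compose[OF fstP r] in \<open>auto simp: o_def\<close>)
    have "continuous_map ?P (conf_pt n) (\<lambda>q. (a (fst q), h (fst q) (\<theta>' (snd q))))"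
      by (rule continuous_map_conf_ptI)
        (use continuous_map_compose[OF fstP a] hP h\<theta> in \<open>auto simp: o_def\<close>)
    then have "continuous_map ?P E' \<psi>"
      unfolding \<psi>_def by (intro lift(9) fstP) auto
    moreover have "\<psi> q \<in> {t \<in> topspace E'. p' t \<in> U}" if "q \<in> topspace ?P" for q
    proof -
      have q: "fst q \<in> topspace X" "fst q \<in> U" "snd q \<notin> a x0" using that by auto
      show ?thesis unfolding \<psi>_def using lift(5)[OF q(1) ptin[OF q(2,3)]] lift(6)[OF q(1) ptin[OF q(2,3)]] q(2) by simp
    qed
    ultimately show "continuous_map ?P ?E \<psi>" by (auto simp: continuous_map_in_subtopology)
    show "\<psi> (\<phi> t) = t" if "t \<in> topspace ?E" for t
    proof -
      have t: "t \<in> topspace E'" "p' t \<in> U" using that by auto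
      have "(a (p' t), snd (g t)) = g t" using lift(4)[OF t(1)] by simp
      then show ?thesis unfolding \<psi>_def \<phi>_def using \<theta>c(4) hy[OF t(2)] lift(8)[OF t(1)] by simp
    qed
    show "\<phi> (\<psi> q) = q" if "q \<in> topspace ?P" for q
    proof -
      have q: "fst q \<in> topspace X" "fst q \<in> U" "snd q \<notin> a x0" using that by auto
      have *: "p' (\<psi> q) = fst q" "g (\<psi> q) = (a (fst q), h (fst q) (\<theta>' (snd q)))"
        unfolding \<psi>_def using lift(6,7)[OF q(1) ptin[OF q(2,3)]] by auto
      then have "y (\<psi> q) = \<theta>' (snd q)" using bij(1)[OF q(2)] by (simp add: y_def inv_f_f)
      then show ?thesis using * \<theta>c(3) by (simp add: \<phi>_def)
    qed
  qed
  then have "homeomorphic_map ?E ?P \<phi>" using homeomorphic_map_maps by blast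
  then show "\<exists>U. openin X U \<and> b \<in> U \<and>
      (\<exists>\<phi>. homeomorphic_map (subtopology E' {t \<in> topspace E'. p' t \<in> U})
          (prod_topology (subtopology X U) (top_of_set (- a x0))) \<phi> \<and>
        (\<forall>t\<in>topspace E'. p' t \<in> U \<longrightarrow> fst (\<phi> t) = p' t))"
    using U bU by (intro exI[of _ U] conjI exI[of _ \<phi>]) (auto simp: \<phi>_def)
qed

section \<open>Coordinates on the torus\<close>

lemma comm_group_cstar: "comm_group cstar"
  by (rule comm_groupI) (auto simp: cstar_def intro!: bexI[of _ "inverse _"])

lemma int_pow_cstar: "z \<noteq> 0 \<Longrightarrow> z [^]\<^bsub>cstar\<^esub> (k::int) = z powi k"
proof -
  assume z: "z \<noteq> 0"
  interpret comm_group cstar by (rule comm_group_cstar)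
  have pow: "z [^]\<^bsub>cstar\<^esub> (n::nat) = z ^ n" for n
    by (induction n) (simp_all add: nat_pow_def cstar_def)
  have "inv\<^bsub>cstar\<^esub> (z ^ n) = inverse (z ^ n)" for n
    using z by (intro inv_equality) (auto simp: cstar_def)
  then show ?thesis by (auto simp: int_pow_def2 pow power_int_def power_inverse)
qed

lemma finprod_cstar:
  assumes "finite I" "\<And>i. i \<in> I \<Longrightarrow> f i \<noteq> 0"
  shows "finprod cstar f I = prod f I"
proof -
  interpret comm_group cstar by (rule comm_group_cstar)
  show ?thesis
    using assms
  proof (induction I rule: finite_induct)
    case (insert i I)
    then have "finprod cstar f (insert i I) = f i \<otimes>\<^bsub>cstar\<^esub> finprod cstar f I"
      by (intro finprod_insert) (auto simp: cstar_def)
    then show ?case using insert by (simp add: cstar_def)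
  next
    case empty
    show ?case using finprod_empty by (simp add: cstar_def)
  qed
qed

lemma hom_finprod_comm_group:
  assumes "comm_group G" "comm_group H" "h \<in> hom G H" "finite I" "\<And>i. i \<in> I \<Longrightarrow> f i \<in> carrier G"
  shows "h (finprod G f I) = finprod H (\<lambda>i. h (f i)) I"
proof -
  interpret G: comm_group G by fact
  interpret H: comm_group H by fact
  interpret group_hom G H h by unfold_locales fact
  show ?thesis
    using assms(4,5)
  proof (induction I rule: finite_induct)
    case (insert i I)
    then have "h (finprod G f (insert i I)) = h (f i) \<otimes>\<^bsub>H\<^esub> h (finprod G f I)"
      by (subst G.finprod_insert) (auto intro!: hom_mult G.finprod_closed)
    also have "\<dots> = finprod H (\<lambda>i. h (f i)) (insert i I)"
      using insert by (subst H.finprod_insert) auto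
    finally show ?case .
  qed simp
qed

lemma torus_nonzero: "t \<in> torus \<Gamma> \<Longrightarrow> g \<in> carrier \<Gamma> \<Longrightarrow> t g \<noteq> 0"
  by (auto simp: torus_def hom_def cstar_def Pi_iff)

lemma torus_mult: "t \<in> torus \<Gamma> \<Longrightarrow> g \<in> carrier \<Gamma> \<Longrightarrow> h \<in> carrier \<Gamma> \<Longrightarrow> t (g \<otimes>\<^bsub>\<Gamma>\<^esub> h) = t g * t h"
  by (auto simp: torus_def hom_def cstar_def)

lemma topspace_torus_topology: "topspace (torus_topology \<Gamma>) = torus \<Gamma>"
  by (auto simp: torus_topology_def torus_def PiE_def)

lemma continuous_map_torus_eval: "g \<in> carrier \<Gamma> \<Longrightarrow> continuous_map (torus_topology \<Gamma>) euclidean (\<lambda>t. t g)"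
  unfolding torus_topology_def
  by (intro continuous_map_from_subtopology continuous_map_product_projection)

definition coord_monomial :: "'g monoid \<Rightarrow> (nat \<Rightarrow> 'g) \<Rightarrow> nat \<Rightarrow> (nat \<Rightarrow> int) \<Rightarrow> 'g" where
  "coord_monomial \<Gamma> e k v = (\<Otimes>\<^bsub>\<Gamma>\<^esub>i\<in>{..<k}. e i [^]\<^bsub>\<Gamma>\<^esub> v i)"

definition coord_exponents :: "'g monoid \<Rightarrow> (nat \<Rightarrow> 'g) \<Rightarrow> nat \<Rightarrow> 'g \<Rightarrow> nat \<Rightarrow> int" where
  "coord_exponents \<Gamma> e k = the_inv_into ({..<k} \<rightarrow>\<^sub>E UNIV) (coord_monomial \<Gamma> e k)"

text \<open>The inverse of the coordinate map: for nonzero \<open>z i\<close> it is the homomorphism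
  with value \<open>z i\<close> at \<open>e i\<close>.\<close>

definition torus_point :: "'g monoid \<Rightarrow> (nat \<Rightarrow> 'g) \<Rightarrow> nat \<Rightarrow> (nat \<Rightarrow> complex) \<Rightarrow> 'g \<Rightarrow> complex" where
  "torus_point \<Gamma> e k z = (\<lambda>g\<in>carrier \<Gamma>. \<Prod>i<k. z i powi coord_exponents \<Gamma> e k g i)"

context
  fixes \<Gamma> :: "'g monoid" and e :: "nat \<Rightarrow> 'g" and k :: nat
  assumes basis: "lattice_basis \<Gamma> e k"
begin

lemma comm_group_lattice: "comm_group \<Gamma>" and basis_carrier: "i < k \<Longrightarrow> e i \<in> carrier \<Gamma>"
  and bij_coord_monomial: "bij_betw (coord_monomial \<Gamma> e k) ({..<k} \<rightarrow>\<^sub>E UNIV) (carrier \<Gamma>)"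
  using basis by (auto simp: lattice_basis_def coord_monomial_def[abs_def])

interpretation comm_group \<Gamma> by (rule comm_group_lattice)

lemma coord_exponents:
  assumes "g \<in> carrier \<Gamma>"
  shows "coord_exponents \<Gamma> e k g \<in> {..<k} \<rightarrow>\<^sub>E UNIV" "coord_monomial \<Gamma> e k (coord_exponents \<Gamma> e k g) = g"
  using the_inv_into_into[of "coord_monomial \<Gamma> e k" "{..<k} \<rightarrow>\<^sub>E UNIV" g]
    f_the_inv_into_f[of "coord_monomial \<Gamma> e k" "{..<k} \<rightarrow>\<^sub>E UNIV" g] bij_coord_monomial assms
  by (auto simp: coord_exponents_def bij_betw_def)

lemma coord_exponents_monomial:
  assumes "v \<in> {..<k} \<rightarrow>\<^sub>E UNIV" shows "coord_exponents \<Gamma> e k (coord_monomial \<Gamma> e k v) = v"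
  using bij_coord_monomial assms by (simp add: coord_exponents_def bij_betw_def the_inv_into_f_f)

lemma coord_monomial_restrict: "coord_monomial \<Gamma> e k (restrict v {..<k}) = coord_monomial \<Gamma> e k v"
  unfolding coord_monomial_def by (rule finprod_cong') (use basis_carrier in auto)

lemma coord_monomial_add:
  "coord_monomial \<Gamma> e k (\<lambda>i. v i + w i) = coord_monomial \<Gamma> e k v \<otimes>\<^bsub>\<Gamma>\<^esub> coord_monomial \<Gamma> e k w"
proof -
  have "coord_monomial \<Gamma> e k (\<lambda>i. v i + w i)
      = (\<Otimes>\<^bsub>\<Gamma>\<^esub>i\<in>{..<k}. e i [^]\<^bsub>\<Gamma>\<^esub> v i \<otimes>\<^bsub>\<Gamma>\<^esub> e i [^]\<^bsub>\<Gamma>\<^esub> w i)"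
    unfolding coord_monomial_def by (rule finprod_cong') (use basis_carrier in \<open>auto simp: int_pow_mult\<close>)
  also have "\<dots> = coord_monomial \<Gamma> e k v \<otimes>\<^bsub>\<Gamma>\<^esub> coord_monomial \<Gamma> e k w"
    unfolding coord_monomial_def by (rule finprod_multf) (use basis_carrier in auto)
  finally show ?thesis .
qed

lemma coord_exponents_mult:
  assumes "g \<in> carrier \<Gamma>" "h \<in> carrier \<Gamma>" "i < k"
  shows "coord_exponents \<Gamma> e k (g \<otimes>\<^bsub>\<Gamma>\<^esub> h) i = coord_exponents \<Gamma> e k g i + coord_exponents \<Gamma> e k h i"
proof -
  let ?v = "\<lambda>i. coord_exponents \<Gamma> e k g i + coord_exponents \<Gamma> e k h i"
  have "coord_monomial \<Gamma> e k (restrict ?v {..<k}) = g \<otimes>\<^bsub>\<Gamma>\<^esub> h"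
    unfolding coord_monomial_restrict coord_monomial_add using assms by (simp add: coord_exponents)
  then have "coord_exponents \<Gamma> e k (g \<otimes>\<^bsub>\<Gamma>\<^esub> h) = restrict ?v {..<k}"
    using coord_exponents_monomial[of "restrict ?v {..<k}"] by simp
  then show ?thesis using assms(3) by simp
qed

lemma coord_exponents_basis:
  assumes "j < k" "i < k" shows "coord_exponents \<Gamma> e k (e j) i = (if i = j then 1 else 0)"
proof -
  let ?v = "\<lambda>i\<in>{..<k}. if i = j then 1 else 0 :: int"
  have "coord_monomial \<Gamma> e k ?v = (\<Otimes>\<^bsub>\<Gamma>\<^esub>i\<in>{..<k}. if j = i then e i else \<one>\<^bsub>\<Gamma>\<^esub>)"
    unfolding coord_monomial_def by (rule finprod_cong') (use basis_carrier in auto)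
  also have "\<dots> = e j" using assms basis_carrier by (intro finprod_singleton) auto
  finally have "coord_exponents \<Gamma> e k (e j) = ?v"
    using coord_exponents_monomial[of ?v] by simp
  then show ?thesis using assms by simp
qed

lemma torus_apply:
  assumes "t \<in> torus \<Gamma>" "g \<in> carrier \<Gamma>"
  shows "t g = (\<Prod>i<k. t (e i) powi coord_exponents \<Gamma> e k g i)"
proof -
  let ?v = "coord_exponents \<Gamma> e k g"
  have t: "t \<in> hom \<Gamma> cstar" using assms by (simp add: torus_def)
  have "t g = t (\<Otimes>\<^bsub>\<Gamma>\<^esub>i\<in>{..<k}. e i [^]\<^bsub>\<Gamma>\<^esub> ?v i)"
    using coord_exponents(2)[OF assms(2)] by (simp add: coord_monomial_def)
  also have "\<dots> = finprod cstar (\<lambda>i. t (e i [^]\<^bsub>\<Gamma>\<^esub> ?v i)) {..<k}"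
    by (rule hom_finprod_comm_group[OF comm_group_lattice comm_group_cstar t])
      (use basis_carrier in auto)
  also have "\<dots> = (\<Prod>i<k. t (e i [^]\<^bsub>\<Gamma>\<^esub> ?v i))"
    by (rule finprod_cstar) (use torus_nonzero[OF assms(1)] basis_carrier in auto)
  also have "\<dots> = (\<Prod>i<k. t (e i) powi ?v i)"
  proof (rule prod.cong[OF refl])
    fix i assume "i \<in> {..<k}"
    then have i: "e i \<in> carrier \<Gamma>" using basis_carrier by simp
    show "t (e i [^]\<^bsub>\<Gamma>\<^esub> ?v i) = t (e i) powi ?v i"
      using hom_int_pow[OF t i is_group comm_group.axioms(2)[OF comm_group_cstar]]
        int_pow_cstar[OF torus_nonzero[OF assms(1) i]] by simp
  qed
  finally show ?thesis .
qed

lemma torus_eqI: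
  assumes "t \<in> torus \<Gamma>" "t' \<in> torus \<Gamma>" "\<And>i. i < k \<Longrightarrow> t (e i) = t' (e i)"
  shows "t = t'"
proof
  fix g show "t g = t' g"
  proof (cases "g \<in> carrier \<Gamma>")
    case True then show ?thesis using assms by (simp add: torus_apply)
  next
    case False then show ?thesis using assms by (auto simp: torus_def extensional_def)
  qed
qed

lemma torus_point_in:
  assumes "\<And>i. i < k \<Longrightarrow> z i \<noteq> 0" shows "torus_point \<Gamma> e k z \<in> torus \<Gamma>"
  unfolding torus_def hom_def
proof (intro IntI CollectI conjI ballI Pi_I)
  fix g assume g: "g \<in> carrier \<Gamma>"
  then show "torus_point \<Gamma> e k z g \<in> carrier cstar"
    using assms by (auto simp: torus_point_def cstar_def)
  fix h assume h: "h \<in> carrier \<Gamma>"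
  have "(\<Prod>i<k. z i powi coord_exponents \<Gamma> e k (g \<otimes>\<^bsub>\<Gamma>\<^esub> h) i)
      = (\<Prod>i<k. z i powi coord_exponents \<Gamma> e k g i * z i powi coord_exponents \<Gamma> e k h i)"
    using assms by (intro prod.cong) (simp_all add: coord_exponents_mult[OF g h] power_int_add)
  then show "torus_point \<Gamma> e k z (g \<otimes>\<^bsub>\<Gamma>\<^esub> h)
      = torus_point \<Gamma> e k z g \<otimes>\<^bsub>cstar\<^esub> torus_point \<Gamma> e k z h"
    using g h by (simp add: torus_point_def cstar_def prod.distrib)
qed (simp add: torus_point_def)

lemma torus_point_basis:
  assumes "j < k" shows "torus_point \<Gamma> e k z (e j) = z j"
proof -
  have "(\<Prod>i<k. z i powi coord_exponents \<Gamma> e k (e j) i) = (\<Prod>i<k. if i = j then z j else 1)"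
    using assms by (intro prod.cong) (simp_all add: coord_exponents_basis)
  then show ?thesis using assms basis_carrier[OF assms] by (simp add: torus_point_def)
qed

lemma continuous_map_torus_point:
  assumes "\<And>i. i < k \<Longrightarrow> continuous_map Z euclidean (\<lambda>x. z x i)"
    "\<And>i x. i < k \<Longrightarrow> x \<in> topspace Z \<Longrightarrow> z x i \<noteq> 0"
  shows "continuous_map Z (torus_topology \<Gamma>) (\<lambda>x. torus_point \<Gamma> e k (z x))"
proof -
  have "continuous_map Z euclidean (\<lambda>x. \<Prod>i<k. z x i powi coord_exponents \<Gamma> e k g i)" for g
    using assms unfolding continuous_map_atin limitin_canonical_iff
    by (auto intro!: tendsto_intros)
  then show ?thesis
    unfolding torus_topology_def continuous_map_in_subtopology continuous_map_componentwise
    using assms(2) torus_point_in by (auto simp: torus_point_def)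
qed

end

section \<open>The projection of the complement of a toric arrangement\<close>

lemma torus_divide:
  assumes "s \<in> torus \<Gamma>" "t \<in> torus \<Gamma>" "comm_group \<Gamma>"
  shows "(\<lambda>g\<in>carrier \<Gamma>. t g / s g) \<in> torus \<Gamma>"
proof -
  interpret comm_group \<Gamma> by fact
  show ?thesis
    using torus_nonzero[OF assms(1)] torus_nonzero[OF assms(2)] torus_mult[OF assms(1)] torus_mult[OF assms(2)]
    by (auto simp: torus_def hom_def cstar_def)
qed

text \<open>\<open>Y\<close> is the kernel of the projection, so two points with equal projection
  lie in the same coset of \<open>Y\<close>, and a union of cosets contains both or neither.\<close>

lemma sub_arrangement_saturated:
  assumes \<Gamma>: "comm_group \<Gamma>" "\<And>i. i < d \<Longrightarrow> e i \<in> carrier \<Gamma>"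
    and Y: "Y = {t \<in> torus \<Gamma>. \<forall>i<d. t (e i) = 1}"
    and K: "K \<in> sub_arrangement \<Gamma> A Y" and t: "t \<in> K" and t': "t' \<in> torus \<Gamma>"
    and eq: "proj e d t = proj e d t'"
  shows "t' \<in> K"
proof -
  obtain \<C> where \<C>: "\<C> \<subseteq> rcosets\<^bsub>torus_group \<Gamma>\<^esub> Y" "K = \<Union>\<C>"
    using K by (auto simp: sub_arrangement_def)
  then obtain C where C: "C \<in> \<C>" "t \<in> C" using t by blast
  then obtain s where s: "s \<in> torus \<Gamma>" "C = Y #>\<^bsub>torus_group \<Gamma>\<^esub> s"
    using \<C>(1) by (auto simp: RCOSETS_def torus_group_def)
  obtain y where y: "y \<in> Y" "t = (\<lambda>g\<in>carrier \<Gamma>. y g * s g)"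
    using C(2) s(2) by (auto simp: r_coset_def torus_group_def)
  \<comment> \<open>The factor that carries the coset representative \<open>s\<close> to
    \<open>t'\<close>; equality of the projections puts it in \<open>Y\<close>.\<close>
  define y' where "y' = (\<lambda>g\<in>carrier \<Gamma>. t' g / s g)"
  have "y' (e i) = 1" if i: "i < d" for i
  proof -
    have "t' (e i) = t (e i)" using fun_cong[OF eq, of i] i by (simp add: proj_def)
    then show ?thesis
      using y \<Gamma>(2)[OF i] torus_nonzero[OF s(1)] i by (simp add: y'_def Y)
  qed
  then have "y' \<in> Y" using torus_divide[OF s(1) t' \<Gamma>(1)] by (simp add: Y y'_def)
  moreover have "t' = (\<lambda>g\<in>carrier \<Gamma>. y' g * s g)"
    using torus_nonzero[OF s(1)] t' by (auto simp: y'_def torus_def extensional_def restrict_def fun_eq_iff)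
  ultimately have "t' \<in> C"
    unfolding s(2) by (auto simp: r_coset_def torus_group_def)
  then show ?thesis using C(1) \<C>(2) by blast
qed

lemma coefficient_map_eq:
  "coefficient_map d l m0 m \<mu> x =
     insert 0 (\<Union>j\<in>{1..l}. {z. z ^ m0 j = \<mu> j * monomial d (m j) x})"
  by (auto simp: coefficient_map_def weierstrass_poly_def poly_prod poly_monom)

lemma monomial_nonzero: "(\<And>i. i < d \<Longrightarrow> x i \<noteq> 0) \<Longrightarrow> monomial d v x \<noteq> 0"
  by (simp add: monomial_def)

lemma continuous_map_monomial:
  assumes "\<And>i. i < d \<Longrightarrow> continuous_map Z euclidean (\<lambda>z. x z i)"
    "\<And>i z. i < d \<Longrightarrow> z \<in> topspace Z \<Longrightarrow> x z i \<noteq> 0"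
  shows "continuous_map Z euclidean (\<lambda>z. monomial d v (x z))"
  using assms unfolding continuous_map_atin limitin_canonical_iff monomial_def
  by (auto intro!: tendsto_intros)

section \<open>The complement in the coordinates (x, y)\<close>

context
  fixes \<Gamma> :: "'g monoid" and e :: "nat \<Rightarrow> 'g" and d l :: nat
    and A :: "('g \<Rightarrow> complex) set set" and Y :: "('g \<Rightarrow> complex) set"
    and H :: "nat \<Rightarrow> ('g \<Rightarrow> complex) set"
    and m0 :: "nat \<Rightarrow> nat" and m :: "nat \<Rightarrow> nat \<Rightarrow> int" and \<mu> :: "nat \<Rightarrow> complex"
  assumes basis: "lattice_basis \<Gamma> e (Suc d)"
    and A_torus: "\<And>K. K \<in> A \<Longrightarrow> K \<subseteq> torus \<Gamma>"
    and M_ideal: "M_ideal \<Gamma> A Y"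
    and Y_coords: "Y = {t \<in> torus \<Gamma>. \<forall>i<d. t (e i) = 1}"
    and H_enum: "bij_betw H {1..l} (A - sub_arrangement \<Gamma> A Y)"
    and H_eq: "\<And>j. j \<in> {1..l} \<Longrightarrow>
        H j = {t \<in> torus \<Gamma>. t (e d) ^ m0 j = \<mu> j * monomial d (m j) (proj e d t)}"
    and m0_pos: "\<And>j. j \<in> {1..l} \<Longrightarrow> m0 j > 0"
    and \<mu>_nonzero: "\<And>j. j \<in> {1..l} \<Longrightarrow> \<mu> j \<noteq> 0"
begin

private abbreviation (input) "MA \<equiv> complement_space \<Gamma> A"
private abbreviation (input) "MB \<equiv> coord_complement_space d (quotient_arrangement \<Gamma> e d A Y)"
private abbreviation (input) "a \<equiv> coefficient_map d l m0 m \<mu>"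
private abbreviation (input) "n \<equiv> 1 + (\<Sum>j=1..l. m0 j)"
private abbreviation (input) "\<rho> \<equiv> \<lambda>j x. \<mu> j * monomial d (m j) x"
private abbreviation (input) "pt \<equiv> \<lambda>x y. torus_point \<Gamma> e (Suc d) (x(d := y))"

lemma proj_eq_iff: "proj e d t = x \<longleftrightarrow> x \<in> extensional {..<d} \<and> (\<forall>i<d. t (e i) = x i)"
  by (auto simp: proj_def fun_eq_iff restrict_def extensional_def)

lemma basis_in_carrier: "i \<le> d \<Longrightarrow> e i \<in> carrier \<Gamma>"
  using basis_carrier[OF basis, of i] by simp

lemma topspace_complement_space: "topspace MA = torus \<Gamma> - \<Union>A"
  by (auto simp: complement_space_def topspace_torus_topology)

lemma topspace_coord_complement_space:
  "topspace MB = {x \<in> {..<d} \<rightarrow>\<^sub>E - {0}. \<forall>K\<in>sub_arrangement \<Gamma> A Y. x \<notin> proj e d ` K}"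
  by (auto simp: coord_complement_space_def quotient_arrangement_def)

lemma coord_complement_nonzero: "x \<in> topspace MB \<Longrightarrow> i < d \<Longrightarrow> x i \<noteq> 0"
  by (auto simp: topspace_coord_complement_space PiE_iff)

lemma coord_complement_extensional: "x \<in> topspace MB \<Longrightarrow> x \<in> extensional {..<d}"
  by (auto simp: topspace_coord_complement_space PiE_iff)

lemma root_power_nonzero: "x \<in> topspace MB \<Longrightarrow> j \<in> {1..l} \<Longrightarrow> \<rho> j x \<noteq> 0"
  using \<mu>_nonzero monomial_nonzero[OF coord_complement_nonzero] by simp

lemma H_notin_sub_arrangement: "j \<in> {1..l} \<Longrightarrow> H j \<in> A - sub_arrangement \<Gamma> A Y"
  using H_enum by (auto simp: bij_betw_def)

text \<open>Members of the subarrangement are visible in the base by saturation, and the remaining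
  \<open>H j\<close> say that the last coordinate is a root of factor \<open>j\<close>. The root 0,
  from the factor y, excludes nothing on the torus, whose last coordinate is nonzero.\<close>

lemma in_complement_space_iff:
  assumes t: "t \<in> torus \<Gamma>"
  shows "t \<in> topspace MA \<longleftrightarrow> proj e d t \<in> topspace MB \<and> t (e d) \<notin> a (proj e d t)"
proof -
  have nz: "t (e i) \<noteq> 0" if "i \<le> d" for i using torus_nonzero[OF t basis_in_carrier[OF that]] .
  have p: "proj e d t \<in> {..<d} \<rightarrow>\<^sub>E - {0}" using nz by (auto simp: proj_def PiE_iff)
  have sub: "proj e d t \<in> proj e d ` K \<longleftrightarrow> t \<in> K" if "K \<in> sub_arrangement \<Gamma> A Y" for K
    using sub_arrangement_saturated[OF comm_group_lattice[OF basis] _ Y_coords that _ t] basis_in_carrier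
    by force
  have "A = sub_arrangement \<Gamma> A Y \<union> H ` {1..l}"
    using H_enum by (auto simp: bij_betw_def sub_arrangement_def)
  then have "t \<in> \<Union>A \<longleftrightarrow> (\<exists>K\<in>sub_arrangement \<Gamma> A Y. t \<in> K) \<or> (\<exists>j\<in>{1..l}. t \<in> H j)" by blast
  moreover have "t \<in> H j \<longleftrightarrow> t (e d) ^ m0 j = \<rho> j (proj e d t)" if "j \<in> {1..l}" for j
    using H_eq[OF that] t by simp
  ultimately show ?thesis
    using t p sub nz[of d] unfolding topspace_complement_space topspace_coord_complement_space coefficient_map_eq by auto
qed

lemma torus_point_coords:
  assumes "\<And>i. i < d \<Longrightarrow> x i \<noteq> 0" "x \<in> extensional {..<d}" "y \<noteq> 0"
  shows "pt x y \<in> torus \<Gamma>" "proj e d (pt x y) = x" "pt x y (e d) = y"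
proof -
  have "(x(d := y)) i \<noteq> 0" if "i < Suc d" for i using assms that by auto
  then show "pt x y \<in> torus \<Gamma>" by (rule torus_point_in[OF basis])
  have "pt x y (e i) = (x(d := y)) i" if "i < Suc d" for i
    by (rule torus_point_basis[OF basis that])
  then show "proj e d (pt x y) = x" "pt x y (e d) = y"
    using assms(2) by (simp_all add: proj_eq_iff)
qed

lemma torus_point_of_coords: assumes "t \<in> torus \<Gamma>" shows "pt (proj e d t) (t (e d)) = t"
proof (rule torus_eqI[OF basis _ assms])
  show "pt (proj e d t) (t (e d)) \<in> torus \<Gamma>"
    using torus_nonzero[OF assms basis_in_carrier] by (intro torus_point_coords) (auto simp: proj_def)
  show "pt (proj e d t) (t (e d)) (e i) = t (e i)" if "i < Suc d" for i
    using torus_point_basis[OF basis that, of "(proj e d t)(d := t (e d))"] that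
    by (auto simp: proj_def less_Suc_eq)
qed

lemma roots_disjoint:
  assumes x: "x \<in> topspace MB" and j: "i \<in> {1..l}" "j \<in> {1..l}" "i \<noteq> j" and y: "y ^ m0 i = \<rho> i x"
  shows "y ^ m0 j \<noteq> \<rho> j x"
proof
  assume y': "y ^ m0 j = \<rho> j x"
  have "y \<noteq> 0" using y root_power_nonzero[OF x j(1)] m0_pos[OF j(1)] by (auto simp: power_0_left)
  note p = torus_point_coords[OF coord_complement_nonzero[OF x] coord_complement_extensional[OF x] this]
  have H12: "pt x y \<in> H i \<inter> H j" using H_eq[OF j(1)] H_eq[OF j(2)] p y y' by simp
  \<comment> \<open>The M-ideal condition concerns components; a single point is connected and
    therefore lies in one of them.\<close>
  have "connectedin (torus_topology \<Gamma>) {pt x y}"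
    using p(1) by (simp add: topspace_torus_topology)
  moreover have "{pt x y} \<subseteq> H i \<inter> H j" using H12 by simp
  ultimately obtain X where X: "X \<in> components_in \<Gamma> (H i \<inter> H j)" "{pt x y} \<subseteq> X"
    using component_exists[of \<Gamma> "{pt x y}" "H i \<inter> H j"] by (metis insert_not_empty)
  have "H i \<noteq> H j"
    using bij_betw_imp_inj_on[OF H_enum] j by (metis inj_onD)
  from M_ideal[unfolded M_ideal_def, rule_format, OF H_notin_sub_arrangement[OF j(1)] H_notin_sub_arrangement[OF j(2)] this X(1)]
  obtain K where K: "K \<in> sub_arrangement \<Gamma> A Y" "X \<subseteq> K" by (rule bexE)
  then have "pt x y \<in> K" using X(2) by (simp add: subsetD)
  then have "x \<in> proj e d ` K" using p(2) by (intro image_eqI[OF sym])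
  then show False using x K(1) unfolding topspace_coord_complement_space by simp
qed

text \<open>Factor \<open>j\<close> contributes the \<open>m0 j\<close> distinct roots of a nonzero
  number, different factors contribute disjoint sets, and 0 is a root of none of them.\<close>

lemma card_coefficient_map:
  assumes x: "x \<in> topspace MB" shows "finite (a x)" "card (a x) = n"
proof -
  let ?R = "\<lambda>j. {z. z ^ m0 j = \<rho> j x}"
  have fin: "finite (?R j)" if "j \<in> {1..l}" for j using finite_nth_roots[OF m0_pos[OF that]] .
  show "finite (a x)" unfolding coefficient_map_eq using fin by auto
  have "card (\<Union>j\<in>{1..l}. ?R j) = (\<Sum>j\<in>{1..l}. card (?R j))"
    using fin roots_disjoint[OF x] by (intro card_UN_disjoint) blast+
  also have "\<dots> = (\<Sum>j\<in>{1..l}. m0 j)"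
    using m0_pos root_power_nonzero[OF x] by (intro sum.cong refl card_nth_roots) auto
  finally have "card (\<Union>j\<in>{1..l}. ?R j) = (\<Sum>j\<in>{1..l}. m0 j)" .
  moreover have "0 \<notin> ?R j" if "j \<in> {1..l}" for j
    using m0_pos[OF that] root_power_nonzero[OF x that] unfolding mem_Collect_eq by (metis zero_power)
  then have "0 \<notin> (\<Union>j\<in>{1..l}. ?R j)" by blast
  ultimately show "card (a x) = n"
    unfolding coefficient_map_eq using fin by simp
qed

lemma continuous_map_coord: "i < d \<Longrightarrow> continuous_map MB euclidean (\<lambda>x. x i)"
  unfolding coord_complement_space_def
  by (intro continuous_map_from_subtopology continuous_map_product_projection) auto

lemma continuous_map_root_power: "continuous_map MB euclidean (\<rho> j)"
proof -
  have "continuous_map MB euclidean (\<lambda>x. monomial d (m j) x)"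
    by (rule continuous_map_monomial[OF continuous_map_coord coord_complement_nonzero])
  then show ?thesis by (simp add: continuous_map_atin tendsto_mult)
qed

text \<open>Explicit branches: a root over \<open>x0\<close> is continued by multiplying it with a
  principal root of the ratio of the right-hand sides at \<open>x\<close> and \<open>x0\<close>.
  Near \<open>x0\<close> this ratio is close to 1, so the branch cut of \<open>Ln\<close> is
  avoided.\<close>

lemma continuous_map_coefficient_map: "continuous_map MB (uconf n) a"
proof (rule continuous_map_uconf_branches)
  fix x0 assume x0: "x0 \<in> topspace MB"
  obtain c where c: "inj_on c {..<n}" "c ` {..<n} = a x0"
    using enumerate_configuration[OF card_coefficient_map[OF x0]] by (metis (lifting) mem_Collect_eq topspace_conf)
  \<comment> \<open>The index of the factor to which a nonzero root belongs; for the root 0 the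
    choice is arbitrary, and its branch below is constantly 0.\<close>
  have "\<exists>j. c i \<noteq> 0 \<longrightarrow> j \<in> {1..l} \<and> c i ^ m0 j = \<rho> j x0" if "i < n" for i
  proof -
    have "c i \<in> a x0" using c(2) that by blast
    then show ?thesis unfolding coefficient_map_eq by blast
  qed
  then obtain J where J: "\<And>i. i < n \<Longrightarrow> c i \<noteq> 0 \<Longrightarrow> J i \<in> {1..l}"
      "\<And>i. i < n \<Longrightarrow> c i \<noteq> 0 \<Longrightarrow> c i ^ m0 (J i) = \<rho> (J i) x0" by metis
  define q where "q = (\<lambda>j x. \<rho> j x / \<rho> j x0)"
  define r where "r = (\<lambda>i x. c i * exp (Ln (q (J i) x) / of_nat (m0 (J i))))"
  define U where "U = (\<Inter>j\<in>{1..l}. {x \<in> topspace MB. q j x \<in> {z. Re z > 0}}) \<inter> topspace MB"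
  have q: "continuous_map MB euclidean (q j)" if "j \<in> {1..l}" for j
    using continuous_map_root_power[of j] root_power_nonzero[OF x0 that]
    unfolding q_def by (simp add: continuous_map_atin tendsto_divide)
  have Re_open: "open {z. Re z > 0}" by (rule open_halfspace_Re_gt)
  have root: "r i x ^ m0 (J i) = \<rho> (J i) x" if "x \<in> U" "i < n" "c i \<noteq> 0" for i x
  proof -
    note j = J(1)[OF that(2,3)]
    have "Re (q (J i) x) > 0" using that(1) j by (auto simp: U_def)
    then have qnz: "q (J i) x \<noteq> 0" by auto
    have "exp (Ln (q (J i) x) / of_nat (m0 (J i))) ^ m0 (J i) = q (J i) x"
      using m0_pos[OF j] qnz by (simp add: exp_of_nat_mult[symmetric])
    then show ?thesis
      using J(2)[OF that(2,3)] root_power_nonzero[OF x0 j] by (simp add: r_def power_mult_distrib q_def)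
  qed
  have inj: "inj_on (\<lambda>i. r i x) {..<n}" if x: "x \<in> U" for x
  proof (rule inj_onI)
    fix i i' assume i: "i \<in> {..<n}" "i' \<in> {..<n}" and eq: "r i x = r i' x"
    have xB: "x \<in> topspace MB" using x by (simp add: U_def)
    \<comment> \<open>Branches of different factors cannot meet by \<open>roots_disjoint\<close>;
      within one factor the common nonzero exponential cancels.\<close>
    have "c i = c i'"
    proof (cases "c i = 0 \<or> c i' = 0")
      case True then show ?thesis using eq by (auto simp: r_def)
    next
      case False
      have "J i = J i'"
        using roots_disjoint[OF xB J(1)[of i] J(1)[of i'] _ root[OF x, of i]] root[OF x, of i'] eq i False
        by auto
      then show ?thesis using eq by (simp add: r_def)
    qed
    then show "i = i'" by (rule inj_onD[OF c(1) _ i])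
  qed
  show "\<exists>U r. openin MB U \<and> x0 \<in> U \<and>
      (\<forall>i<n. continuous_map (subtopology MB U) euclidean (r i)) \<and>
      (\<forall>x'\<in>U. inj_on (\<lambda>i. r i x') {..<n} \<and> a x' = (\<lambda>i. r i x') ` {..<n})"
  proof (intro exI conjI allI impI ballI)
    show "openin MB U"
      unfolding U_def
      by (intro openin_INT openin_continuous_map_preimage[OF q]) (use Re_open in \<open>simp_all flip: open_openin\<close>)
    show "x0 \<in> U" using x0 root_power_nonzero[OF x0] by (auto simp: U_def q_def)
    fix i assume i: "i < n"
    show "continuous_map (subtopology MB U) euclidean (r i)"
    proof (cases "c i = 0")
      case True then show ?thesis by (simp add: r_def)
    next
      case False
      note j = J(1)[OF i False]
      have "continuous_map (subtopology MB U) (top_of_set {z. Re z > 0}) (q (J i))"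
        using q[OF j] j by (auto simp: continuous_map_in_subtopology continuous_map_from_subtopology U_def)
      moreover have "continuous_on {z. Re z > 0} (\<lambda>z. c i * exp (Ln z / of_nat (m0 (J i))))"
        using m0_pos[OF j] by (intro continuous_intros) (auto simp: complex_nonpos_Reals_iff)
      then have "continuous_map (top_of_set {z. Re z > 0}) euclidean (\<lambda>z. c i * exp (Ln z / of_nat (m0 (J i))))"
        by simp
      ultimately have "continuous_map (subtopology MB U) euclidean
          ((\<lambda>z. c i * exp (Ln z / of_nat (m0 (J i)))) \<circ> q (J i))"
        by (rule continuous_map_compose)
      then show ?thesis by (simp add: r_def o_def)
    qed
  next
    fix x assume x: "x \<in> U"
    then have xB: "x \<in> topspace MB" by (simp add: U_def)
    show "inj_on (\<lambda>i. r i x) {..<n}" by (rule inj[OF x])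
    have "r i x \<in> a x" if "i < n" for i
    proof (cases "c i = 0")
      case False
      then show ?thesis unfolding coefficient_map_eq using root[OF x that False] J(1)[OF that False] by blast
    qed (simp add: r_def coefficient_map_eq)
    then show "a x = (\<lambda>i. r i x) ` {..<n}"
      using card_coefficient_map[OF xB] inj[OF x] by (intro card_subset_eq[symmetric]) (auto simp: card_image)
  qed
qed

lemma continuous_map_complement_eval: "g \<in> carrier \<Gamma> \<Longrightarrow> continuous_map MA euclidean (\<lambda>t. t g)"
  unfolding complement_space_def
  by (intro continuous_map_from_subtopology continuous_map_torus_eval)

lemma complement_space_subset_torus: "t \<in> topspace MA \<Longrightarrow> t \<in> torus \<Gamma>"
  by (simp add: topspace_complement_space)

lemma continuous_map_proj_complement: "continuous_map MA MB (proj e d)"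
proof -
  have "proj e d t \<in> ({..<d} \<rightarrow>\<^sub>E - {0}) - \<Union> (quotient_arrangement \<Gamma> e d A Y)" if "t \<in> topspace MA" for t
  proof -
    have "proj e d t \<in> topspace MB" using in_complement_space_iff[OF complement_space_subset_torus[OF that]] that by simp
    then show ?thesis unfolding coord_complement_space_def by simp
  qed
  moreover have "continuous_map MA euclidean (\<lambda>t. proj e d t i)" if "i < d" for i
    using continuous_map_complement_eval[OF basis_in_carrier, of i] that by (simp add: proj_def)
  ultimately show ?thesis
    unfolding coord_complement_space_def continuous_map_in_subtopology continuous_map_componentwise
    by (auto simp: proj_def)
qed

lemma torus_point_in_complement:
  assumes "x \<in> topspace MB" "y \<notin> a x"
  shows "pt x y \<in> topspace MA" "proj e d (pt x y) = x" "pt x y (e d) = y"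
proof -
  have "y \<noteq> 0" using assms(2) by (auto simp: coefficient_map_eq)
  note p = torus_point_coords[OF coord_complement_nonzero[OF assms(1)] coord_complement_extensional[OF assms(1)] this]
  show "proj e d (pt x y) = x" by (rule p(2))
  show "pt x y (e d) = y" by (rule p(3))
  show "pt x y \<in> topspace MA" using in_complement_space_iff[OF p(1)] p assms by simp
qed

lemma continuous_map_torus_point_complement:
  assumes u: "continuous_map Z MB u" and w: "continuous_map Z euclidean w"
    and "\<And>z. z \<in> topspace Z \<Longrightarrow> w z \<notin> a (u z)"
  shows "continuous_map Z MA (\<lambda>z. pt (u z) (w z))"
proof -
  have uB: "u z \<in> topspace MB" if "z \<in> topspace Z" for z
    using continuous_map_image_subset_topspace[OF u] that by auto
  have nz: "w z \<noteq> 0" if "z \<in> topspace Z" for z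
    using assms(3)[OF that] by (auto simp: coefficient_map_eq)
  have "continuous_map Z (torus_topology \<Gamma>) (\<lambda>z. pt (u z) (w z))"
  proof (rule continuous_map_torus_point[OF basis])
    fix i assume i: "i < Suc d"
    show "continuous_map Z euclidean (\<lambda>z. ((u z)(d := w z)) i)"
    proof (cases "i = d")
      case False
      then have "i < d" using i by simp
      from continuous_map_compose[OF u continuous_map_coord[OF this]] False show ?thesis
        by (simp add: o_def)
    qed (use w in simp)
    show "((u z)(d := w z)) i \<noteq> 0" if "z \<in> topspace Z" for z
      using coord_complement_nonzero[OF uB[OF that]] nz[OF that] i by auto
  qed
  moreover have "pt (u z) (w z) \<in> torus \<Gamma> - \<Union>A" if "z \<in> topspace Z" for z
    using torus_point_in_complement(1)[OF uB[OF that] assms(3)[OF that]] unfolding topspace_complement_space .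
  ultimately show ?thesis by (auto simp: complement_space_def continuous_map_in_subtopology)
qed

text \<open>The total space is determined by the projection and the last coordinate, so both pullback
  squares follow from one criterion: \<open>y\<close> reads off the moving point of a configuration.\<close>

lemma is_pullback_complement_space:
  assumes f: "continuous_map MB B f" and g: "continuous_map MA E g" and y: "continuous_map E euclidean y"
    and comm: "\<And>t. t \<in> topspace MA \<Longrightarrow> f (proj e d t) = q (g t)"
    and yg: "\<And>t. t \<in> topspace MA \<Longrightarrow> y (g t) = t (e d)"
    and notin: "\<And>x c. x \<in> topspace MB \<Longrightarrow> c \<in> topspace E \<Longrightarrow> f x = q c \<Longrightarrow> y c \<notin> a x"
    and inj: "\<And>c c'. c \<in> topspace E \<Longrightarrow> c' \<in> topspace E \<Longrightarrow> q c = q c' \<Longrightarrow> y c = y c' \<Longrightarrow> c = c'"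
  shows "is_pullback MA MB (proj e d) E B q f g"
proof -
  let ?R = "subtopology (prod_topology MB E) {(x, c). f x = q c}"
  let ?\<kappa> = "\<lambda>r. pt (fst r) (y (snd r))"
  have pB: "proj e d t \<in> topspace MB" if "t \<in> topspace MA" for t
    using in_complement_space_iff[OF complement_space_subset_torus[OF that]] that by simp
  have gE: "g t \<in> topspace E" if "t \<in> topspace MA" for t
    using continuous_map_image_subset_topspace[OF g] that by auto
  have "homeomorphic_maps MA ?R (\<lambda>t. (proj e d t, g t)) ?\<kappa>"
    unfolding homeomorphic_maps_def
  proof (intro conjI ballI)
    show "continuous_map MA ?R (\<lambda>t. (proj e d t, g t))"
      unfolding continuous_map_in_subtopology continuous_map_pairwise o_def
      using continuous_map_proj_complement g comm by auto
    have "continuous_map ?R MB fst" "continuous_map ?R E snd"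
      by (auto intro: continuous_map_from_subtopology continuous_map_fst continuous_map_snd)
    moreover have "continuous_map ?R euclidean (\<lambda>r. y (snd r))"
      using continuous_map_compose[OF calculation(2) y] by (simp add: o_def)
    ultimately show "continuous_map ?R MA ?\<kappa>"
      using notin by (intro continuous_map_torus_point_complement) auto
    show "?\<kappa> (proj e d t, g t) = t" if "t \<in> topspace MA" for t
      using yg[OF that] torus_point_of_coords[OF complement_space_subset_torus[OF that]] by simp
    show "(proj e d (?\<kappa> r), g (?\<kappa> r)) = r" if "r \<in> topspace ?R" for r
    proof -
      have r: "fst r \<in> topspace MB" "snd r \<in> topspace E" "f (fst r) = q (snd r)" using that by auto
      note p = torus_point_in_complement[OF r(1) notin[OF r]]
      have "g (?\<kappa> r) = snd r"
        using comm[OF p(1)] yg[OF p(1)] p r by (intro inj gE) simp_all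
      then show ?thesis using p(2) by (simp add: prod_eq_iff)
    qed
  qed
  then have "homeomorphic_map MA ?R (\<lambda>t. (proj e d t, g t))" using homeomorphic_map_maps by blast
  then show ?thesis using f by (simp add: is_pullback_def)
qed

lemma is_pullback_coefficient_map:
  "is_pullback MA MB (proj e d) (conf_pt n) (uconf n) fst a (\<lambda>t. (a (proj e d t), t (e d)))"
proof (rule is_pullback_complement_space[where y = snd])
  have "continuous_map MA (uconf n) (\<lambda>t. a (proj e d t))"
    using continuous_map_compose[OF continuous_map_proj_complement continuous_map_coefficient_map] by (simp add: o_def)
  then show "continuous_map MA (conf_pt n) (\<lambda>t. (a (proj e d t), t (e d)))"
    using in_complement_space_iff[OF complement_space_subset_torus]
    by (intro continuous_map_conf_ptI continuous_map_complement_eval basis_in_carrier) auto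
  show "snd c \<notin> a x" if "c \<in> topspace (conf_pt n)" "a x = fst c" for x c
    using that by (auto simp: topspace_conf_pt)
qed (rule continuous_map_coefficient_map continuous_map_conf_pt_snd | simp add: prod_eq_iff)+

section \<open>Linear factors and the root map\<close>

context
  assumes m0_one: "\<And>j. j \<in> {1..l} \<Longrightarrow> m0 j = 1"
begin

private abbreviation (input) "b \<equiv> root_map d l m \<mu>"

lemma degree_eq: "n = l + 1" by (simp add: m0_one)

lemma root_map_image: "b x ` {..<n} = a x"
proof -
  have "{..<n} = insert 0 {1..l}" unfolding degree_eq by auto
  then show ?thesis by (auto simp: root_map_def coefficient_map_eq m0_one image_iff)
qed

lemma continuous_map_root_map: "continuous_map MB (conf n) b"
  unfolding continuous_map_conf
proof (intro conjI ballI allI impI)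
  have eq: "{..<n} = {..l}" unfolding degree_eq by auto
  show "b x \<in> extensional {..<n}" for x unfolding eq by (simp add: root_map_def)
  show "inj_on (b x) {..<n}" if "x \<in> topspace MB" for x
    \<comment> \<open>A map from \<open>n\<close> indices onto the \<open>n\<close> roots is
      injective.\<close>
    using card_coefficient_map(2)[OF that] root_map_image[of x] by (intro eq_card_imp_inj_on) auto
  fix i assume "i < n"
  then have "i \<le> l" unfolding degree_eq by simp
  then show "continuous_map MB euclidean (\<lambda>x. b x i)"
    using continuous_map_root_power[of i] by (cases "i = 0") (simp_all add: root_map_def)
qed

lemma is_pullback_root_map:
  "is_pullback MA MB (proj e d) (conf (n + 1)) (conf n) (\<lambda>c. restrict c {..<n}) b
     (\<lambda>t. (b (proj e d t))(n := t (e d)))"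
proof (rule is_pullback_complement_space[where y = "\<lambda>c. c n"])
  have bc: "b x \<in> extensional {..<n} \<and> inj_on (b x) {..<n}" if "x \<in> topspace MB" for x
    using continuous_map_image_subset_topspace[OF continuous_map_root_map] that by (auto simp: topspace_conf)
  have pB: "proj e d t \<in> topspace MB" "t (e d) \<notin> a (proj e d t)" if "t \<in> topspace MA" for t
    using in_complement_space_iff[OF complement_space_subset_torus[OF that]] that by auto
  show "continuous_map MA (conf (n + 1)) (\<lambda>t. (b (proj e d t))(n := t (e d)))"
    unfolding continuous_map_conf
  proof (intro conjI ballI allI impI)
    fix t assume t: "t \<in> topspace MA"
    let ?c = "(b (proj e d t))(n := t (e d))"
    show "?c \<in> extensional {..<n + 1}"
      using bc[OF pB(1)[OF t]] by (auto simp: extensional_def)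
    have "?c ` {..<n} = a (proj e d t)" using root_map_image[of "proj e d t"] by auto
    moreover have "inj_on ?c {..<n}"
      using bc[OF pB(1)[OF t]] by (subst inj_on_cong[of _ _ "b (proj e d t)"]) auto
    ultimately show "inj_on ?c {..<n + 1}"
      using pB(2)[OF t] by (simp add: lessThan_Suc)
  next
    fix i assume i: "i < n + 1"
    show "continuous_map MA euclidean (\<lambda>t. ((b (proj e d t))(n := t (e d))) i)"
    proof (cases "i = n")
      case False
      then have "i < n" using i by simp
      from continuous_map_compose[OF continuous_map_compose[OF continuous_map_proj_complement continuous_map_root_map]
          continuous_map_conf_proj[OF this]] False
      show ?thesis by (simp add: o_def)
    qed (use continuous_map_complement_eval[OF basis_in_carrier] in simp)
  qed
  show "continuous_map (conf (n + 1)) euclidean (\<lambda>c. c n)" by (rule continuous_map_conf_proj) simp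
  show "b (proj e d t) = restrict ((b (proj e d t))(n := t (e d))) {..<n}" if "t \<in> topspace MA" for t
    using bc[OF pB(1)[OF that]] by (auto simp: extensional_def fun_eq_iff restrict_def)
  show "c n \<notin> a x"
    if "x \<in> topspace MB" "c \<in> topspace (conf (n + 1))" "b x = restrict c {..<n}" for x c
  proof -
    have "c ` {..<n} = a x" using root_map_image[of x] that(3) by simp
    then show ?thesis using that(2) by (auto simp: topspace_conf lessThan_Suc)
  qed
  show "c = c'" if "c \<in> topspace (conf (n + 1))" "c' \<in> topspace (conf (n + 1))"
      "restrict c {..<n} = restrict c' {..<n}" "c n = c' n" for c c'
  proof (rule extensionalityI[of _ "{..<n + 1}"])
    show "c i = c' i" if "i \<in> {..<n + 1}" for i
      using fun_cong[OF \<open>restrict c {..<n} = restrict c' {..<n}\<close>, of i] that \<open>c n = c' n\<close>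
      by (cases "i = n") auto
  qed (use that in \<open>auto simp: topspace_conf\<close>)
qed (rule continuous_map_root_map | simp)+

end

end

section \<open>Independence of the chosen square, and the TM condition\<close>

lemma monodromy_cong:
  assumes i: "continuous_map F E i" and s: "continuous_map B E s"
    and f0: "f0 \<in> topspace F" "i f0 = s b0" and b0: "b0 \<in> topspace B"
    and eq: "\<And>z. z \<in> topspace F \<Longrightarrow> i z = i' z" "\<And>x. x \<in> topspace B \<Longrightarrow> s x = s' x"
  shows "monodromy F f0 i E B s b0 = monodromy F f0 i' E B s' b0"
proof -
  have i_eq: "induced_map E (s b0) i \<gamma> = induced_map E (s b0) i' \<gamma>"
    if "\<gamma> \<in> carrier (fundamental_group F f0)" for \<gamma>
    by (rule induced_map_cong[OF that i f0(2) eq(1)])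
  have s_eq: "induced_map E (s b0) s \<beta> = induced_map E (s b0) s' \<beta>"
    if "\<beta> \<in> carrier (fundamental_group B b0)" for \<beta>
    by (rule induced_map_cong[OF that s refl eq(2)])
  show ?thesis
    unfolding monodromy_def eq(2)[OF b0, symmetric]
    by (intro restrict_ext) (simp add: i_eq s_eq cong: conj_cong)
qed

lemma induced_map_compose:
  assumes f: "continuous_map X Y f" "f x0 = y0" and g: "continuous_map Y Z g" "g y0 = z0"
    and P: "P \<in> carrier (fundamental_group X x0)"
  shows "induced_map Z z0 g (induced_map Y y0 f P) = induced_map Z z0 (g \<circ> f) P"
proof -
  obtain p where p: "p \<in> loops X x0" "P = loop_class X x0 p"
    using P by (auto simp: carrier_fundamental_group)
  then show ?thesis
    using f g by (simp add: induced_map_loop_class[OF p(1)] induced_map_loop_class[OF loops_compose[OF p(1)]]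
      induced_map_loop_class[OF p(1) continuous_map_compose[OF f(1) g(1)]] comp_assoc)
qed

text \<open>The coordinate image is connected and finite, hence a single point. Applied to the last
  coordinate on \<open>H \<inter> Y\<close>, it turns connectedness into a count of roots.\<close>

lemma connectedin_finite_coordinate:
  assumes "connectedin (subtopology (product_topology (\<lambda>_. euclidean) I) T) S"
    and g: "g \<in> I" and fin: "finite ((\<lambda>t. t g) ` S)"
    and t: "t \<in> S" "t' \<in> S"
  shows "t g = (t' g :: complex)"
proof -
  have "continuous_map (subtopology (product_topology (\<lambda>_. euclidean) I) T) euclidean (\<lambda>t. t g :: complex)"
    by (intro continuous_map_from_subtopology continuous_map_product_projection g)
  from connectedin_continuous_map_image[OF this assms(1)]
  have "connected ((\<lambda>t. t g) ` S)" by simp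
  then obtain c where "(\<lambda>t. t g) ` S \<subseteq> {c}"
    using fin t(1) by (auto simp: connected_finite_iff_sing)
  then show ?thesis using t by auto
qed

text \<open>\<open>H \<inter> Y\<close> consists of \<open>k\<close> points, one for each \<open>k\<close>-th root of \<open>c\<close>.\<close>

lemma TM_ideal_degree_one:
  assumes basis: "lattice_basis \<Gamma> e (Suc d)"
    and Y: "Y = {t \<in> torus \<Gamma>. \<forall>i<d. t (e i) = 1}"
    and H: "H = {t \<in> torus \<Gamma>. t (e d) ^ k = c * monomial d v (proj e d t)}"
    and "k > 0" "c \<noteq> 0" and con: "connectedin (torus_topology \<Gamma>) (H \<inter> Y)"
  shows "k = 1"
proof -
  \<comment> \<open>Coordinates of the point of \<open>Y\<close> with last coordinate
    \<open>y\<close>; there the monomial is 1 and the equation of \<open>H\<close> becomes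
    \<open>y ^ k = c\<close>.\<close>
  define z where "z = (\<lambda>y i. if i < d then 1 else y :: complex)"
  have mon: "monomial d v (proj e d t) = 1" if "\<forall>i<d. t (e i) = 1" for t
    using that by (simp add: monomial_def proj_def)
  have "torus_point \<Gamma> e (Suc d) (z y) \<in> H \<inter> Y" if "y ^ k = c" for y
  proof -
    have "y \<noteq> 0" using that \<open>k > 0\<close> \<open>c \<noteq> 0\<close> by (auto simp: zero_power)
    then have "torus_point \<Gamma> e (Suc d) (z y) \<in> torus \<Gamma>"
      by (intro torus_point_in[OF basis]) (simp add: z_def)
    then show ?thesis
      using mon torus_point_basis[OF basis] that by (simp add: H Y z_def)
  qed
  moreover have "torus_point \<Gamma> e (Suc d) (z y) (e d) = y" for y
    using torus_point_basis[OF basis, of d] by (simp add: z_def)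
  moreover have "t (e d) \<in> {y. y ^ k = c}" if "t \<in> H \<inter> Y" for t
    using that mon[of t] by (simp add: H Y)
  ultimately have im: "(\<lambda>t. t (e d)) ` (H \<inter> Y) = {y. y ^ k = c}"
    by (intro subset_antisym image_subsetI subsetI) (auto intro: image_eqI[OF sym])
  have fin: "finite {y :: complex. y ^ k = c}" using finite_nth_roots[OF \<open>k > 0\<close>] .
  have "y = y'" if "y \<in> {y. y ^ k = c}" "y' \<in> {y. y ^ k = c}" for y y'
    using connectedin_finite_coordinate[OF con[unfolded torus_topology_def], of "e d"]
      basis_carrier[OF basis, of d] that fin unfolding im[symmetric] by auto
  then have "card {y. y ^ k = c} \<le> 1" by (simp add: card_le_Suc0_iff_eq[OF fin])
  \<comment> \<open>A nonzero number has exactly \<open>k\<close> complex \<open>k\<close>-th roots,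
    so at most one root means \<open>k = 1\<close>.\<close>
  then show ?thesis using card_nth_roots[OF \<open>c \<noteq> 0\<close> \<open>k > 0\<close>] \<open>k > 0\<close> by simp
qed

theorem proposition3p2p3:
  fixes \<Gamma> :: "'g monoid" and e :: "nat \<Rightarrow> 'g" and d l n :: nat
    and A :: "('g \<Rightarrow> complex) set set" and Y :: "('g \<Rightarrow> complex) set"
    and H :: "nat \<Rightarrow> ('g \<Rightarrow> complex) set"
    and m0 :: "nat \<Rightarrow> nat" and m :: "nat \<Rightarrow> nat \<Rightarrow> int" and \<mu> :: "nat \<Rightarrow> complex"
  assumes basis: "lattice_basis \<Gamma> e (d + 1)"
    and arrangement: "toric_arrangement \<Gamma> A"
    and corank_one: "corank_one \<Gamma> A Y"
    and M_ideal: "M_ideal \<Gamma> A Y"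
    and Y_coords: "Y = {t \<in> torus \<Gamma>. \<forall>i<d. t (e i) = 1}"
    and H_enum: "bij_betw H {1..l} (A - sub_arrangement \<Gamma> A Y)"
    and H_eq: "\<And>j. j \<in> {1..l} \<Longrightarrow>
        H j = {t \<in> torus \<Gamma>. t (e d) ^ m0 j - \<mu> j * monomial d (m j) (proj e d t) = 0}"
    and m0_pos: "\<And>j. j \<in> {1..l} \<Longrightarrow> m0 j > 0"
    and root_of_unity: "\<And>j. j \<in> {1..l} \<Longrightarrow> \<exists>k>0. \<mu> j ^ k = 1"
    and primitive: "\<And>j. j \<in> {1..l} \<Longrightarrow> Gcd (insert (int (m0 j)) (m j ` {..<d})) = 1"
  defines "n \<equiv> 1 + (\<Sum>j=1..l. m0 j)"
    and "MA \<equiv> complement_space \<Gamma> A"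
    and "MB \<equiv> coord_complement_space d (quotient_arrangement \<Gamma> e d A Y)"
    and "p \<equiv> proj e d"
    and "a \<equiv> coefficient_map d l m0 m \<mu>"
    and "b \<equiv> root_map d l m \<mu>"
    and "ga \<equiv> (\<lambda>t. (coefficient_map d l m0 m \<mu> (proj e d t), t (e d)))"
    and "gb \<equiv> (\<lambda>t. (root_map d l m \<mu> (proj e d t))(1 + (\<Sum>j=1..l. m0 j) := t (e d)))"
  shows
    "is_pullback MA MB p (conf_pt n) (uconf n) fst a ga \<and>
     (\<forall>x0\<in>topspace MB.
        fiber_bundle MA MB p (top_of_set (- a x0)) \<and>
        (\<forall>\<sigma> y \<alpha>. standard_artin_representation n (a x0) \<sigma> y \<alpha> \<longrightarrow>
           (\<forall>\<beta>\<in>carrier (fundamental_group MB x0).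
              monodromy (top_of_set (- a x0)) (far_point (a x0))
                (pullback_fiber MA p ga x0 (\<lambda>z. (a x0, z)))
                MA MB (pullback_section MA p ga a uconf_section) x0 \<beta>
              = \<alpha> (induced_map (uconf n) (a x0) a \<beta>)))) \<and>
     (TM_ideal \<Gamma> A Y \<longrightarrow>
        (\<forall>j\<in>{1..l}. m0 j = 1) \<and> n = l + 1 \<and>
        is_pullback MA MB p (conf (n + 1)) (conf n) (\<lambda>c. restrict c {..<n}) b gb \<and>
        (\<forall>x0\<in>topspace MB.
           (\<forall>\<sigma> y \<alpha>. standard_artin_representation n (a x0) \<sigma> y \<alpha> \<longrightarrow>
              (\<forall>\<beta>\<in>carrier (fundamental_group MB x0).
                 monodromy (top_of_set (- a x0)) (far_point (a x0))
                   (pullback_fiber MA p gb x0 (\<lambda>z. (b x0)(n := z)))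
                   MA MB (pullback_section MA p gb b (conf_section n)) x0 \<beta>
                 = pure_artin_representation n (a x0) \<alpha> (induced_map (conf n) (b x0) b \<beta>)))))"
proof -
  have basis': "lattice_basis \<Gamma> e (Suc d)" using basis by simp
  have A_torus: "K \<subseteq> torus \<Gamma>" if "K \<in> A" for K
  proof -
    obtain \<xi> where "K \<in> components_in \<Gamma> (character_kernel \<Gamma> \<xi>)"
      using arrangement \<open>K \<in> A\<close> unfolding toric_arrangement_def arrangement_of_def by blast
    then show ?thesis by (auto simp: components_in_iff character_kernel_def)
  qed
  have H_eq': "H j = {t \<in> torus \<Gamma>. t (e d) ^ m0 j = \<mu> j * monomial d (m j) (proj e d t)}"
    if "j \<in> {1..l}" for j
    using H_eq[OF that] by simp
  have \<mu>_nonzero: "\<mu> j \<noteq> 0" if "j \<in> {1..l}" for j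
    using root_of_unity[OF that] by (auto simp: power_0_left)
  note assms' = basis' A_torus M_ideal Y_coords H_enum H_eq' m0_pos \<mu>_nonzero
  have n: "n > 0" by (simp add: n_def)
  have pb: "is_pullback MA MB p (conf_pt n) (uconf n) fst a ga"
    unfolding n_def MA_def MB_def p_def a_def ga_def
    by (rule is_pullback_coefficient_map) (fact assms')+
  have a: "continuous_map MB (uconf n) a" by (rule is_pullback_base[OF pb])
  have fin: "finite (a x)" if "x \<in> topspace MB" for x
    using continuous_map_image_subset_topspace[OF a] that by (auto simp: topspace_uconf)
  have carrier_a: "induced_map (uconf n) (a x0) a \<beta> \<in> carrier (fundamental_group (uconf n) (a x0))"
    if "\<beta> \<in> carrier (fundamental_group MB x0)" for x0 \<beta>
    using that induced_map_loop_class[OF _ a refl] loops_compose[OF _ a refl]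
    by (auto simp: carrier_fundamental_group)
  have monodromy_a: "monodromy (top_of_set (- a x0)) (far_point (a x0))
      (pullback_fiber MA p ga x0 (\<lambda>z. (a x0, z)))
      MA MB (pullback_section MA p ga a uconf_section) x0 \<beta>
      = \<alpha> (induced_map (uconf n) (a x0) a \<beta>)"
    if "x0 \<in> topspace MB" "standard_artin_representation n (a x0) \<sigma> y \<alpha>"
      "\<beta> \<in> carrier (fundamental_group MB x0)" for x0 \<sigma> y \<alpha> \<beta>
    using monodromy_pullback[OF n pb that(1,3)] that(2) carrier_a[OF that(3)]
    by (simp add: standard_artin_representation_def braid_group_def)
  have part1: "fiber_bundle MA MB p (top_of_set (- a x0)) \<and>
        (\<forall>\<sigma> y \<alpha>. standard_artin_representation n (a x0) \<sigma> y \<alpha> \<longrightarrow>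
           (\<forall>\<beta>\<in>carrier (fundamental_group MB x0).
              monodromy (top_of_set (- a x0)) (far_point (a x0))
                (pullback_fiber MA p ga x0 (\<lambda>z. (a x0, z)))
                MA MB (pullback_section MA p ga a uconf_section) x0 \<beta>
              = \<alpha> (induced_map (uconf n) (a x0) a \<beta>)))" if "x0 \<in> topspace MB" for x0
    using fiber_bundle_pullback[OF pb that] monodromy_a[OF that] by blast
  have part2: "(\<forall>j\<in>{1..l}. m0 j = 1) \<and> n = l + 1 \<and>
        is_pullback MA MB p (conf (n + 1)) (conf n) (\<lambda>c. restrict c {..<n}) b gb \<and>
        (\<forall>x0\<in>topspace MB.
           (\<forall>\<sigma> y \<alpha>. standard_artin_representation n (a x0) \<sigma> y \<alpha> \<longrightarrow>
              (\<forall>\<beta>\<in>carrier (fundamental_group MB x0).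
                 monodromy (top_of_set (- a x0)) (far_point (a x0))
                   (pullback_fiber MA p gb x0 (\<lambda>z. (b x0)(n := z)))
                   MA MB (pullback_section MA p gb b (conf_section n)) x0 \<beta>
                 = pure_artin_representation n (a x0) \<alpha> (induced_map (conf n) (b x0) b \<beta>))))"
    if TM: "TM_ideal \<Gamma> A Y"
  proof -
    have m0_one: "m0 j = 1" if j: "j \<in> {1..l}" for j
    proof (rule TM_ideal_degree_one[OF basis' Y_coords H_eq'[OF j] m0_pos[OF j] \<mu>_nonzero[OF j]])
      have "H j \<in> A - sub_arrangement \<Gamma> A Y" using H_enum j by (auto simp: bij_betw_def)
      then show "connectedin (torus_topology \<Gamma>) (H j \<inter> Y)" using TM by (simp add: TM_ideal_def)
    qed
    have b_image: "b x ` {..<n} = a x" for x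
      unfolding n_def a_def b_def by (rule root_map_image) (fact assms' m0_one)+
    have pb2: "is_pullback MA MB p (conf (n + 1)) (conf n) (\<lambda>c. restrict c {..<n}) b gb"
      unfolding n_def MA_def MB_def p_def b_def gb_def
      by (rule is_pullback_root_map) (fact assms' m0_one)+
    note lift1 = is_pullback_lift[OF pb] and lift2 = is_pullback_lift[OF pb2]
    have b: "continuous_map MB (conf n) b" by (rule is_pullback_base[OF pb2])
    \<comment> \<open>Both comparison maps are inverted by the same point of \<open>MA\<close>, the
      one over \<open>x\<close> with last coordinate \<open>z\<close>. Hence the section and the
      fiber inclusion of the ordered square equal those of the unordered one wherever they matter,
      and the second monodromy reduces to the first.\<close>
    have lift_eq: "the_inv_into (topspace MA) (\<lambda>t. (p t, gb t)) (x, (b x)(n := z))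
        = the_inv_into (topspace MA) (\<lambda>t. (p t, ga t)) (x, (a x, z))"
      if x: "x \<in> topspace MB" and z: "z \<notin> a x" for x z
    proof -
      let ?t = "the_inv_into (topspace MA) (\<lambda>t. (p t, ga t)) (x, (a x, z))"
      have "(a x, z) \<in> topspace (conf_pt n)"
        using continuous_map_image_subset_topspace[OF a] x z
        by (auto simp: topspace_uconf topspace_conf_pt)
      then have t: "?t \<in> topspace MA" "p ?t = x" "ga ?t = (a x, z)"
        using lift1(5)[OF x] lift1(6)[OF x] lift1(7)[OF x] by auto
      have "gb ?t = (b x)(n := z)"
        using t(2,3) by (simp add: ga_def gb_def p_def b_def n_def)
      then show ?thesis using lift2(8)[OF t(1)] t(2) by simp
    qed
    have sec_eq: "pullback_section MA p gb b (conf_section n) x = pullback_section MA p ga a uconf_section x"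
      if "x \<in> topspace MB" for x
      using lift_eq[OF that far_point_notin[OF fin[OF that]]]
      by (simp add: pullback_section_def conf_section_def uconf_section_def b_image)
    have fib_eq: "pullback_fiber MA p gb x0 (\<lambda>z. (b x0)(n := z)) z
        = pullback_fiber MA p ga x0 (\<lambda>z. (a x0, z)) z"
      if "x0 \<in> topspace MB" "z \<notin> a x0" for x0 z
      using lift_eq[OF that] by (simp add: pullback_fiber_def)
    have "monodromy (top_of_set (- a x0)) (far_point (a x0))
          (pullback_fiber MA p gb x0 (\<lambda>z. (b x0)(n := z)))
          MA MB (pullback_section MA p gb b (conf_section n)) x0 \<beta>
        = pure_artin_representation n (a x0) \<alpha> (induced_map (conf n) (b x0) b \<beta>)"
      if x0: "x0 \<in> topspace MB" and \<alpha>: "standard_artin_representation n (a x0) \<sigma> y \<alpha>"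
        and \<beta>: "\<beta> \<in> carrier (fundamental_group MB x0)" for x0 \<sigma> y \<alpha> \<beta>
    proof -
      have "continuous_map (top_of_set (- a x0)) (conf_pt n) (\<lambda>z. (a x0, z))"
        using continuous_map_image_subset_topspace[OF a] x0
        by (intro continuous_map_conf_ptI) (auto simp: topspace_uconf)
      then have i: "continuous_map (top_of_set (- a x0)) MA (pullback_fiber MA p ga x0 (\<lambda>z. (a x0, z)))"
        unfolding pullback_fiber_def using x0 by (intro lift1(9)) auto
      have s: "continuous_map MB MA (pullback_section MA p ga a uconf_section)"
        unfolding pullback_section_def
      proof (rule lift1(9))
        have "continuous_map MB (conf_pt n) (\<lambda>x. (a x, far_point (a x)))"
          using continuous_map_compose[OF a continuous_map_far_point[OF n]] fin far_point_notin
          by (intro continuous_map_conf_ptI[OF a]) (auto simp: o_def)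
        then show "continuous_map MB (conf_pt n) (\<lambda>x. uconf_section (a x))"
          by (simp add: uconf_section_def)
      qed (simp_all add: uconf_section_def)
      have "monodromy (top_of_set (- a x0)) (far_point (a x0))
            (pullback_fiber MA p ga x0 (\<lambda>z. (a x0, z)))
            MA MB (pullback_section MA p ga a uconf_section) x0
          = monodromy (top_of_set (- a x0)) (far_point (a x0))
            (pullback_fiber MA p gb x0 (\<lambda>z. (b x0)(n := z)))
            MA MB (pullback_section MA p gb b (conf_section n)) x0"
        by (rule monodromy_cong[OF i s])
          (use x0 far_point_notin[OF fin[OF x0]] fib_eq[OF x0] sec_eq in
            \<open>simp_all add: pullback_fiber_def pullback_section_def uconf_section_def\<close>)
      \<comment> \<open>Forgetting the numbering of the root map gives the coefficient map, so
        restricting the Artin representation to pure braids along the root map evaluates it along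
        the coefficient map.\<close>
      moreover have "induced_map (uconf n) (a x0) (\<lambda>c. c ` {..<n}) (induced_map (conf n) (b x0) b \<beta>)
          = induced_map (uconf n) (a x0) a \<beta>"
      proof -
        have "(\<lambda>c. c ` {..<n}) \<circ> b = a" by (simp add: fun_eq_iff b_image)
        then show ?thesis
          using induced_map_compose[OF b refl quotient_imp_continuous_map[OF quotient_uconf] _ \<beta>,
              where ?z0.0 = "a x0"]
          by (simp add: b_image)
      qed
      ultimately show ?thesis
        using monodromy_a[OF x0 \<alpha> \<beta>] by (simp add: pure_artin_representation_def)
    qed
    moreover have "n = l + 1" by (simp add: n_def m0_one)
    ultimately show ?thesis using m0_one pb2 by blast
  qed
  show ?thesis using pb part1 part2 by blast
qed

end
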